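(* Let $A,B\subseteq\mathbb{R}^2$ be measurable sets such that $\overline{\delta}_{VC}(A,B)>0$. Let $\Gamma\subseteq\mathbb{R}^2$ be a closed, smooth, centrally symmetric (that is, $-\Gamma=\Gamma$) planar curve of non-vanishing curvature which is the boundary of some compact convex region in the plane with non-empty interior. Then there exists $t_0>0$ such that for every $t\geq t_0$ there exist a point $x\in B$ and vectors $v_1,v_2,v_3,s_1,s_2,s_3\in t\Gamma$ such that $$x,\ x+v_1+v_2,\ x+v_1+v_3,\ x+v_2+v_3,\ x+v_1+s_1,\ x+v_2+s_2,\ x+v_3+s_3\in B,$$ $$x+v_1,\ x+v_2,\ x+v_3\in A,$$ and all $10$ points listed above are mutually distinct.
   Context: For measurable $A,B\subseteq\mathbb{R}^2$ and $x,v_1,v_2,v_3,s_1,s_2,s_3\in\mathbb{R}^2$ let $$\begin{aligned}\mathcal{F}_{A,B}(x;v_1,v_2,v_3;s_1,s_2,s_3):={}&\mathbb{1}_B(x)\,\mathbb{1}_A(x+v_1)\mathbb{1}_A(x+v_2)\mathbb{1}_A(x+v_3)\\&\cdot\mathbb{1}_B(x+v_1+v_2)\mathbb{1}_B(x+v_1+v_3)\mathbb{1}_B(x+v_2+v_3)\\&\cdot\mathbb{1}_B(x+v_1+s_1)\mathbb{1}_B(x+v_2+s_2)\mathbb{1}_B(x+v_3+s_3),\end{aligned}$$ where $\mathbb{1}_S$ is the indicator function of $S$, and define $$\overline{\delta}_{VC}(A,B):=\sup_{M\geq1}\ \limsup_{R\to+\infty}\ \sup_{z\in\mathbb{R}^2}\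 \inf_{M\leq r\leq2^{-6}R}\ \frac{1}{(2r)^{12}R^2}\int_{z+[0,R]^2}\int_{([-r,r]^2)^6}\mathcal{F}_{A,B}(x;v_1,v_2,v_3;s_1,s_2,s_3)\,dv_1\,dv_2\,dv_3\,ds_1\,ds_2\,ds_3\,dx .$$ *)

theory Defs
  imports "HOL-Analysis.Analysis"
begin

definition vc_form ::
  "(real^2) set \<Rightarrow> (real^2) set \<Rightarrow> real^2 \<Rightarrow> real^2 \<Rightarrow> real^2 \<Rightarrow> real^2 \<Rightarrow> real^2 \<Rightarrow> real^2 \<Rightarrow> real^2 \<Rightarrow> real"
  where
  "vc_form A B x v1 v2 v3 s1 s2 s3 =
     indicator B x * indicator A (x + v1) * indicator A (x + v2) * indicator A (x + v3)
     * indicator B (x + v1 + v2) * indicator B (x + v1 + v3) * indicator B (x + v2 + v3)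
     * indicator B (x + v1 + s1) * indicator B (x + v2 + s2) * indicator B (x + v3 + s3)"

definition square :: "real \<Rightarrow> (real^2) set"
  where "square r = cbox (vec (- r)) (vec r)"

definition vc_average ::
  "(real^2) set \<Rightarrow> (real^2) set \<Rightarrow> real \<Rightarrow> real^2 \<Rightarrow> real \<Rightarrow> real"
  where
  "vc_average A B R z r =
     1 / ((2 * r) ^ 12 * R\<^sup>2) *
     (LINT x:cbox z (z + vec R)|lebesgue.
        (LINT (v1, v2, v3, s1, s2, s3):
             square r \<times> square r \<times> square r \<times> square r \<times> square r \<times> square r|lebesgue.
           vc_form A B x v1 v2 v3 s1 s2 s3))"

text \<open>
  The averages lie in $[0,1]$. They are embedded in the extended reals only so that suprema,
  infima and upper limits are always defined. The infimum over an empty range of $r$, which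
  occurs only for $R < 2^6 M$, does not influence the upper limit as $R \to \infty$.
\<close>

definition vc_density :: "(real^2) set \<Rightarrow> (real^2) set \<Rightarrow> ereal"
  where
  "vc_density A B =
     (SUP M\<in>{1::real..}.
        Limsup at_top (\<lambda>R::real.
          SUP z. INF r\<in>{M..R / 2 ^ 6}. ereal (vc_average A B R z r)))"

definition nth_vector_derivative :: "nat \<Rightarrow> (real \<Rightarrow> real^2) \<Rightarrow> real \<Rightarrow> real^2"
  where "nth_vector_derivative n = (\<lambda>g t. vector_derivative g (at t)) ^^ n"

definition smooth :: "(real \<Rightarrow> real^2) \<Rightarrow> bool"
  where "smooth \<gamma> \<longleftrightarrow> (\<forall>n t. nth_vector_derivative n \<gamma> differentiable (at t))"

text \<open>Signed curvature $\det(\gamma', \gamma'') / |\gamma'|^3$ of a regular plane curve.\<close>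

definition curvature :: "(real \<Rightarrow> real^2) \<Rightarrow> real \<Rightarrow> real"
  where
  "curvature \<gamma> t =
     (let d1 = nth_vector_derivative 1 \<gamma> t; d2 = nth_vector_derivative 2 \<gamma> t
      in (d1 $ 1 * d2 $ 2 - d1 $ 2 * d2 $ 1) / norm d1 ^ 3)"

text \<open>
  A closed curve is a subset of the plane that has an \<open>L\<close>-periodic parametrization, injective
  on a period. Smoothness of the curve includes regularity of the parametrization.
\<close>

definition closed_smooth_param :: "(real \<Rightarrow> real^2) \<Rightarrow> real \<Rightarrow> (real^2) set \<Rightarrow> bool"
  where
  "closed_smooth_param \<gamma> L \<Gamma> \<longleftrightarrow>
     smooth \<gamma> \<and> L > 0 \<and> (\<forall>t. \<gamma> (t + L) = \<gamma> t) \<and> inj_on \<gamma> {0..<L} \<and>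
     (\<forall>t. nth_vector_derivative 1 \<gamma> t \<noteq> 0) \<and> \<Gamma> = range \<gamma>"

definition closed_smooth_curve_nonvanishing_curvature :: "(real^2) set \<Rightarrow> bool"
  where
  "closed_smooth_curve_nonvanishing_curvature \<Gamma> \<longleftrightarrow>
     (\<exists>\<gamma> L. closed_smooth_param \<gamma> L \<Gamma> \<and> (\<forall>t. curvature \<gamma> t \<noteq> 0))"

end

theory Submission
  imports Defs
begin

text \<open>
  Discretize the plane at a small spacing \<open>h\<close>, on a torus so large that no configuration wraps
  around; compactness of the arcs and of compact subsets of \<open>A\<close> and \<open>B\<close> turns approximate
  configurations for all \<open>h\<close> into an exact one. Suppose that the conclusion fails for arbitrarily
  large dilations, and choose a sparse sequence of them.

  Structured part: averages over boxes are compared through nonnegative differences of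
  three-dimensional cube forms at consecutive scales. These differences telescope, so at one of boundedly
  many dilations they are small. At that dilation the vectors may be moved freely between any two sets
  that are invariant at the small scale and dense in the large box. In particular they may be moved
  from boxes, where the density hypothesis bounds the average from below, to thick neighbourhoods of
  arcs of \<open>t \<Gamma>\<close>.

  Uniform part: thick neighbourhoods are replaced by neighbourhoods of width comparable to
  \<open>h\<close>. Squaring the operator given by averaging over a neighbourhood of the graph of \<open>\<phi>\<close> leaves the
  differences of pairs of points of the graph; for a fixed horizontal difference \<open>d\<close> the vertical
  one, \<open>\<phi> (u + d) - \<phi> u\<close>, is strictly monotone in \<open>u\<close> because of the curvature, so vertical shifts
  hardly matter.
\<close>

section \<open>Averages over finite sets\<close>

text \<open>The order of the constants shapes the argument. The curvature estimate tolerates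
  vertical shifts up to a fixed multiple of the dilation and so dictates how thick the arcs may be.
  The small scale must be much shorter than this thickness, the large scale much longer than the
  dilation, and the number of dilations needed for the pigeonhole depends on both. None of these
  depends on \<open>h\<close>: finitely many dilations are fixed before \<open>h\<close> tends to 0,
  so one of them serves arbitrarily small errors. Dimension three arises as follows. Moving one
  vector \<open>v\<close> acts on a product over vertices of a parallelogram spanned by the other
  two; correlating this product with a translate of itself produces the eight vertices of a cube.
  Each vector \<open>s\<close> meets one further point only, and for these two-point correlations of
  \<open>B\<close> suffice.\<close>

definition avg :: "'a set \<Rightarrow> ('a \<Rightarrow> real) \<Rightarrow> real"
  where "avg S f = (\<Sum>v\<in>S. f v) / card S"

lemma avg_cong: "(\<And>v. v \<in> S \<Longrightarrow> f v = g v) \<Longrightarrow> avg S f = avg S g"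
  by (simp add: avg_def)

lemma avg_const: "finite S \<Longrightarrow> S \<noteq> {} \<Longrightarrow> avg S (\<lambda>_. c) = c"
  by (simp add: avg_def)

lemma avg_add: "avg S (\<lambda>v. f v + g v) = avg S f + avg S g"
  by (simp add: avg_def sum.distrib add_divide_distrib)

lemma avg_diff: "avg S (\<lambda>v. f v - g v) = avg S f - avg S g"
  by (simp add: avg_def sum_subtractf diff_divide_distrib)

lemma avg_cmult: "avg S (\<lambda>v. c * f v) = c * avg S f"
  by (simp add: avg_def sum_distrib_left)

lemma avg_multc: "avg S (\<lambda>v. f v * c) = avg S f * c"
  by (simp add: avg_def sum_distrib_right)

lemma avg_divc: "avg S (\<lambda>v. f v / c) = avg S f / c"
  by (simp add: avg_def sum_divide_distrib mult.commute)

lemma avg_mono: "(\<And>v. v \<in> S \<Longrightarrow> f v \<le> g v) \<Longrightarrow> avg S f \<le> avg S g"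
  by (simp add: avg_def divide_right_mono sum_mono)

lemma avg_nonneg: "(\<And>v. v \<in> S \<Longrightarrow> 0 \<le> f v) \<Longrightarrow> 0 \<le> avg S f"
  by (simp add: avg_def sum_nonneg)

text \<open>An average over an empty or infinite set is 0 by the conventions for
  \<open>card\<close>, sums and division, so \<open>0 \<le> c\<close> stands in place of assumptions
  on \<open>S\<close>.\<close>

lemma avg_le_const: "(\<And>v. v \<in> S \<Longrightarrow> f v \<le> c) \<Longrightarrow> 0 \<le> c \<Longrightarrow> avg S f \<le> c"
proof (cases "finite S \<and> S \<noteq> {}")
  case True
  assume "\<And>v. v \<in> S \<Longrightarrow> f v \<le> c"
  then have "avg S f \<le> avg S (\<lambda>_. c)" by (rule avg_mono)
  with True show ?thesis by (simp add: avg_const)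
qed (auto simp: avg_def)

lemma abs_avg_le: "\<bar>avg S f\<bar> \<le> avg S (\<lambda>v. \<bar>f v\<bar>)"
  by (simp add: avg_def abs_divide divide_right_mono sum_abs)

lemma abs_avg_le_const: "(\<And>v. v \<in> S \<Longrightarrow> \<bar>f v\<bar> \<le> c) \<Longrightarrow> 0 \<le> c \<Longrightarrow> \<bar>avg S f\<bar> \<le> c"
  by (rule order_trans[OF abs_avg_le avg_le_const])

lemma avg_swap: "avg S (\<lambda>v. avg U (\<lambda>u. f v u)) = avg U (\<lambda>u. avg S (\<lambda>v. f v u))"
  unfolding avg_def sum_divide_distrib[symmetric] by (subst sum.swap) (simp add: mult.commute)

lemma avg_bij: "bij_betw k S U \<Longrightarrow> avg S (\<lambda>v. f (k v)) = avg U f"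
  by (simp add: avg_def sum.reindex_bij_betw bij_betw_same_card)

lemma avg_Times: "avg (S \<times> U) f = avg S (\<lambda>v. avg U (\<lambda>u. f (v, u)))"
  by (simp add: avg_def sum.cartesian_product card_cartesian_product
      sum_divide_distrib[symmetric] mult.commute split_def)

lemma avg_mult_avg: "avg S f * avg U g = avg S (\<lambda>v. avg U (\<lambda>u. f v * g u))"
  by (simp add: avg_cmult avg_multc)

lemma abs_avg_diff_le: "\<bar>avg S f - avg S g\<bar> \<le> avg S (\<lambda>v. \<bar>f v - g v\<bar>)"
  using abs_avg_le[of S "\<lambda>v. f v - g v"] by (simp add: avg_diff)

text \<open>Completing the square. With a free \<open>\<theta>\<close> this replaces the
  Cauchy-Schwarz inequality: a small second moment bounds a first moment without square roots, and
  errors keep the shape \<open>\<theta> + defect / \<theta>\<close>.\<close>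

lemma abs_le_weighted_square:
  fixes a \<theta> :: real assumes "\<theta> > 0" shows "2 * \<bar>a\<bar> \<le> \<theta> + a\<^sup>2 / \<theta>"
proof -
  have "0 \<le> (\<bar>a\<bar> - \<theta>)\<^sup>2 / \<theta>" using assms by simp
  also have "\<dots> = a\<^sup>2 / \<theta> - 2 * \<bar>a\<bar> + \<theta>" using assms
    by (simp add: power2_diff field_simps power2_eq_square)
  finally show ?thesis by simp
qed

lemma avg_abs_le_square:
  assumes "\<theta> > 0" shows "2 * avg S (\<lambda>v. \<bar>f v\<bar>) \<le> \<theta> + avg S (\<lambda>v. (f v)\<^sup>2) / \<theta>"
proof -
  have "2 * avg S (\<lambda>v. \<bar>f v\<bar>) = avg S (\<lambda>v. 2 * \<bar>f v\<bar>)" by (simp add: avg_cmult)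
  also have "\<dots> \<le> avg S (\<lambda>v. \<theta> + (f v)\<^sup>2 / \<theta>)"
    by (intro avg_mono abs_le_weighted_square assms)
  also have "\<dots> = avg S (\<lambda>v. \<theta>) + avg S (\<lambda>v. (f v)\<^sup>2) / \<theta>"
    by (simp add: avg_add avg_divc)
  also have "avg S (\<lambda>v. \<theta>) \<le> \<theta>" using assms by (intro avg_le_const) auto
  finally show ?thesis by simp
qed

text \<open>One half of the symmetric difference of \<open>S\<close> and its translate. A finite set
  and its translate have equal size, so the other half is equally large; hence the factor 2 in
  \<open>avg_translate_le\<close>.\<close>

definition sym_diff_card :: "(int \<times> int) set \<Rightarrow> int \<times> int \<Rightarrow> nat"
  where "sym_diff_card S p = card (S - (+) p ` S)"

lemma avg_translate_le:
  fixes S :: "(int \<times> int) set"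
  assumes "finite S" and "\<And>v. \<bar>g v\<bar> \<le> 1"
  shows "\<bar>avg S (\<lambda>v. g (p + v)) - avg S g\<bar> \<le> 2 * real (sym_diff_card S p) / card S"
proof -
  let ?S' = "(+) p ` S"
  have inj: "inj_on ((+) p) S" by (simp add: inj_on_def)
  have eq: "(\<Sum>v\<in>S. g (p + v)) = sum g ?S'" by (simp add: sum.reindex[OF inj])
  have c: "card ?S' = card S" by (rule card_image[OF inj])
  have f': "finite ?S'" using assms by simp
  have s1: "sum g ?S' = sum g (?S' - S) + sum g (?S' \<inter> S)"
    using f' by (metis Int_commute add.commute sum.Int_Diff)
  have s2: "sum g S = sum g (S - ?S') + sum g (?S' \<inter> S)"
    using assms(1) by (metis Int_commute add.commute sum.Int_Diff)
  have "card (?S' - S) = card (S - ?S')"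
    using card_Diff_subset_Int[of ?S' S] card_Diff_subset_Int[of S ?S'] assms(1) c
    by (simp add: Int_commute)
  moreover have "\<bar>sum g C\<bar> \<le> card C" for C
    using sum_norm_le[of C g "\<lambda>_. 1"] assms(2) by auto
  ultimately have "\<bar>sum g ?S' - sum g S\<bar> \<le> 2 * real (sym_diff_card S p)"
    using s1 s2 unfolding sym_diff_card_def
    by (smt (verit, best))
  then show ?thesis unfolding avg_def eq diff_divide_distrib[symmetric] abs_divide
    by (simp add: divide_right_mono)
qed

definition Box :: "nat \<Rightarrow> (int \<times> int) set"
  where "Box l = {0..<int l} \<times> {0..<int l}"

lemma finite_Box [simp]: "finite (Box l)" by (simp add: Box_def)
lemma card_Box [simp]: "card (Box l) = l\<^sup>2" by (simp add: Box_def power2_eq_square)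
lemma Box_ne: "l > 0 \<Longrightarrow> Box l \<noteq> {}" by (simp add: Box_def)

text \<open>Differences of two points of a box, rather than the points themselves: the resulting
  triangular weight is positive definite, and correlations averaged against it become inner products
  of box averages.\<close>

definition diff_avg :: "nat \<Rightarrow> (int \<times> int \<Rightarrow> real) \<Rightarrow> real"
  where "diff_avg l f = avg (Box l) (\<lambda>p. avg (Box l) (\<lambda>q. f (q - p)))"

lemma diff_avg_mono: "(\<And>v. f v \<le> g v) \<Longrightarrow> diff_avg l f \<le> diff_avg l g"
  unfolding diff_avg_def by (intro avg_mono)

lemma diff_avg_nonneg: "(\<And>v. 0 \<le> f v) \<Longrightarrow> 0 \<le> diff_avg l f"
  unfolding diff_avg_def by (intro avg_nonneg)

lemma diff_avg_diff: "diff_avg l (\<lambda>v. f v - g v) = diff_avg l f - diff_avg l g"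
  unfolding diff_avg_def by (simp add: avg_diff)

lemma diff_avg_add: "diff_avg l (\<lambda>v. f v + g v) = diff_avg l f + diff_avg l g"
  unfolding diff_avg_def by (simp add: avg_add)

lemma diff_avg_divc: "diff_avg l (\<lambda>v. f v / c) = diff_avg l f / c"
  unfolding diff_avg_def by (simp add: avg_divc)

lemma diff_avg_le_const: "(\<And>v. f v \<le> c) \<Longrightarrow> 0 \<le> c \<Longrightarrow> diff_avg l f \<le> c"
  unfolding diff_avg_def by (intro avg_le_const)

lemma abs_diff_avg_le: "\<bar>diff_avg l f\<bar> \<le> diff_avg l (\<lambda>v. \<bar>f v\<bar>)"
  unfolding diff_avg_def
  by (rule order_trans[OF abs_avg_le avg_mono]) (rule abs_avg_le)

lemma diff_avg_swap:
  "diff_avg k (\<lambda>v. diff_avg l (\<lambda>w. f v w)) = diff_avg l (\<lambda>w. diff_avg k (\<lambda>v. f v w))"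
proof -
  have "diff_avg k (\<lambda>v. diff_avg l (\<lambda>w. f v w)) =
    avg (Box k) (\<lambda>p. avg (Box l) (\<lambda>r. avg (Box k) (\<lambda>q. avg (Box l) (\<lambda>s. f (q - p) (s - r)))))"
    unfolding diff_avg_def by (subst avg_swap) simp
  also have "\<dots> = avg (Box l) (\<lambda>r. avg (Box k) (\<lambda>p. avg (Box l) (\<lambda>s. avg (Box k) (\<lambda>q. f (q - p) (s - r)))))"
    by (subst avg_swap, subst (3) avg_swap) simp
  also have "\<dots> = diff_avg l (\<lambda>w. diff_avg k (\<lambda>v. f v w))"
    unfolding diff_avg_def by (subst avg_swap) simp
  finally show ?thesis .
qed

text \<open>A difference of two elements of a box of side \<open>l\<close> takes every value in the box of
  half the size at least \<open>(l/2)\<^sup>2\<close> times.\<close>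

lemma avg_le_diff_avg:
  fixes S :: "(int \<times> int) set" and Q :: real
  assumes fin: "finite S" and ne: "S \<noteq> {}" and l: "l > 0"
    and S: "\<And>v. v \<in> S \<Longrightarrow> 2 * \<bar>fst v\<bar> \<le> int l \<and> 2 * \<bar>snd v\<bar> \<le> int l"
    and f: "\<And>v. 0 \<le> f v"
    and Q: "(real l)\<^sup>2 \<le> Q * card S"
  shows "avg S f \<le> 4 * Q * diff_avg l f"
proof -
  have one: "(real l)\<^sup>2 / 4 \<le> card {p \<in> Box l. p + v \<in> Box l}" if "v \<in> S" for v
  proof -
    obtain a b where v: "v = (a, b)" by (cases v)
    have ab: "2 * \<bar>a\<bar> \<le> int l" "2 * \<bar>b\<bar> \<le> int l" using S[OF that] v by auto
    have e: "{p \<in> Box l. p + v \<in> Box l}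
       = {max 0 (-a)..<min (int l) (int l - a)} \<times> {max 0 (-b)..<min (int l) (int l - b)}"
      unfolding v Box_def by auto
    have "real l / 2 \<le> nat (min (int l) (int l - a) - max 0 (-a))" using ab by linarith
    moreover have "real l / 2 \<le> nat (min (int l) (int l - b) - max 0 (-b))" using ab by linarith
    ultimately have "real l / 2 * (real l / 2) \<le> real (nat (min (int l) (int l - a) - max 0 (-a)))
        * real (nat (min (int l) (int l - b) - max 0 (-b)))"
      by (intro mult_mono) auto
    then show ?thesis unfolding e by (simp add: card_cartesian_product power2_eq_square)
  qed
  have "(\<Sum>v\<in>S. f v) * ((real l)\<^sup>2 / 4) \<le> (\<Sum>v\<in>S. f v * card {p \<in> Box l. p + v \<in> Box l})"
    unfolding sum_distrib_right by (intro sum_mono mult_left_mono one f)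
  also have "\<dots> = (\<Sum>v\<in>S. \<Sum>p\<in>{p \<in> Box l. p + v \<in> Box l}. f v)"
    by (simp add: mult.commute)
  also have "\<dots> = (\<Sum>(v,p)\<in>Sigma S (\<lambda>v. {p \<in> Box l. p + v \<in> Box l}). f v)"
    by (subst sum.Sigma) (use fin in \<open>auto simp: split_def\<close>)
  also have "\<dots> = (\<Sum>(p,q)\<in>(\<lambda>(v,p). (p, p + v)) ` Sigma S (\<lambda>v. {p \<in> Box l. p + v \<in> Box l}). f (q - p))"
    by (subst sum.reindex) (auto simp: inj_on_def split_def)
  also have "\<dots> \<le> (\<Sum>(p,q)\<in>Box l \<times> Box l. f (q - p))"
    by (intro sum_mono2) (auto simp: f)
  also have "\<dots> = diff_avg l f * ((real l)\<^sup>2 * (real l)\<^sup>2)"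
    using l by (simp add: diff_avg_def avg_def sum_divide_distrib[symmetric] sum.cartesian_product)
  finally have "(\<Sum>v\<in>S. f v) * (real l)\<^sup>2 / 4 \<le> diff_avg l f * ((real l)\<^sup>2 * (real l)\<^sup>2)" by simp
  then have "(\<Sum>v\<in>S. f v) * (real l)\<^sup>2 \<le> (4 * diff_avg l f * (real l)\<^sup>2) * (real l)\<^sup>2"
    by (simp add: power4_eq_xxxx power2_eq_square algebra_simps)
  then have "(\<Sum>v\<in>S. f v) \<le> 4 * diff_avg l f * (real l)\<^sup>2"
    using l by (subst (asm) mult_le_cancel_right) auto
  also have "\<dots> \<le> 4 * diff_avg l f * (Q * card S)"
    by (intro mult_left_mono Q mult_nonneg_nonneg diff_avg_nonneg f) auto
  finally show ?thesis using fin ne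
    unfolding avg_def by (simp add: divide_le_eq card_gt_0_iff mult.commute mult.left_commute)
qed

section \<open>Finite actions of the integer lattice\<close>

text \<open>A probability-preserving action of the integer lattice on a finite set with uniform
  measure; finiteness removes questions of measurability and convergence. The composition law is
  demanded at every point of the type so that it can serve as an unconditional rewrite rule.\<close>

locale shift_system =
  fixes X :: "'x set" and T :: "int \<times> int \<Rightarrow> 'x \<Rightarrow> 'x"
  assumes finite_X: "finite X" and X_ne: "X \<noteq> {}"
    and T_closed: "x \<in> X \<Longrightarrow> T v x \<in> X"
    and T_T [simp]: "T u (T v x) = T (u + v) x"
    and T_0: "x \<in> X \<Longrightarrow> T 0 x = x"
begin

abbreviation E :: "('x \<Rightarrow> real) \<Rightarrow> real"
  where "E \<equiv> avg X"

lemma T_bij: "bij_betw (T v) X X"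
proof (rule bij_betw_byWitness[where f' = "T (- v)"])
qed (auto simp: T_closed T_0)

lemma E_shift: "E (\<lambda>x. f (T v x)) = E f"
  by (rule avg_bij[OF T_bij])

section \<open>Box averages and the energy they lose between scales\<close>

definition box_avg :: "nat \<Rightarrow> ('x \<Rightarrow> real) \<Rightarrow> 'x \<Rightarrow> real"
  where "box_avg l g x = avg (Box l) (\<lambda>p. g (T p x))"

text \<open>By invariance of \<open>E\<close>, the correlation at \<open>q - p\<close> is the mean
  of \<open>g (T p x) * h (T q x)\<close>, and the averages over \<open>p\<close> and
  \<open>q\<close> factor for each fixed \<open>x\<close>.\<close>

lemma diff_avg_corr:
  "diff_avg l (\<lambda>v. E (\<lambda>x. g x * h (T v x))) = E (\<lambda>x. box_avg l g x * box_avg l h x)"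
proof -
  have "diff_avg l (\<lambda>v. E (\<lambda>x. g x * h (T v x)))
     = avg (Box l) (\<lambda>p. avg (Box l) (\<lambda>q. E (\<lambda>x. g (T p x) * h (T q x))))"
    unfolding diff_avg_def
  proof (rule avg_cong, rule avg_cong)
    fix p q
    show "E (\<lambda>x. g x * h (T (q - p) x)) = E (\<lambda>x. g (T p x) * h (T q x))"
      using E_shift[of "\<lambda>x. g x * h (T (q - p) x)" p] by simp
  qed
  also have "\<dots> = avg (Box l) (\<lambda>p. E (\<lambda>x. avg (Box l) (\<lambda>q. g (T p x) * h (T q x))))"
    by (subst avg_swap) simp
  also have "\<dots> = E (\<lambda>x. avg (Box l) (\<lambda>p. avg (Box l) (\<lambda>q. g (T p x) * h (T q x))))"
    by (rule avg_swap)
  finally show ?thesis by (simp add: box_avg_def avg_mult_avg)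
qed

definition grid :: "nat \<Rightarrow> nat \<Rightarrow> (int \<times> int) set"
  where "grid l k = (\<lambda>q. (int l * fst q, int l * snd q)) ` Box k"

lemma finite_grid: "finite (grid l k)" by (simp add: grid_def)
lemma grid_ne: "k > 0 \<Longrightarrow> grid l k \<noteq> {}" by (simp add: grid_def Box_ne)

text \<open>Division with remainder tiles the large box by translates of the small one along
  \<open>grid l k\<close>. This is why each scale has to divide the next.\<close>

lemma box_avg_grid:
  assumes l: "l > 0"
  shows "box_avg (l * k) g x = avg (grid l k) (\<lambda>q. box_avg l g (T q x))"
proof -
  let ?s = "\<lambda>q. (int l * fst q, int l * snd q)"
  let ?m = "\<lambda>(q, p). p + ?s q"
  have inj: "inj_on ?s (Box k)" using l by (auto simp: inj_on_def prod_eq_iff)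
  have bij: "bij_betw ?m (Box k \<times> Box l) (Box (l * k))"
  proof (rule bij_betw_byWitness[where f' = "\<lambda>v. ((fst v div int l, snd v div int l), (fst v mod int l, snd v mod int l))"])
    show "\<forall>a\<in>Box k \<times> Box l. (\<lambda>v. ((fst v div int l, snd v div int l), (fst v mod int l, snd v mod int l))) (?m a) = a"
      using l by (auto simp: Box_def)
    show "\<forall>a'\<in>Box (l * k). ?m ((fst a' div int l, snd a' div int l), (fst a' mod int l, snd a' mod int l)) = a'"
      by (auto simp: Box_def)
    have lt: "p + int l * q < int l * int k" if "p < int l" "q < int k" for p q
    proof -
      have "int l * (q + 1) \<le> int l * int k" using that l by (intro mult_left_mono) auto
      then show ?thesis using that by (simp add: algebra_simps)
    qed
    show "?m ` (Box k \<times> Box l) \<subseteq> Box (l * k)"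
      by (auto simp: Box_def intro!: lt)
    have lt': "p div int l < int k" if "p < int l * int k" "0 \<le> p" for p
    proof (rule ccontr)
      assume "\<not> p div int l < int k"
      then have "int l * int k \<le> int l * (p div int l)" by (intro mult_left_mono) auto
      also have "\<dots> \<le> p" using l mult_div_mod_eq[of "int l" p] pos_mod_sign[of "int l" p] by linarith
      finally show False using that by simp
    qed
    show "(\<lambda>v. ((fst v div int l, snd v div int l), (fst v mod int l, snd v mod int l))) ` Box (l * k) \<subseteq> Box k \<times> Box l"
      using l by (auto simp: Box_def pos_imp_zdiv_nonneg_iff intro!: lt')
  qed
  have "avg (grid l k) (\<lambda>q. box_avg l g (T q x)) = avg (Box k) (\<lambda>q. box_avg l g (T (?s q) x))"
    unfolding grid_def by (rule avg_bij[symmetric]) (simp add: inj inj_on_imp_bij_betw)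
  also have "\<dots> = avg (Box k) (\<lambda>q. avg (Box l) (\<lambda>p. g (T (p + ?s q) x)))"
    by (simp add: box_avg_def)
  also have "\<dots> = avg (Box k \<times> Box l) (\<lambda>a. g (T (?m a) x))"
    by (simp add: avg_Times)
  also have "\<dots> = box_avg (l * k) g x"
    unfolding box_avg_def by (rule avg_bij[OF bij, of "\<lambda>p. g (T p x)"])
  finally show ?thesis ..
qed

text \<open>For \<open>g = h\<close> this is the energy lost when box averages of side
  \<open>l\<close> are replaced by those of side \<open>L\<close>; for two functions it is the
  polarized form.\<close>

definition box_defect :: "nat \<Rightarrow> nat \<Rightarrow> ('x \<Rightarrow> real) \<Rightarrow> ('x \<Rightarrow> real) \<Rightarrow> real"
  where "box_defect l L g h = diff_avg l (\<lambda>v. E (\<lambda>x. g x * h (T v x)))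
     - diff_avg L (\<lambda>v. E (\<lambda>x. g x * h (T v x)))"

text \<open>A covariance identity: the small averages at the grid points have the large average as
  their mean, so each cross term equals the inner product of the large averages and only the mean
  product of the deviations remains. For \<open>g = h\<close> this is a variance.\<close>

lemma box_defect_eq:
  assumes l: "l > 0" and k: "k > 0"
  shows "box_defect l (l * k) g h = avg (grid l k) (\<lambda>q. E (\<lambda>x.
     (box_avg l g (T q x) - box_avg (l * k) g x) * (box_avg l h (T q x) - box_avg (l * k) h x)))"
proof -
  let ?a = "box_avg l g" and ?b = "box_avg l h" and ?c = "box_avg (l * k) g" and ?d = "box_avg (l * k) h"
  have "avg (grid l k) (\<lambda>q. E (\<lambda>x. (?a (T q x) - ?c x) * (?b (T q x) - ?d x)))
    = avg (grid l k) (\<lambda>q. E (\<lambda>x. ?a (T q x) * ?b (T q x)) - E (\<lambda>x. ?a (T q x) * ?d x)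
       - E (\<lambda>x. ?c x * ?b (T q x)) + E (\<lambda>x. ?c x * ?d x))"
    by (intro avg_cong) (simp add: avg_diff avg_add algebra_simps)
  also have "\<dots> = avg (grid l k) (\<lambda>q. E (\<lambda>x. ?a (T q x) * ?b (T q x)))
       - avg (grid l k) (\<lambda>q. E (\<lambda>x. ?a (T q x) * ?d x))
       - avg (grid l k) (\<lambda>q. E (\<lambda>x. ?c x * ?b (T q x))) + E (\<lambda>x. ?c x * ?d x)"
    by (simp add: avg_diff avg_add avg_const[OF finite_grid grid_ne[OF k]])
  also have "avg (grid l k) (\<lambda>q. E (\<lambda>x. ?a (T q x) * ?b (T q x))) = E (\<lambda>x. ?a x * ?b x)"
    by (simp add: E_shift[of "\<lambda>x. ?a x * ?b x"] avg_const[OF finite_grid grid_ne[OF k]])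
  also have "avg (grid l k) (\<lambda>q. E (\<lambda>x. ?a (T q x) * ?d x)) = E (\<lambda>x. ?c x * ?d x)"
    by (subst avg_swap) (simp add: avg_multc box_avg_grid[OF l])
  also have "avg (grid l k) (\<lambda>q. E (\<lambda>x. ?c x * ?b (T q x))) = E (\<lambda>x. ?c x * ?d x)"
    by (subst avg_swap) (simp add: avg_cmult box_avg_grid[OF l])
  finally show ?thesis by (simp add: box_defect_def diff_avg_corr)
qed

lemma box_defect_nonneg:
  assumes "l > 0" "L > 0" "l dvd L" shows "0 \<le> box_defect l L g g"
proof -
  obtain k where L: "L = l * k" using assms by auto
  then have "k > 0" using assms by auto
  then show ?thesis unfolding L box_defect_eq[OF assms(1) \<open>k > 0\<close>] by (intro avg_nonneg) auto
qed

text \<open>The bound \<open>\<bar>a * b\<bar> \<le> (a * a + b * b) / 2\<close>, applied to the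
  deviations, controls a mixed defect of unknown sign by two nonnegative ones.\<close>

lemma abs_box_defect_le:
  assumes "l > 0" "L > 0" "l dvd L"
  shows "\<bar>box_defect l L g h\<bar> \<le> (box_defect l L g g + box_defect l L h h) / 2"
proof -
  obtain k where L: "L = l * k" using assms by auto
  then have k: "k > 0" using assms by auto
  have am: "\<bar>a * b\<bar> \<le> (a * a + b * b) / 2" for a b :: real
    using sum_squares_bound[of "\<bar>a\<bar>" "\<bar>b\<bar>"] by (simp add: power2_eq_square abs_mult)
  have "\<bar>box_defect l L g h\<bar> \<le> avg (grid l k) (\<lambda>q. E (\<lambda>x.
     \<bar>(box_avg l g (T q x) - box_avg L g x) * (box_avg l h (T q x) - box_avg L h x)\<bar>))"
    unfolding L box_defect_eq[OF assms(1) k]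
    by (rule order_trans[OF abs_avg_le avg_mono]) (rule abs_avg_le)
  also have "\<dots> \<le> avg (grid l k) (\<lambda>q. E (\<lambda>x.
     ((box_avg l g (T q x) - box_avg L g x) * (box_avg l g (T q x) - box_avg L g x)
      + (box_avg l h (T q x) - box_avg L h x) * (box_avg l h (T q x) - box_avg L h x)) / 2))"
    by (intro avg_mono am)
  also have "\<dots> = (box_defect l L g g + box_defect l L h h) / 2"
    unfolding L box_defect_eq[OF assms(1) k] by (simp add: avg_add avg_divc)
  finally show ?thesis .
qed

lemma abs_box_avg_le: "(\<And>x. \<bar>g x\<bar> \<le> 1) \<Longrightarrow> \<bar>box_avg l g x\<bar> \<le> 1"
  unfolding box_avg_def by (intro abs_avg_le_const) auto

lemma sym_diff_Box: "real (sym_diff_card (Box l) (a, b)) \<le> real l * (\<bar>a\<bar> + \<bar>b\<bar>)"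
proof -
  let ?I = "{0..<int l}"
  have h: "card (?I - (+) a ` ?I) \<le> nat \<bar>a\<bar>" for a :: int
  proof -
    have "?I - (+) a ` ?I \<subseteq> (if a \<ge> 0 then {0..<a} else {int l + a..<int l})"
      by (force simp: image_iff)
    then have "card (?I - (+) a ` ?I) \<le> card (if a \<ge> 0 then {0..<a} else {int l + a..<int l})"
      by (intro card_mono) auto
    then show ?thesis by (cases "a \<ge> 0") (simp_all del: image_add_atLeastLessThan)
  qed
  have "Box l - (+) (a, b) ` Box l \<subseteq> (?I - (+) a ` ?I) \<times> ?I \<union> ?I \<times> (?I - (+) b ` ?I)"
    unfolding Box_def by (force simp: image_iff)
  then have "sym_diff_card (Box l) (a, b) \<le> card ((?I - (+) a ` ?I) \<times> ?I \<union> ?I \<times> (?I - (+) b ` ?I))"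
    unfolding sym_diff_card_def by (intro card_mono) auto
  also have "\<dots> \<le> card (?I - (+) a ` ?I) * l + l * card (?I - (+) b ` ?I)"
    by (rule order_trans[OF card_Un_le]) (simp add: card_cartesian_product)
  also have "\<dots> \<le> nat \<bar>a\<bar> * l + l * nat \<bar>b\<bar>"
    by (intro add_mono mult_mono h) auto
  finally have "real (sym_diff_card (Box l) (a, b)) \<le> real (nat \<bar>a\<bar> * l + l * nat \<bar>b\<bar>)"
    by (simp only: of_nat_le_iff)
  then show ?thesis by (simp add: algebra_simps)
qed

lemma box_avg_Lipschitz:
  assumes L: "L > 0" and g: "\<And>x. \<bar>g x\<bar> \<le> 1"
    and y: "real_of_int \<bar>fst y\<bar> \<le> D" "real_of_int \<bar>snd y\<bar> \<le> D"
  shows "\<bar>box_avg L g (T y x) - box_avg L g x\<bar> \<le> 4 * D / L"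
proof -
  have "\<bar>box_avg L g (T y x) - box_avg L g x\<bar> \<le> 2 * real (sym_diff_card (Box L) y) / card (Box L)"
    unfolding box_avg_def
    using avg_translate_le[of "Box L" "\<lambda>p. g (T p x)" y] g by (simp add: add.commute)
  also have "\<dots> \<le> 2 * (real L * (\<bar>fst y\<bar> + \<bar>snd y\<bar>)) / card (Box L)"
    using sym_diff_Box[of L "fst y" "snd y"] by (intro divide_right_mono) auto
  also have "\<dots> \<le> 2 * (real L * (D + D)) / card (Box L)"
    using y by (intro divide_right_mono mult_left_mono) auto
  also have "\<dots> = 4 * D / L" using L by (simp add: power2_eq_square)
  finally show ?thesis .
qed

text \<open>The large average is Lipschitz, and the defect measures how far the small averages at
  the grid points are from it in mean square. Since shifting by \<open>q\<close> does not change
  \<open>E\<close>, the left side may be averaged over all grid points \<open>q\<close>, which is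
  where the defect gives control.\<close>

lemma box_avg_slowly_varying:
  assumes l: "l > 0" "L > 0" "l dvd L" and g: "\<And>x. \<bar>g x\<bar> \<le> 1" and \<theta>: "\<theta> > 0"
    and y: "real_of_int \<bar>fst y\<bar> \<le> D" "real_of_int \<bar>snd y\<bar> \<le> D"
  shows "E (\<lambda>x. \<bar>box_avg l g (T y x) - box_avg l g x\<bar>) \<le> \<theta> + box_defect l L g g / \<theta> + 4 * D / L"
proof -
  obtain k where L: "L = l * k" using l by auto
  then have k: "k > 0" using l by auto
  let ?a = "box_avg l g" and ?c = "box_avg L g"
  let ?e = "\<lambda>q. E (\<lambda>x. \<bar>?a (T q x) - ?c x\<bar>)"
  have 1: "E (\<lambda>x. \<bar>?a (T y x) - ?a x\<bar>) \<le> 2 * ?e q + 4 * D / L" for q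
  proof -
    have "E (\<lambda>x. \<bar>?a (T y x) - ?a x\<bar>) = E (\<lambda>x. \<bar>?a (T q (T y x)) - ?a (T q x)\<bar>)"
      using E_shift[of "\<lambda>x. \<bar>?a (T y x) - ?a x\<bar>" q] by (simp add: add.commute)
    also have "\<dots> \<le> E (\<lambda>x. \<bar>?a (T q (T y x)) - ?c (T y x)\<bar> + \<bar>?c (T y x) - ?c x\<bar> + \<bar>?a (T q x) - ?c x\<bar>)"
      by (intro avg_mono) linarith
    also have "\<dots> = E (\<lambda>x. \<bar>?a (T q (T y x)) - ?c (T y x)\<bar>) + E (\<lambda>x. \<bar>?c (T y x) - ?c x\<bar>) + ?e q"
      by (simp only: avg_add)
    also have "E (\<lambda>x. \<bar>?a (T q (T y x)) - ?c (T y x)\<bar>) = ?e q"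
      using E_shift[of "\<lambda>x. \<bar>?a (T q x) - ?c x\<bar>" y] by simp
    also have "E (\<lambda>x. \<bar>?c (T y x) - ?c x\<bar>) \<le> 4 * D / L"
    proof (rule avg_le_const)
      have "0 \<le> D" using y by linarith
      then show "0 \<le> 4 * D / L" by simp
    qed (rule box_avg_Lipschitz[OF l(2) g y])
    finally show ?thesis by simp
  qed
  have "E (\<lambda>x. \<bar>?a (T y x) - ?a x\<bar>) = avg (grid l k) (\<lambda>q. E (\<lambda>x. \<bar>?a (T y x) - ?a x\<bar>))"
    by (simp add: avg_const[OF finite_grid grid_ne[OF k]])
  also have "\<dots> \<le> avg (grid l k) (\<lambda>q. 2 * ?e q + 4 * D / L)" by (intro avg_mono 1)
  also have "\<dots> \<le> avg (grid l k) (\<lambda>q. \<theta> + E (\<lambda>x. (?a (T q x) - ?c x)\<^sup>2) / \<theta> + 4 * D / L)"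
    by (intro avg_mono add_right_mono avg_abs_le_square \<theta>)
  also have "\<dots> = \<theta> + box_defect l L g g / \<theta> + 4 * D / L"
    unfolding L box_defect_eq[OF l(1) k]
    by (simp add: avg_add avg_divc avg_const[OF finite_grid grid_ne[OF k]] power2_eq_square)
  finally show ?thesis .
qed

section \<open>Cube forms in three directions and their telescoping differences\<close>

definition sq :: "(bool \<Rightarrow> bool \<Rightarrow> 'x \<Rightarrow> real) \<Rightarrow> int \<times> int \<Rightarrow> int \<times> int \<Rightarrow> 'x \<Rightarrow> real"
  where "sq f v w x = f False False x * f True False (T v x) * f False True (T w x) * f True True (T (v + w) x)"

text \<open>\<open>h i j k\<close> is the function at the vertex \<open>i u + j v + k w\<close> of a parallelepiped with edges \<open>u\<close>, \<open>v\<close>, \<open>w\<close>.\<close>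

definition cube :: "nat \<Rightarrow> nat \<Rightarrow> nat \<Rightarrow> (bool \<Rightarrow> bool \<Rightarrow> bool \<Rightarrow> 'x \<Rightarrow> real) \<Rightarrow> real"
  where "cube a b c h = diff_avg a (\<lambda>u. diff_avg b (\<lambda>v. diff_avg c (\<lambda>w.
     E (\<lambda>x. sq (h False) v w x * sq (h True) v w (T u x)))))"

lemma cube_swap12: "cube a b c h = cube b a c (\<lambda>i j k. h j i k)"
  unfolding cube_def
  by (subst diff_avg_swap) (simp add: sq_def add.commute add.left_commute mult.commute mult.left_commute)

lemma cube_swap13: "cube a b c h = cube c b a (\<lambda>i j k. h k j i)"
proof -
  have "cube a b c h = diff_avg c (\<lambda>w. diff_avg b (\<lambda>v. diff_avg a (\<lambda>u.
     E (\<lambda>x. sq (h False) v w x * sq (h True) v w (T u x)))))"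
    unfolding cube_def
    by (subst diff_avg_swap, subst (2) diff_avg_swap, subst (1) diff_avg_swap) simp
  then show ?thesis unfolding cube_def
    by (simp add: sq_def add.commute add.left_commute mult.commute mult.left_commute)
qed

lemma cube_eq:
  "cube a b c h = diff_avg b (\<lambda>v. diff_avg c (\<lambda>w. diff_avg a (\<lambda>u.
     E (\<lambda>x. sq (h False) v w x * sq (h True) v w (T u x)))))"
  unfolding cube_def by (subst diff_avg_swap, subst (2) diff_avg_swap) simp

text \<open>With \<open>v\<close> and \<open>w\<close> frozen, the cube form is a correlation in
  direction \<open>u\<close> of two parallelogram products, so a change of the first scale is an
  average of box defects. The permutation lemmas carry this over to the other two
  directions.\<close>

lemma cube_diff_eq: "cube a b c h - cube a' b c h =
   diff_avg b (\<lambda>v. diff_avg c (\<lambda>w. box_defect a a' (sq (h False) v w) (sq (h True) v w)))"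
  unfolding cube_eq box_defect_def by (simp add: diff_avg_diff)

lemma cube_diff1_nonneg:
  assumes "a > 0" "a' > 0" "a dvd a'" "h True = h False"
  shows "0 \<le> cube a b c h - cube a' b c h"
  unfolding cube_diff_eq assms(4) by (intro diff_avg_nonneg box_defect_nonneg assms)

lemma cube_diff1_le:
  assumes "a > 0" "a' > 0" "a dvd a'"
  shows "\<bar>cube a b c h - cube a' b c h\<bar> \<le>
    ((cube a b c (\<lambda>_. h False) - cube a' b c (\<lambda>_. h False))
     + (cube a b c (\<lambda>_. h True) - cube a' b c (\<lambda>_. h True))) / 2"
proof -
  have "\<bar>cube a b c h - cube a' b c h\<bar> \<le>
     diff_avg b (\<lambda>v. diff_avg c (\<lambda>w. \<bar>box_defect a a' (sq (h False) v w) (sq (h True) v w)\<bar>))"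
    unfolding cube_diff_eq
    by (rule order_trans[OF abs_diff_avg_le diff_avg_mono]) (rule abs_diff_avg_le)
  also have "\<dots> \<le> diff_avg b (\<lambda>v. diff_avg c (\<lambda>w.
     (box_defect a a' (sq (h False) v w) (sq (h False) v w) + box_defect a a' (sq (h True) v w) (sq (h True) v w)) / 2))"
    by (intro diff_avg_mono abs_box_defect_le assms)
  also have "\<dots> = ((cube a b c (\<lambda>_. h False) - cube a' b c (\<lambda>_. h False))
     + (cube a b c (\<lambda>_. h True) - cube a' b c (\<lambda>_. h True))) / 2"
    unfolding cube_diff_eq by (simp add: diff_avg_add diff_avg_divc)
  finally show ?thesis .
qed

lemma cube_bounds:
  assumes "\<And>i j k x. 0 \<le> h i j k x \<and> h i j k x \<le> 1"
  shows "0 \<le> cube a b c h" "cube a b c h \<le> 1"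
  unfolding cube_def sq_def using assms
  by (auto intro!: diff_avg_nonneg avg_nonneg diff_avg_le_const avg_le_const mult_nonneg_nonneg mult_le_one)

text \<open>The step from \<open>cube (l j) (l j) (l j)\<close> to the next scale is split into one step for each
  direction, since the positivity of a difference is available for one direction at a time.\<close>

definition d1 :: "(nat \<Rightarrow> nat) \<Rightarrow> (bool \<Rightarrow> bool \<Rightarrow> bool \<Rightarrow> 'x \<Rightarrow> real) \<Rightarrow> nat \<Rightarrow> real"
  where "d1 l h j = cube (l j) (l (Suc j)) (l (Suc j)) h - cube (l (Suc j)) (l (Suc j)) (l (Suc j)) h"

definition d2 :: "(nat \<Rightarrow> nat) \<Rightarrow> (bool \<Rightarrow> bool \<Rightarrow> bool \<Rightarrow> 'x \<Rightarrow> real) \<Rightarrow> nat \<Rightarrow> real"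
  where "d2 l h j = cube (l j) (l j) (l (Suc j)) h - cube (l j) (l (Suc j)) (l (Suc j)) h"

definition d3 :: "(nat \<Rightarrow> nat) \<Rightarrow> (bool \<Rightarrow> bool \<Rightarrow> bool \<Rightarrow> 'x \<Rightarrow> real) \<Rightarrow> nat \<Rightarrow> real"
  where "d3 l h j = cube (l j) (l j) (l j) h - cube (l j) (l j) (l (Suc j)) h"

context
  fixes l :: "nat \<Rightarrow> nat"
  assumes l_pos: "\<And>j. l j > 0" and l_dvd: "\<And>j. l j dvd l (Suc j)"
begin

lemma d2_eq: "d2 l h j = cube (l j) (l j) (l (Suc j)) (\<lambda>i j k. h j i k)
    - cube (l (Suc j)) (l j) (l (Suc j)) (\<lambda>i j k. h j i k)"
  unfolding d2_def by (rule arg_cong2[where f = minus]) (rule cube_swap12)+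

lemma d3_eq: "d3 l h j = cube (l j) (l j) (l j) (\<lambda>i j k. h k j i)
    - cube (l (Suc j)) (l j) (l j) (\<lambda>i j k. h k j i)"
  unfolding d3_def by (rule arg_cong2[where f = minus]) (rule cube_swap13)+

lemma d1_nonneg: "h True = h False \<Longrightarrow> 0 \<le> d1 l h j"
  unfolding d1_def by (intro cube_diff1_nonneg l_pos l_dvd)

lemma d2_nonneg: "(\<And>i k. h i True k = h i False k) \<Longrightarrow> 0 \<le> d2 l h j"
  unfolding d2_eq by (intro cube_diff1_nonneg l_pos l_dvd) (simp add: fun_eq_iff)

lemma d3_nonneg: "(\<And>i j. h i j True = h i j False) \<Longrightarrow> 0 \<le> d3 l h j"
  unfolding d3_eq by (intro cube_diff1_nonneg l_pos l_dvd) (simp add: fun_eq_iff)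

lemma abs_d2_le: "\<bar>d2 l h j\<bar> \<le> (d2 l (\<lambda>i _ k. h i False k) j + d2 l (\<lambda>i _ k. h i True k) j) / 2"
  unfolding d2_eq by (rule order_trans[OF cube_diff1_le[OF l_pos l_pos l_dvd]]) simp

lemma abs_d3_le: "\<bar>d3 l h j\<bar> \<le> (d3 l (\<lambda>i m _. h i m False) j + d3 l (\<lambda>i m _. h i m True) j) / 2"
  unfolding d3_eq by (rule order_trans[OF cube_diff1_le[OF l_pos l_pos l_dvd]]) simp

text \<open>Three steps in single directions make up one full step, so everything telescopes to a
  difference of two cube forms with values in [0, 1].\<close>

lemma sum_defects_le:
  assumes "\<And>i j k x. 0 \<le> h i j k x \<and> h i j k x \<le> 1"
  shows "(\<Sum>j<J. d1 l h j) + (\<Sum>j<J. d2 l h j) + (\<Sum>j<J. d3 l h j) \<le> 1"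
proof -
  have "(\<Sum>j<J. d1 l h j) + (\<Sum>j<J. d2 l h j) + (\<Sum>j<J. d3 l h j)
     = cube (l 0) (l 0) (l 0) h - cube (l J) (l J) (l J) h"
    by (induction J) (simp_all add: d1_def d2_def d3_def)
  also have "\<dots> \<le> 1" using cube_bounds(1)[of h "l J" "l J" "l J"] cube_bounds(2)[of h "l 0" "l 0" "l 0"] assms by fastforce
  finally show ?thesis .
qed

text \<open>With one function at all vertices each of the three families is nonnegative, so each is
  bounded by the total.\<close>

lemma sum_d_const:
  assumes f: "\<And>x. 0 \<le> f x \<and> f x \<le> 1"
  shows "(\<Sum>j<J. d2 l (\<lambda>_ _ _. f) j) \<le> 1" "(\<Sum>j<J. d3 l (\<lambda>_ _ _. f) j) \<le> 1"
proof -
  let ?h = "\<lambda>_ _ _. f"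
  have "0 \<le> (\<Sum>j<J. d1 l ?h j)" "0 \<le> (\<Sum>j<J. d2 l ?h j)" "0 \<le> (\<Sum>j<J. d3 l ?h j)"
    by (auto intro!: sum_nonneg d1_nonneg d2_nonneg d3_nonneg)
  moreover note sum_defects_le[of ?h J] f
  ultimately show "(\<Sum>j<J. d2 l (\<lambda>_ _ _. f) j) \<le> 1" "(\<Sum>j<J. d3 l (\<lambda>_ _ _. f) j) \<le> 1"
    by force+
qed

text \<open>The vertices depend on the third index only: differences in the first two directions
  stay nonnegative, and those in the third are dominated in absolute value by the constant case.
  Hence 2 = 1 + 1.\<close>

lemma sum_d2_le:
  assumes f: "\<And>k x. 0 \<le> f k x \<and> f k x \<le> 1"
  shows "(\<Sum>j<J. d2 l (\<lambda>_ _ k. f k) j) \<le> 2"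
proof -
  let ?h = "\<lambda>_ _ k. f k"
  have "(\<Sum>j<J. \<bar>d3 l ?h j\<bar>) \<le> (\<Sum>j<J. (d3 l (\<lambda>_ _ _. f False) j + d3 l (\<lambda>_ _ _. f True) j) / 2)"
    by (intro sum_mono order_trans[OF abs_d3_le]) simp
  also have "\<dots> = ((\<Sum>j<J. d3 l (\<lambda>_ _ _. f False) j) + (\<Sum>j<J. d3 l (\<lambda>_ _ _. f True) j)) / 2"
    by (simp add: sum.distrib sum_divide_distrib[symmetric])
  also have "\<dots> \<le> 1" using sum_d_const(2)[of "f False" J] sum_d_const(2)[of "f True" J] f by auto
  finally have "(\<Sum>j<J. \<bar>d3 l ?h j\<bar>) \<le> 1" .
  moreover have "\<bar>\<Sum>j<J. d3 l ?h j\<bar> \<le> (\<Sum>j<J. \<bar>d3 l ?h j\<bar>)" by (rule sum_abs)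
  moreover have "0 \<le> (\<Sum>j<J. d1 l ?h j)" by (auto intro!: sum_nonneg d1_nonneg)
  moreover have "(\<Sum>j<J. d1 l ?h j) + (\<Sum>j<J. d2 l ?h j) + (\<Sum>j<J. d3 l ?h j) \<le> 1"
    using f by (intro sum_defects_le)
  ultimately show ?thesis by linarith
qed

lemma sum_d3_le:
  assumes f: "\<And>k x. 0 \<le> f k x \<and> f k x \<le> 1"
  shows "(\<Sum>j<J. d3 l (\<lambda>_ k _. f k) j) \<le> 2"
proof -
  let ?h = "\<lambda>_ k _. f k"
  have "(\<Sum>j<J. \<bar>d2 l ?h j\<bar>) \<le> (\<Sum>j<J. (d2 l (\<lambda>_ _ _. f False) j + d2 l (\<lambda>_ _ _. f True) j) / 2)"
    by (intro sum_mono order_trans[OF abs_d2_le]) simp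
  also have "\<dots> = ((\<Sum>j<J. d2 l (\<lambda>_ _ _. f False) j) + (\<Sum>j<J. d2 l (\<lambda>_ _ _. f True) j)) / 2"
    by (simp add: sum.distrib sum_divide_distrib[symmetric])
  also have "\<dots> \<le> 1" using sum_d_const(1)[of "f False" J] sum_d_const(1)[of "f True" J] f by auto
  finally have "(\<Sum>j<J. \<bar>d2 l ?h j\<bar>) \<le> 1" .
  moreover have "\<bar>\<Sum>j<J. d2 l ?h j\<bar> \<le> (\<Sum>j<J. \<bar>d2 l ?h j\<bar>)" by (rule sum_abs)
  moreover have "0 \<le> (\<Sum>j<J. d1 l ?h j)" by (auto intro!: sum_nonneg d1_nonneg)
  moreover have "(\<Sum>j<J. d1 l ?h j) + (\<Sum>j<J. d2 l ?h j) + (\<Sum>j<J. d3 l ?h j) \<le> 1"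
    using f by (intro sum_defects_le)
  ultimately show ?thesis by linarith
qed

text \<open>The last stage of an induction on the number of indices on which the vertices depend.
  Freezing one of the two indices that matter reduces to \<open>sum_d2_le\<close> and
  \<open>sum_d3_le\<close>, so each of the other two directions contributes at most 2, and 5 = 1 + 2
  + 2.\<close>

lemma sum_d1_le:
  assumes f: "\<And>i k x. 0 \<le> f i k x \<and> f i k x \<le> 1"
  shows "(\<Sum>j<J. d1 l (\<lambda>_. f) j) \<le> 5"
proof -
  let ?h = "\<lambda>_. f"
  have "(\<Sum>j<J. \<bar>d2 l ?h j\<bar>) \<le> (\<Sum>j<J. (d2 l (\<lambda>_ _. f False) j + d2 l (\<lambda>_ _. f True) j) / 2)"
    by (intro sum_mono order_trans[OF abs_d2_le]) simp
  also have "\<dots> = ((\<Sum>j<J. d2 l (\<lambda>_ _. f False) j) + (\<Sum>j<J. d2 l (\<lambda>_ _. f True) j)) / 2"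
    by (simp add: sum.distrib sum_divide_distrib[symmetric])
  also have "\<dots> \<le> 2" using sum_d2_le[of "f False" J] sum_d2_le[of "f True" J] f by auto
  finally have 2: "(\<Sum>j<J. \<bar>d2 l ?h j\<bar>) \<le> 2" .
  have "(\<Sum>j<J. \<bar>d3 l ?h j\<bar>) \<le> (\<Sum>j<J. (d3 l (\<lambda>_ i _. f i False) j + d3 l (\<lambda>_ i _. f i True) j) / 2)"
    by (intro sum_mono order_trans[OF abs_d3_le]) simp
  also have "\<dots> = ((\<Sum>j<J. d3 l (\<lambda>_ i _. f i False) j) + (\<Sum>j<J. d3 l (\<lambda>_ i _. f i True) j)) / 2"
    by (simp add: sum.distrib sum_divide_distrib[symmetric])
  also have "\<dots> \<le> 2"
    using sum_d3_le[of "\<lambda>i. f i False" J] sum_d3_le[of "\<lambda>i. f i True" J] f by auto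
  finally have "(\<Sum>j<J. \<bar>d3 l ?h j\<bar>) \<le> 2" .
  moreover have "\<bar>\<Sum>j<J. d3 l ?h j\<bar> \<le> (\<Sum>j<J. \<bar>d3 l ?h j\<bar>)" by (rule sum_abs)
  moreover have "(\<Sum>j<J. d1 l ?h j) + (\<Sum>j<J. d2 l ?h j) + (\<Sum>j<J. d3 l ?h j) \<le> 1"
    using f by (intro sum_defects_le)
  moreover have "\<bar>\<Sum>j<J. d2 l ?h j\<bar> \<le> (\<Sum>j<J. \<bar>d2 l ?h j\<bar>)" by (rule sum_abs)
  moreover note 2
  ultimately show ?thesis by linarith
qed

lemma sum_box_defect_le:
  assumes f: "\<And>x. 0 \<le> f x \<and> f x \<le> 1"
  shows "(\<Sum>j<J. box_defect (l j) (l (Suc j)) f f) \<le> 1"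
proof -
  let ?c = "\<lambda>v. E (\<lambda>x. f x * f (T v x))"
  have "(\<Sum>j<J. box_defect (l j) (l (Suc j)) f f) = diff_avg (l 0) ?c - diff_avg (l J) ?c"
    by (induction J) (simp_all add: box_defect_def)
  moreover have "diff_avg (l 0) ?c \<le> 1" using f by (intro diff_avg_le_const avg_le_const mult_le_one) auto
  moreover have "0 \<le> diff_avg (l J) ?c" using f by (intro diff_avg_nonneg avg_nonneg) auto
  ultimately show ?thesis by simp
qed

end

text \<open>The last condition says that \<open>S\<close> is invariant under \<open>Box l\<close> up to a proportion \<open>\<eta>\<close>, and
  \<open>L\<^sup>2 \<le> Q |S|\<close> that \<open>S\<close> has positive density in a box of side \<open>L\<close>.\<close>

definition well_spread :: "nat \<Rightarrow> nat \<Rightarrow> real \<Rightarrow> real \<Rightarrow> real \<Rightarrow> (int \<times> int) set \<Rightarrow> bool"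
  where "well_spread l L D \<eta> Q S \<longleftrightarrow> finite S \<and> S \<noteq> {} \<and>
    (\<forall>v\<in>S. real_of_int \<bar>fst v\<bar> \<le> D \<and> real_of_int \<bar>snd v\<bar> \<le> D) \<and> 2 * D \<le> L \<and>
    (real L)\<^sup>2 \<le> Q * card S \<and> (\<forall>p\<in>Box l. 2 * real (sym_diff_card S p) \<le> \<eta> * card S)"

text \<open>Averaging over the translates of \<open>S\<close> by points of the small box inserts a
  box average; near invariance bounds the cost of each translate by \<open>\<eta>\<close>.\<close>

lemma well_spread_smooth:
  assumes S: "well_spread l L D \<eta> Q S" and l: "l > 0" and \<eta>: "\<eta> \<ge> 0" and g: "\<And>x. \<bar>g x\<bar> \<le> 1"
  shows "\<bar>avg S (\<lambda>v. g (T v x)) - avg S (\<lambda>v. box_avg l g (T v x))\<bar> \<le> \<eta>"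
proof -
  have fS: "finite S" "S \<noteq> {}" using S by (auto simp: well_spread_def)
  then have c: "real (card S) > 0" by (simp add: card_gt_0_iff)
  have "avg S (\<lambda>v. box_avg l g (T v x)) = avg (Box l) (\<lambda>p. avg S (\<lambda>v. g (T (p + v) x)))"
    unfolding box_avg_def by (subst avg_swap) simp
  moreover have "avg S (\<lambda>v. g (T v x)) = avg (Box l) (\<lambda>p. avg S (\<lambda>v. g (T v x)))"
    by (simp add: avg_const Box_ne l)
  ultimately have "\<bar>avg S (\<lambda>v. g (T v x)) - avg S (\<lambda>v. box_avg l g (T v x))\<bar>
    \<le> avg (Box l) (\<lambda>p. \<bar>avg S (\<lambda>v. g (T v x)) - avg S (\<lambda>v. g (T (p + v) x))\<bar>)"
    using abs_avg_diff_le[of "Box l" "\<lambda>p. avg S (\<lambda>v. g (T v x))" "\<lambda>p. avg S (\<lambda>v. g (T (p + v) x))"]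
    by linarith
  also have "\<dots> \<le> \<eta>"
  proof (rule avg_le_const[OF _ \<eta>])
    fix p assume "p \<in> Box l"
    then have "2 * real (sym_diff_card S p) / card S \<le> \<eta>" using S c
      by (simp add: well_spread_def divide_le_eq)
    moreover have "\<bar>avg S (\<lambda>v. g (T (p + v) x)) - avg S (\<lambda>v. g (T v x))\<bar> \<le> 2 * real (sym_diff_card S p) / card S"
      using avg_translate_le[OF fS(1), of "\<lambda>v. g (T v x)" p] g by simp
    ultimately show "\<bar>avg S (\<lambda>v. g (T v x)) - avg S (\<lambda>v. g (T (p + v) x))\<bar> \<le> \<eta>" by linarith
  qed
  finally show ?thesis .
qed

text \<open>Box averages vary little within distance \<open>2 * D\<close>, the reach of
  \<open>s + v\<close>. An average over \<open>S\<close>, even one centred at a shifted point,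
  therefore forgets \<open>S\<close> and is close to the box average at \<open>x\<close>, so that
  two such sets can be exchanged.\<close>

lemma well_spread_avg_close:
  assumes S: "well_spread l L D \<eta> Q S" and l: "l > 0" "L > 0" "l dvd L" and \<eta>: "\<eta> \<ge> 0" and \<theta>: "\<theta> > 0"
    and g: "\<And>x. \<bar>g x\<bar> \<le> 1" and v: "real_of_int \<bar>fst v\<bar> \<le> D" "real_of_int \<bar>snd v\<bar> \<le> D"
  shows "E (\<lambda>x. \<bar>avg S (\<lambda>s. g (T s (T v x))) - box_avg l g x\<bar>)
     \<le> \<eta> + \<theta> + box_defect l L g g / \<theta> + 8 * D / L"
proof -
  have fS: "finite S" "S \<noteq> {}" using S by (auto simp: well_spread_def)
  have D: "D \<ge> 0" using v by linarith
  have bd: "0 \<le> box_defect l L g g" by (rule box_defect_nonneg[OF l])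
  have "E (\<lambda>x. \<bar>avg S (\<lambda>s. g (T s (T v x))) - box_avg l g x\<bar>)
    \<le> E (\<lambda>x. \<eta> + avg S (\<lambda>s. \<bar>box_avg l g (T (s + v) x) - box_avg l g x\<bar>))"
  proof (rule avg_mono)
    fix x
    have "\<bar>avg S (\<lambda>s. g (T s (T v x))) - avg S (\<lambda>s. box_avg l g (T s (T v x)))\<bar> \<le> \<eta>"
      by (rule well_spread_smooth[OF S l(1) \<eta> g])
    moreover have "\<bar>avg S (\<lambda>s. box_avg l g (T s (T v x))) - avg S (\<lambda>s. box_avg l g x)\<bar>
       \<le> avg S (\<lambda>s. \<bar>box_avg l g (T (s + v) x) - box_avg l g x\<bar>)"
      by (rule order_trans[OF abs_avg_diff_le]) simp
    moreover have "avg S (\<lambda>s. box_avg l g x) = box_avg l g x" by (rule avg_const[OF fS])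
    ultimately show "\<bar>avg S (\<lambda>s. g (T s (T v x))) - box_avg l g x\<bar> \<le>
      \<eta> + avg S (\<lambda>s. \<bar>box_avg l g (T (s + v) x) - box_avg l g x\<bar>)" by linarith
  qed
  also have "\<dots> = \<eta> + avg S (\<lambda>s. E (\<lambda>x. \<bar>box_avg l g (T (s + v) x) - box_avg l g x\<bar>))"
    by (subst avg_swap) (simp add: avg_add avg_const finite_X X_ne)
  also have "avg S (\<lambda>s. E (\<lambda>x. \<bar>box_avg l g (T (s + v) x) - box_avg l g x\<bar>))
    \<le> \<theta> + box_defect l L g g / \<theta> + 4 * (2 * D) / L"
  proof (rule avg_le_const)
    fix s assume "s \<in> S"
    then have "real_of_int \<bar>fst s\<bar> \<le> D" "real_of_int \<bar>snd s\<bar> \<le> D" using S by (auto simp: well_spread_def)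
    moreover have "\<bar>fst (s + v)\<bar> \<le> \<bar>fst s\<bar> + \<bar>fst v\<bar>" "\<bar>snd (s + v)\<bar> \<le> \<bar>snd s\<bar> + \<bar>snd v\<bar>"
      by simp_all
    ultimately have "real_of_int \<bar>fst (s + v)\<bar> \<le> 2 * D" "real_of_int \<bar>snd (s + v)\<bar> \<le> 2 * D"
      using v by linarith+
    then show "E (\<lambda>x. \<bar>box_avg l g (T (s + v) x) - box_avg l g x\<bar>) \<le> \<theta> + box_defect l L g g / \<theta> + 4 * (2 * D) / L"
      by (intro box_avg_slowly_varying l g \<theta>)
  qed (use \<theta> bd D in simp)
  finally show ?thesis by simp
qed

section \<open>The multilinear form behind a configuration and the exchange of its sets\<close>

definition form7 where
  "form7 f b a1 a2 a3 S1 S2 S3 = E (\<lambda>x. avg S1 (\<lambda>v1. avg S2 (\<lambda>v2. avg S3 (\<lambda>v3.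
     b x * a1 (T v1 x) * a2 (T v2 x) * a3 (T v3 x)
       * f (T (v1 + v2) x) * f (T (v1 + v3) x) * f (T (v2 + v3) x) :: real))))"

lemma form7_swap12: "form7 f b a1 a2 a3 S1 S2 S3 = form7 f b a2 a1 a3 S2 S1 S3"
proof -
  have "form7 f b a1 a2 a3 S1 S2 S3 = E (\<lambda>x. avg S2 (\<lambda>v2. avg S1 (\<lambda>v1. avg S3 (\<lambda>v3.
     b x * a1 (T v1 x) * a2 (T v2 x) * a3 (T v3 x)
       * f (T (v1 + v2) x) * f (T (v1 + v3) x) * f (T (v2 + v3) x)))))"
    unfolding form7_def by (rule avg_cong) (rule avg_swap)
  then show ?thesis
    unfolding form7_def by (simp add: mult.commute mult.left_commute add.commute)
qed

lemma form7_swap23: "form7 f b a1 a2 a3 S1 S2 S3 = form7 f b a1 a3 a2 S1 S3 S2"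
proof -
  have "form7 f b a1 a2 a3 S1 S2 S3 = E (\<lambda>x. avg S1 (\<lambda>v1. avg S3 (\<lambda>v3. avg S2 (\<lambda>v2.
     b x * a1 (T v1 x) * a2 (T v2 x) * a3 (T v3 x)
       * f (T (v1 + v2) x) * f (T (v1 + v3) x) * f (T (v2 + v3) x)))))"
    unfolding form7_def by (rule avg_cong, rule avg_cong) (rule avg_swap)
  then show ?thesis
    unfolding form7_def by (simp add: mult.commute mult.left_commute add.commute)
qed

lemma form7_swap13: "form7 f b a1 a2 a3 S1 S2 S3 = form7 f b a3 a2 a1 S3 S2 S1"
  by (metis form7_swap12 form7_swap23)

lemma abs_prod_le_one: "\<bar>a\<bar> \<le> (1::real) \<Longrightarrow> \<bar>b\<bar> \<le> 1 \<Longrightarrow> \<bar>a * b\<bar> \<le> 1"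
  by (simp add: abs_mult mult_le_one)

text \<open>With \<open>x\<close>, \<open>v2\<close> and \<open>v3\<close> fixed, the factors
  without \<open>v1\<close> have a product of absolute value at most 1 and come out of the average
  over \<open>v1\<close>; what is left is a single function averaged over the two sets.\<close>

lemma form7_change1:
  assumes b: "\<And>x. \<bar>b x\<bar> \<le> 1" "\<And>x. \<bar>a2 x\<bar> \<le> 1" "\<And>x. \<bar>a3 x\<bar> \<le> 1" "\<And>x. \<bar>f x\<bar> \<le> 1"
  shows "\<bar>form7 f b a1 a2 a3 S1 S2 S3 - form7 f b a1 a2 a3 S1' S2 S3\<bar> \<le>
    avg S2 (\<lambda>v2. avg S3 (\<lambda>v3. E (\<lambda>x. \<bar>avg S1 (\<lambda>v. a1 (T v x) * f (T v2 (T v x)) * f (T v3 (T v x)))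
       - avg S1' (\<lambda>v. a1 (T v x) * f (T v2 (T v x)) * f (T v3 (T v x)))\<bar>)))"
proof -
  let ?G = "\<lambda>S v2 v3 x. avg S (\<lambda>v. a1 (T v x) * f (T v2 (T v x)) * f (T v3 (T v x)))"
  let ?B = "\<lambda>v2 v3 x. b x * a2 (T v2 x) * a3 (T v3 x) * f (T (v2 + v3) x)"
  have eq: "form7 f b a1 a2 a3 S S2 S3 = avg S2 (\<lambda>v2. avg S3 (\<lambda>v3. E (\<lambda>x. ?B v2 v3 x * ?G S v2 v3 x)))" for S
  proof -
    have "form7 f b a1 a2 a3 S S2 S3 = E (\<lambda>x. avg S2 (\<lambda>v2. avg S (\<lambda>v1. avg S3 (\<lambda>v3.
      b x * a1 (T v1 x) * a2 (T v2 x) * a3 (T v3 x)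
       * f (T (v1 + v2) x) * f (T (v1 + v3) x) * f (T (v2 + v3) x)))))"
      unfolding form7_def by (rule avg_cong) (rule avg_swap)
    also have "\<dots> = E (\<lambda>x. avg S2 (\<lambda>v2. avg S3 (\<lambda>v3. avg S (\<lambda>v1.
      b x * a1 (T v1 x) * a2 (T v2 x) * a3 (T v3 x)
       * f (T (v1 + v2) x) * f (T (v1 + v3) x) * f (T (v2 + v3) x)))))"
      by (rule avg_cong, rule avg_cong) (rule avg_swap)
    also have "\<dots> = E (\<lambda>x. avg S2 (\<lambda>v2. avg S3 (\<lambda>v3. ?B v2 v3 x * ?G S v2 v3 x)))"
      unfolding avg_cmult[symmetric]
      by (simp add: mult.commute mult.left_commute add.commute)
    also have "\<dots> = avg S2 (\<lambda>v2. E (\<lambda>x. avg S3 (\<lambda>v3. ?B v2 v3 x * ?G S v2 v3 x)))"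
      by (rule avg_swap)
    also have "\<dots> = avg S2 (\<lambda>v2. avg S3 (\<lambda>v3. E (\<lambda>x. ?B v2 v3 x * ?G S v2 v3 x)))"
      by (rule avg_cong) (rule avg_swap)
    finally show ?thesis .
  qed
  have "\<bar>form7 f b a1 a2 a3 S1 S2 S3 - form7 f b a1 a2 a3 S1' S2 S3\<bar> \<le>
    avg S2 (\<lambda>v2. avg S3 (\<lambda>v3. E (\<lambda>x. \<bar>?B v2 v3 x * ?G S1 v2 v3 x - ?B v2 v3 x * ?G S1' v2 v3 x\<bar>)))"
    unfolding eq
    by (rule order_trans[OF abs_avg_diff_le avg_mono], rule order_trans[OF abs_avg_diff_le avg_mono],
        rule abs_avg_diff_le)
  also have "\<dots> \<le> avg S2 (\<lambda>v2. avg S3 (\<lambda>v3. E (\<lambda>x. \<bar>?G S1 v2 v3 x - ?G S1' v2 v3 x\<bar>)))"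
  proof (intro avg_mono)
    fix v2 v3 x
    have "\<bar>?B v2 v3 x\<bar> \<le> 1" using b by (intro abs_prod_le_one)
    then show "\<bar>?B v2 v3 x * ?G S1 v2 v3 x - ?B v2 v3 x * ?G S1' v2 v3 x\<bar> \<le> \<bar>?G S1 v2 v3 x - ?G S1' v2 v3 x\<bar>"
      unfolding right_diff_distrib[symmetric] abs_mult by (simp add: mult_left_le_one_le)
  qed
  finally show ?thesis .
qed

text \<open>For fixed \<open>v1\<close> the vector \<open>s1\<close> enters through the point
  \<open>x + v1 + s1\<close> alone, so its average is a weight at \<open>x + v1\<close>, and
  likewise for \<open>s2\<close> and \<open>s3\<close>. Ten points thus reduce to a form with
  seven.\<close>

definition config_avg where
  "config_avg fA fB S1 S2 S3 U1 U2 U3 = form7 fB fB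
     (\<lambda>y. fA y * avg U1 (\<lambda>s. fB (T s y))) (\<lambda>y. fA y * avg U2 (\<lambda>s. fB (T s y)))
     (\<lambda>y. fA y * avg U3 (\<lambda>s. fB (T s y))) S1 S2 S3"

lemma E_avg3:
  "E (\<lambda>x. avg S1 (\<lambda>v1. avg S2 (\<lambda>v2. avg S3 (\<lambda>v3. K v1 v2 v3 x))))
   = avg S1 (\<lambda>v1. avg S2 (\<lambda>v2. avg S3 (\<lambda>v3. E (K v1 v2 v3))))"
  by (subst avg_swap, rule avg_cong, subst avg_swap, rule avg_cong, rule avg_swap)

lemma form7_diff_le:
  assumes "0 \<le> e"
    and "\<And>v1 v2 v3. v1 \<in> S1 \<Longrightarrow> v2 \<in> S2 \<Longrightarrow> v3 \<in> S3 \<Longrightarrow>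
      E (\<lambda>x. \<bar>b x * a1 (T v1 x) * a2 (T v2 x) * a3 (T v3 x) - b' x * a1' (T v1 x) * a2' (T v2 x) * a3' (T v3 x)\<bar>) \<le> e"
    and f: "\<And>x. \<bar>f x\<bar> \<le> 1"
  shows "\<bar>form7 f b a1 a2 a3 S1 S2 S3 - form7 f b' a1' a2' a3' S1 S2 S3\<bar> \<le> e"
proof -
  let ?F = "\<lambda>b a1 a2 a3 v1 v2 v3 x. b x * a1 (T v1 x) * a2 (T v2 x) * a3 (T v3 x)
       * f (T (v1 + v2) x) * f (T (v1 + v3) x) * f (T (v2 + v3) x)"
  have "\<bar>form7 f b a1 a2 a3 S1 S2 S3 - form7 f b' a1' a2' a3' S1 S2 S3\<bar>
     \<le> avg S1 (\<lambda>v1. avg S2 (\<lambda>v2. avg S3 (\<lambda>v3. E (\<lambda>x. \<bar>?F b a1 a2 a3 v1 v2 v3 x - ?F b' a1' a2' a3' v1 v2 v3 x\<bar>))))"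
    unfolding form7_def E_avg3
    by (rule order_trans[OF abs_avg_diff_le avg_mono], rule order_trans[OF abs_avg_diff_le avg_mono],
        rule order_trans[OF abs_avg_diff_le avg_mono], rule abs_avg_diff_le)
  also have "\<dots> \<le> e"
  proof (rule avg_le_const[OF avg_le_const[OF avg_le_const[OF _ \<open>0 \<le> e\<close>] \<open>0 \<le> e\<close>] \<open>0 \<le> e\<close>])
    fix v1 v2 v3 assume v: "v1 \<in> S1" "v2 \<in> S2" "v3 \<in> S3"
    have "E (\<lambda>x. \<bar>?F b a1 a2 a3 v1 v2 v3 x - ?F b' a1' a2' a3' v1 v2 v3 x\<bar>) \<le>
      E (\<lambda>x. \<bar>b x * a1 (T v1 x) * a2 (T v2 x) * a3 (T v3 x) - b' x * a1' (T v1 x) * a2' (T v2 x) * a3' (T v3 x)\<bar>)"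
    proof (rule avg_mono)
      fix x
      let ?k = "f (T (v1 + v2) x) * f (T (v1 + v3) x) * f (T (v2 + v3) x)"
      have "\<bar>?k\<bar> \<le> 1" by (intro abs_prod_le_one f)
      moreover have "?F b a1 a2 a3 v1 v2 v3 x - ?F b' a1' a2' a3' v1 v2 v3 x =
        (b x * a1 (T v1 x) * a2 (T v2 x) * a3 (T v3 x) - b' x * a1' (T v1 x) * a2' (T v2 x) * a3' (T v3 x)) * ?k"
        by (simp add: algebra_simps)
      ultimately show "\<bar>?F b a1 a2 a3 v1 v2 v3 x - ?F b' a1' a2' a3' v1 v2 v3 x\<bar> \<le>
        \<bar>b x * a1 (T v1 x) * a2 (T v2 x) * a3 (T v3 x) - b' x * a1' (T v1 x) * a2' (T v2 x) * a3' (T v3 x)\<bar>"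
        by (simp only: abs_mult) (simp add: mult_left_le)
    qed
    also have "\<dots> \<le> e" by (rule assms(2)[OF v])
    finally show "E (\<lambda>x. \<bar>?F b a1 a2 a3 v1 v2 v3 x - ?F b' a1' a2' a3' v1 v2 v3 x\<bar>) \<le> e" .
  qed
  finally show ?thesis .
qed

text \<open>Changing \<open>v\<^sub>1\<close> involves \<open>y \<mapsto> fA y * fB (y + v\<^sub>2) * fB (y + v\<^sub>3)\<close>. These are three of the four
  vertices of a parallelogram; the fourth one carries the constant function 1.\<close>

definition vert :: "('x \<Rightarrow> real) \<Rightarrow> ('x \<Rightarrow> real) \<Rightarrow> bool \<Rightarrow> bool \<Rightarrow> 'x \<Rightarrow> real"
  where "vert fA fB i k = (if i then if k then (\<lambda>_. 1) else fB else if k then fB else fA)"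

text \<open>Both averages over \<open>v1\<close> are close to the same box average of
  \<open>?G v2 v3\<close>, at a cost given by the defect of this product. The average of the defects
  over \<open>S2\<close> and \<open>S3\<close> is dominated by one over differences in the large
  box, which is a difference of cube forms. The two dominations give the factor
  \<open>(4 * Q)\<^sup>2\<close>.\<close>

lemma structured_v_step:
  assumes fA: "\<And>x. 0 \<le> fA x \<and> fA x \<le> 1" and fB: "\<And>x. 0 \<le> fB x \<and> fB x \<le> 1"
    and b: "\<And>x. \<bar>b x\<bar> \<le> 1"
    and l: "l > 0" "L > 0" "l dvd L" and \<eta>: "\<eta> \<ge> 0" and \<theta>: "\<theta> > 0"
    and well_spread: "well_spread l L D \<eta> Q S1" "well_spread l L D \<eta> Q S1'" "well_spread l L D \<eta> Q S2" "well_spread l L D \<eta> Q S3"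
    and \<delta>: "cube l L L (\<lambda>_. vert fA fB) - cube L L L (\<lambda>_. vert fA fB) \<le> \<delta>"
  shows "\<bar>form7 fB b fA fA fA S1 S2 S3 - form7 fB b fA fA fA S1' S2 S3\<bar>
     \<le> 2 * (\<eta> + \<theta> + 16 * Q\<^sup>2 * \<delta> / \<theta> + 8 * D / L)"
proof -
  let ?G = "\<lambda>v2 v3 y. fA y * fB (T v2 y) * fB (T v3 y)"
  let ?d = "\<lambda>v2 v3. box_defect l L (?G v2 v3) (?G v2 v3)"
  have aA: "\<bar>fA x\<bar> \<le> 1" and aB: "\<bar>fB x\<bar> \<le> 1" for x using fA[of x] fB[of x] by auto
  have D: "D \<ge> 0"
  proof -
    obtain v where "v \<in> S1" using well_spread(1) by (auto simp: well_spread_def)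
    then have "real_of_int \<bar>fst v\<bar> \<le> D" using well_spread(1) by (auto simp: well_spread_def)
    then show ?thesis by linarith
  qed
  have Q: "Q \<ge> 0"
  proof (rule ccontr)
    assume "\<not> Q \<ge> 0"
    then have "Q * card S1 \<le> 0" by (simp add: mult_nonpos_nonneg)
    moreover have "(real L)\<^sup>2 \<le> Q * card S1" using well_spread(1) by (simp add: well_spread_def)
    ultimately have "(real L)\<^sup>2 \<le> 0" by linarith
    then show False using l by simp
  qed
  have G1: "\<bar>?G v2 v3 x\<bar> \<le> 1" for v2 v3 x by (intro abs_prod_le_one aA aB)
  have d0: "0 \<le> ?d v2 v3" for v2 v3 by (rule box_defect_nonneg[OF l])
  let ?e = "\<lambda>v2 v3. \<eta> + \<theta> + ?d v2 v3 / \<theta> + 8 * D / L"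
  have e: "E (\<lambda>x. \<bar>avg S (\<lambda>v. ?G v2 v3 (T v x)) - box_avg l (?G v2 v3) x\<bar>) \<le> ?e v2 v3"
    if "well_spread l L D \<eta> Q S" for S v2 v3
    using well_spread_avg_close[OF that l \<eta> \<theta>, where g = "?G v2 v3" and v = 0, OF G1] D by simp
  have "\<bar>form7 fB b fA fA fA S1 S2 S3 - form7 fB b fA fA fA S1' S2 S3\<bar> \<le>
    avg S2 (\<lambda>v2. avg S3 (\<lambda>v3. E (\<lambda>x. \<bar>avg S1 (\<lambda>v. ?G v2 v3 (T v x)) - avg S1' (\<lambda>v. ?G v2 v3 (T v x))\<bar>)))"
    by (rule form7_change1) (use aA aB b in auto)
  also have "\<dots> \<le> avg S2 (\<lambda>v2. avg S3 (\<lambda>v3. 2 * (\<eta> + \<theta> + 8 * D / L) + 2 / \<theta> * ?d v2 v3))"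
  proof (intro avg_mono)
    fix v2 v3
    have "E (\<lambda>x. \<bar>avg S1 (\<lambda>v. ?G v2 v3 (T v x)) - avg S1' (\<lambda>v. ?G v2 v3 (T v x))\<bar>)
      \<le> E (\<lambda>x. \<bar>avg S1 (\<lambda>v. ?G v2 v3 (T v x)) - box_avg l (?G v2 v3) x\<bar>
           + \<bar>avg S1' (\<lambda>v. ?G v2 v3 (T v x)) - box_avg l (?G v2 v3) x\<bar>)"
      by (intro avg_mono) linarith
    also have "\<dots> \<le> ?e v2 v3 + ?e v2 v3" unfolding avg_add by (intro add_mono e well_spread)
    finally show "E (\<lambda>x. \<bar>avg S1 (\<lambda>v. ?G v2 v3 (T v x)) - avg S1' (\<lambda>v. ?G v2 v3 (T v x))\<bar>)
       \<le> 2 * (\<eta> + \<theta> + 8 * D / L) + 2 / \<theta> * ?d v2 v3" by simp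
  qed
  also have "\<dots> = 2 * (\<eta> + \<theta> + 8 * D / L) + 2 / \<theta> * avg S2 (\<lambda>v2. avg S3 (\<lambda>v3. ?d v2 v3))"
  proof -
    have "finite S2" "S2 \<noteq> {}" "finite S3" "S3 \<noteq> {}" using well_spread by (auto simp: well_spread_def)
    then show ?thesis by (simp add: avg_add avg_cmult avg_const avg_divc)
  qed
  also have "\<dots> \<le> 2 * (\<eta> + \<theta> + 8 * D / L) + 2 / \<theta> * (16 * Q\<^sup>2 * \<delta>)"
  proof -
    have sm: "2 * \<bar>fst v\<bar> \<le> int L \<and> 2 * \<bar>snd v\<bar> \<le> int L" if "well_spread l L D \<eta> Q S" "v \<in> S" for S v
    proof -
      have "real_of_int \<bar>fst v\<bar> \<le> D" "real_of_int \<bar>snd v\<bar> \<le> D" "2 * D \<le> L"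
        using that by (auto simp: well_spread_def)
      then have "2 * real_of_int \<bar>fst v\<bar> \<le> real L \<and> 2 * real_of_int \<bar>snd v\<bar> \<le> real L" by linarith
      then show ?thesis by linarith
    qed
    have k: "avg S f \<le> 4 * Q * diff_avg L f" if "well_spread l L D \<eta> Q S" "\<And>v. 0 \<le> f v" for S f
    proof (rule avg_le_diff_avg)
      show "finite S" "S \<noteq> {}" "(real L)\<^sup>2 \<le> Q * card S" using that(1) by (simp_all add: well_spread_def)
    qed (use that sm l in auto)
    have "avg S2 (\<lambda>v2. avg S3 (\<lambda>v3. ?d v2 v3)) \<le> 4 * Q * diff_avg L (\<lambda>v2. avg S3 (\<lambda>v3. ?d v2 v3))"
      by (intro k well_spread avg_nonneg d0)
    also have "\<dots> \<le> 4 * Q * diff_avg L (\<lambda>v2. 4 * Q * diff_avg L (\<lambda>v3. ?d v2 v3))"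
      using Q by (intro mult_left_mono diff_avg_mono k well_spread d0) auto
    also have "\<dots> = 16 * Q\<^sup>2 * diff_avg L (\<lambda>v2. diff_avg L (\<lambda>v3. ?d v2 v3))"
      unfolding diff_avg_def by (simp add: avg_cmult power2_eq_square)
    also have "diff_avg L (\<lambda>v2. diff_avg L (\<lambda>v3. ?d v2 v3))
        = cube l L L (\<lambda>_. vert fA fB) - cube L L L (\<lambda>_. vert fA fB)"
    proof -
      have "sq (vert fA fB) v w = ?G v w" for v w by (rule ext) (simp add: sq_def vert_def)
      then show ?thesis by (simp only: cube_diff_eq)
    qed
    also have "16 * Q\<^sup>2 * (cube l L L (\<lambda>_. vert fA fB) - cube L L L (\<lambda>_. vert fA fB)) \<le> 16 * Q\<^sup>2 * \<delta>"
      using \<delta> by (intro mult_left_mono) auto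
    finally show ?thesis using \<theta> by (intro add_left_mono mult_left_mono) auto
  qed
  also have "\<dots> = 2 * (\<eta> + \<theta> + 16 * Q\<^sup>2 * \<delta> / \<theta> + 8 * D / L)" by (simp add: field_simps)
  finally show ?thesis .
qed

lemma structured_v_steps:
  assumes fA: "\<And>x. 0 \<le> fA x \<and> fA x \<le> 1" and fB: "\<And>x. 0 \<le> fB x \<and> fB x \<le> 1"
    and b: "\<And>x. \<bar>b x\<bar> \<le> 1"
    and l: "l > 0" "L > 0" "l dvd L" and \<eta>: "\<eta> \<ge> 0" and \<theta>: "\<theta> > 0"
    and well_spread: "well_spread l L D \<eta> Q S1" "well_spread l L D \<eta> Q S2" "well_spread l L D \<eta> Q S3"
       "well_spread l L D \<eta> Q S1'" "well_spread l L D \<eta> Q S2'" "well_spread l L D \<eta> Q S3'"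
    and \<delta>: "cube l L L (\<lambda>_. vert fA fB) - cube L L L (\<lambda>_. vert fA fB) \<le> \<delta>"
  shows "\<bar>form7 fB b fA fA fA S1 S2 S3 - form7 fB b fA fA fA S1' S2' S3'\<bar>
     \<le> 6 * (\<eta> + \<theta> + 16 * Q\<^sup>2 * \<delta> / \<theta> + 8 * D / L)"
proof -
  note st = structured_v_step[where fA = fA and fB = fB and b = b, OF fA fB b l \<eta> \<theta> _ _ _ _ \<delta>]
  have "\<bar>form7 fB b fA fA fA S1 S2 S3 - form7 fB b fA fA fA S1' S2 S3\<bar> \<le> 2 * (\<eta> + \<theta> + 16 * Q\<^sup>2 * \<delta> / \<theta> + 8 * D / L)"
    by (intro st well_spread)
  moreover have "\<bar>form7 fB b fA fA fA S1' S2 S3 - form7 fB b fA fA fA S1' S2' S3\<bar> \<le> 2 * (\<eta> + \<theta> + 16 * Q\<^sup>2 * \<delta> / \<theta> + 8 * D / L)"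
    unfolding form7_swap12[of fB b fA fA fA S1'] by (intro st well_spread)
  moreover have "\<bar>form7 fB b fA fA fA S1' S2' S3 - form7 fB b fA fA fA S1' S2' S3'\<bar> \<le> 2 * (\<eta> + \<theta> + 16 * Q\<^sup>2 * \<delta> / \<theta> + 8 * D / L)"
    unfolding form7_swap13[of fB b fA fA fA S1'] by (intro st well_spread)
  ultimately show ?thesis by argo
qed

text \<open>The averages over \<open>s1\<close>, \<open>s2\<close>, \<open>s3\<close> all become
  \<open>box_avg l fB\<close>, evaluated at \<open>x\<close> and not at the points
  \<open>x + v1\<close>, \<open>x + v2\<close>, \<open>x + v3\<close>. As a weight at
  \<open>x\<close> it does not interfere with moving the other vectors, and the two-point defect of
  \<open>fB\<close> is all that is spent.\<close>

lemma structured_s_steps: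
  assumes fA: "\<And>x. 0 \<le> fA x \<and> fA x \<le> 1" and fB: "\<And>x. 0 \<le> fB x \<and> fB x \<le> 1"
    and l: "l > 0" "L > 0" "l dvd L" and \<eta>: "\<eta> \<ge> 0" and \<theta>: "\<theta> > 0"
    and well_spread: "well_spread l L D \<eta> Q S1" "well_spread l L D \<eta> Q S2" "well_spread l L D \<eta> Q S3"
       "well_spread l L D \<eta> Q U1" "well_spread l L D \<eta> Q U2" "well_spread l L D \<eta> Q U3"
    and \<delta>: "box_defect l L fB fB \<le> \<delta>"
  shows "\<bar>config_avg fA fB S1 S2 S3 U1 U2 U3
      - form7 fB (\<lambda>x. fB x * box_avg l fB x ^ 3) fA fA fA S1 S2 S3\<bar>
     \<le> 3 * (\<eta> + \<theta> + \<delta> / \<theta> + 8 * D / L)"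
proof -
  let ?e = "\<eta> + \<theta> + \<delta> / \<theta> + 8 * D / L"
  let ?\<beta> = "box_avg l fB" and ?g = "\<lambda>U x. avg U (\<lambda>s. fB (T s x))"
  have aB: "\<bar>fB x\<bar> \<le> 1" for x using fB[of x] by auto
  have \<beta>01: "0 \<le> ?\<beta> x \<and> ?\<beta> x \<le> 1" for x
    unfolding box_avg_def using fB by (auto intro!: avg_nonneg avg_le_const)
  have g01: "0 \<le> ?g U x \<and> ?g U x \<le> 1" for U x
    using fB by (auto intro!: avg_nonneg avg_le_const)
  have e: "E (\<lambda>x. \<bar>?g U (T v x) - ?\<beta> x\<bar>) \<le> ?e" if "well_spread l L D \<eta> Q U" "well_spread l L D \<eta> Q S" "v \<in> S" for U S v
  proof -
    have "E (\<lambda>x. \<bar>?g U (T v x) - ?\<beta> x\<bar>) \<le> \<eta> + \<theta> + box_defect l L fB fB / \<theta> + 8 * D / L"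
      by (rule well_spread_avg_close[OF that(1) l \<eta> \<theta> aB]) (use that in \<open>auto simp: well_spread_def\<close>)
    also have "\<dots> \<le> ?e" using \<delta> \<theta> by (simp add: divide_right_mono)
    finally show ?thesis .
  qed
  have tel: "\<bar>b * (a1 * g1) * (a2 * g2) * (a3 * g3) - (b * \<beta> ^ 3) * a1 * a2 * a3\<bar> \<le> \<bar>g1 - \<beta>\<bar> + \<bar>g2 - \<beta>\<bar> + \<bar>g3 - \<beta>\<bar>"
    if "0 \<le> b \<and> b \<le> 1" "0 \<le> a1 \<and> a1 \<le> 1" "0 \<le> a2 \<and> a2 \<le> 1" "0 \<le> a3 \<and> a3 \<le> 1"
      "0 \<le> g1 \<and> g1 \<le> 1" "0 \<le> g2 \<and> g2 \<le> 1" "0 \<le> g3 \<and> g3 \<le> 1" "0 \<le> \<beta> \<and> \<beta> \<le> 1"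
    for b a1 a2 a3 g1 g2 g3 \<beta> :: real
  proof -
    have "b * (a1 * g1) * (a2 * g2) * (a3 * g3) - (b * \<beta> ^ 3) * a1 * a2 * a3 =
      (b * a1 * a2 * a3 * g2 * g3) * (g1 - \<beta>) + (b * a1 * a2 * a3 * \<beta> * g3) * (g2 - \<beta>) + (b * a1 * a2 * a3 * \<beta> * \<beta>) * (g3 - \<beta>)"
      by (simp add: algebra_simps power3_eq_cube)
    also have "\<bar>\<dots>\<bar> \<le> \<bar>(b * a1 * a2 * a3 * g2 * g3) * (g1 - \<beta>)\<bar> + \<bar>(b * a1 * a2 * a3 * \<beta> * g3) * (g2 - \<beta>)\<bar> + \<bar>(b * a1 * a2 * a3 * \<beta> * \<beta>) * (g3 - \<beta>)\<bar>"
      by linarith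
    also have "\<dots> \<le> 1 * \<bar>g1 - \<beta>\<bar> + 1 * \<bar>g2 - \<beta>\<bar> + 1 * \<bar>g3 - \<beta>\<bar>"
      unfolding abs_mult[of _ "g1 - \<beta>"] abs_mult[of _ "g2 - \<beta>"] abs_mult[of _ "g3 - \<beta>"]
      by (intro add_mono mult_right_mono abs_prod_le_one) (use that in auto)
    finally show ?thesis by simp
  qed
  show ?thesis unfolding config_avg_def
  proof (rule form7_diff_le)
    obtain v where "v \<in> S1" using well_spread(1) by (auto simp: well_spread_def)
    then have "real_of_int \<bar>fst v\<bar> \<le> D" using well_spread(1) by (auto simp: well_spread_def)
    then have "0 \<le> D" by linarith
    moreover have "0 \<le> \<delta>" using box_defect_nonneg[OF l, of fB] \<delta> by linarith
    ultimately show "0 \<le> 3 * ?e" using \<eta> \<theta> by simp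
  next
    fix v1 v2 v3 assume v: "v1 \<in> S1" "v2 \<in> S2" "v3 \<in> S3"
    have "E (\<lambda>x. \<bar>fB x * (fA (T v1 x) * ?g U1 (T v1 x)) * (fA (T v2 x) * ?g U2 (T v2 x)) * (fA (T v3 x) * ?g U3 (T v3 x))
        - (fB x * ?\<beta> x ^ 3) * fA (T v1 x) * fA (T v2 x) * fA (T v3 x)\<bar>)
      \<le> E (\<lambda>x. \<bar>?g U1 (T v1 x) - ?\<beta> x\<bar> + \<bar>?g U2 (T v2 x) - ?\<beta> x\<bar> + \<bar>?g U3 (T v3 x) - ?\<beta> x\<bar>)"
      by (intro avg_mono tel fA fB \<beta>01 g01)
    also have "\<dots> \<le> ?e + ?e + ?e"
      unfolding avg_add
      by (intro add_mono e[OF well_spread(4) well_spread(1) v(1)] e[OF well_spread(5) well_spread(2) v(2)] e[OF well_spread(6) well_spread(3) v(3)])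
    finally show "E (\<lambda>x. \<bar>fB x * (fA (T v1 x) * ?g U1 (T v1 x)) * (fA (T v2 x) * ?g U2 (T v2 x)) * (fA (T v3 x) * ?g U3 (T v3 x))
        - (fB x * ?\<beta> x ^ 3) * fA (T v1 x) * fA (T v2 x) * fA (T v3 x)\<bar>) \<le> 3 * ?e" by simp
  qed (rule aB)
qed

text \<open>Pigeonhole: the nonnegative quantities \<open>?s j\<close> sum to at most 6 over any
  number of scales. The sets, \<open>D\<close> and \<open>Q\<close> are quantified after
  \<open>j\<close>, because the sets to be compared depend on the dilation that is found.\<close>

lemma structured_scale:
  assumes fA: "\<And>x. 0 \<le> fA x \<and> fA x \<le> 1" and fB: "\<And>x. 0 \<le> fB x \<and> fB x \<le> 1"
    and l: "\<And>j. l j > 0" "\<And>j. l j dvd l (Suc j)" and \<eta>: "\<eta> \<ge> 0" and \<theta>: "\<theta> > 0"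
    and J: "J > 0" and \<delta>: "6 / J \<le> \<delta>"
  obtains j where "j < J"
    "\<And>D Q S1 S2 S3 U1 U2 U3 S1' S2' S3' U1' U2' U3'.
      (\<And>S. S \<in> {S1, S2, S3, U1, U2, U3, S1', S2', S3', U1', U2', U3'} \<Longrightarrow> well_spread (l j) (l (Suc j)) D \<eta> Q S) \<Longrightarrow>
      \<bar>config_avg fA fB S1 S2 S3 U1 U2 U3 - config_avg fA fB S1' S2' S3' U1' U2' U3'\<bar>
        \<le> 12 * (\<eta> + \<theta> + 8 * D / l (Suc j)) + 6 * (\<delta> / \<theta>) + 6 * (16 * Q\<^sup>2 * \<delta> / \<theta>)"
proof -
  let ?h = "\<lambda>_. vert fA fB"
  let ?s = "\<lambda>j. d1 l ?h j + box_defect (l j) (l (Suc j)) fB fB"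
  have nn: "0 \<le> d1 l ?h j" "0 \<le> box_defect (l j) (l (Suc j)) fB fB" for j
    by (auto intro!: d1_nonneg box_defect_nonneg l)
  have vert01: "0 \<le> vert fA fB i k x \<and> vert fA fB i k x \<le> 1" for i k x
    using fA[of x] fB[of x] by (auto simp: vert_def)
  have "(\<Sum>j<J. ?s j) \<le> 5 + 1"
    unfolding sum.distrib by (intro add_mono sum_d1_le sum_box_defect_le l vert01 fB)
  have "\<exists>j<J. ?s j \<le> 6 / J"
  proof (rule ccontr)
    assume "\<not> ?thesis"
    then have "(\<Sum>j<J. 6 / J) < (\<Sum>j<J. ?s j)" using J by (intro sum_strict_mono) auto
    moreover have "(\<Sum>j<J. 6 / J) = 6" using J by simp
    ultimately show False using \<open>(\<Sum>j<J. ?s j) \<le> 5 + 1\<close> by linarith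
  qed
  then obtain j where j: "j < J" "?s j \<le> 6 / J" by blast
  then have \<delta>1: "cube (l j) (l (Suc j)) (l (Suc j)) ?h - cube (l (Suc j)) (l (Suc j)) (l (Suc j)) ?h \<le> \<delta>"
    and \<delta>2: "box_defect (l j) (l (Suc j)) fB fB \<le> \<delta>"
    using nn[of j] \<delta> by (auto simp: d1_def)
  show ?thesis
  proof (rule that[OF j(1)])
    fix D Q S1 S2 S3 U1 U2 U3 S1' S2' S3' U1' U2' U3'
    assume well_spread: "\<And>S. S \<in> {S1, S2, S3, U1, U2, U3, S1', S2', S3', U1', U2', U3'} \<Longrightarrow> well_spread (l j) (l (Suc j)) D \<eta> Q S"
    \<comment> \<open>The weight left behind by the averages over the three \<open>s\<close>
      vectors. Both families of sets are brought to this weight before the sets for the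
      \<open>v\<close> vectors are exchanged.\<close>
    let ?b = "\<lambda>x. fB x * box_avg (l j) fB x ^ 3"
    have b: "\<bar>?b x\<bar> \<le> 1" for x
    proof -
      have "\<bar>box_avg (l j) fB x\<bar> \<le> 1" using fB by (intro abs_box_avg_le) auto
      then have "\<bar>box_avg (l j) fB x ^ 3\<bar> \<le> 1" by (simp add: power_abs power_le_one)
      then show ?thesis using fB[of x] by (intro abs_prod_le_one) auto
    qed
    have "\<bar>config_avg fA fB S1 S2 S3 U1 U2 U3 - form7 fB ?b fA fA fA S1 S2 S3\<bar> \<le> 3 * (\<eta> + \<theta> + \<delta> / \<theta> + 8 * D / l (Suc j))"
      by (rule structured_s_steps[OF fA fB l(1) l(1) l(2) \<eta> \<theta> _ _ _ _ _ _ \<delta>2]) (rule well_spread, simp)+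
    moreover have "\<bar>config_avg fA fB S1' S2' S3' U1' U2' U3' - form7 fB ?b fA fA fA S1' S2' S3'\<bar> \<le> 3 * (\<eta> + \<theta> + \<delta> / \<theta> + 8 * D / l (Suc j))"
      by (rule structured_s_steps[OF fA fB l(1) l(1) l(2) \<eta> \<theta> _ _ _ _ _ _ \<delta>2]) (rule well_spread, simp)+
    moreover have "\<bar>form7 fB ?b fA fA fA S1 S2 S3 - form7 fB ?b fA fA fA S1' S2' S3'\<bar> \<le> 6 * (\<eta> + \<theta> + 16 * Q\<^sup>2 * \<delta> / \<theta> + 8 * D / l (Suc j))"
      by (rule structured_v_steps[OF fA fB b l(1) l(1) l(2) \<eta> \<theta> _ _ _ _ _ _ \<delta>1]) (rule well_spread, simp)+
    ultimately show "\<bar>config_avg fA fB S1 S2 S3 U1 U2 U3 - config_avg fA fB S1' S2' S3' U1' U2' U3'\<bar>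
        \<le> 12 * (\<eta> + \<theta> + 8 * D / l (Suc j)) + 6 * (\<delta> / \<theta>) + 6 * (16 * Q\<^sup>2 * \<delta> / \<theta>)"
      by argo
  qed
qed

lemma config_avg_change:
  assumes fA: "\<And>x. 0 \<le> fA x \<and> fA x \<le> 1" and fB: "\<And>x. 0 \<le> fB x \<and> fB x \<le> 1"
    and e: "\<And>G S S'. (\<And>x. \<bar>G x\<bar> \<le> 1) \<Longrightarrow>
      (S, S') \<in> {(S1, S1'), (S2, S2'), (S3, S3'), (U1, U1'), (U2, U2'), (U3, U3')} \<Longrightarrow>
      E (\<lambda>x. \<bar>avg S (\<lambda>v. G (T v x)) - avg S' (\<lambda>v. G (T v x))\<bar>) \<le> e" and e0: "0 \<le> e"
  shows "\<bar>config_avg fA fB S1 S2 S3 U1 U2 U3 - config_avg fA fB S1' S2' S3' U1' U2' U3'\<bar> \<le> 6 * e"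
proof -
  let ?a = "\<lambda>U y. fA y * avg U (\<lambda>s. fB (T s y))"
  have aA: "\<bar>fA x\<bar> \<le> 1" and aB: "\<bar>fB x\<bar> \<le> 1" for x using fA[of x] fB[of x] by auto
  have aa: "\<bar>?a U y\<bar> \<le> 1" for U y using fB
    by (intro abs_prod_le_one aA abs_avg_le_const aB) auto
  have v: "\<bar>form7 fB fB (?a V1) (?a V2) (?a V3) R R2 R3 - form7 fB fB (?a V1) (?a V2) (?a V3) R' R2 R3\<bar> \<le> e"
    if R: "(R, R') \<in> {(S1, S1'), (S2, S2'), (S3, S3'), (U1, U1'), (U2, U2'), (U3, U3')}" for V1 V2 V3 R R' R2 R3
  proof -
    have "\<bar>form7 fB fB (?a V1) (?a V2) (?a V3) R R2 R3 - form7 fB fB (?a V1) (?a V2) (?a V3) R' R2 R3\<bar> \<le>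
       avg R2 (\<lambda>v2. avg R3 (\<lambda>v3. E (\<lambda>x. \<bar>avg R (\<lambda>v. ?a V1 (T v x) * fB (T v2 (T v x)) * fB (T v3 (T v x)))
       - avg R' (\<lambda>v. ?a V1 (T v x) * fB (T v2 (T v x)) * fB (T v3 (T v x)))\<bar>)))"
      by (rule form7_change1[OF aB aa aa aB])
    also have "\<dots> \<le> e"
    proof (rule avg_le_const[OF avg_le_const[OF _ e0] e0])
      fix v2 v3
      show "E (\<lambda>x. \<bar>avg R (\<lambda>v. ?a V1 (T v x) * fB (T v2 (T v x)) * fB (T v3 (T v x)))
       - avg R' (\<lambda>v. ?a V1 (T v x) * fB (T v2 (T v x)) * fB (T v3 (T v x)))\<bar>) \<le> e"
        by (rule e[of "\<lambda>y. ?a V1 y * fB (T v2 y) * fB (T v3 y)", OF _ R]) (intro abs_prod_le_one aa aB)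
    qed
    finally show ?thesis .
  qed
  have u: "\<bar>form7 fB fB (?a V) (?a V2) (?a V3) R R2 R3 - form7 fB fB (?a V') (?a V2) (?a V3) R R2 R3\<bar> \<le> e"
    if V: "(V, V') \<in> {(S1, S1'), (S2, S2'), (S3, S3'), (U1, U1'), (U2, U2'), (U3, U3')}" for V V' V2 V3 R R2 R3
  proof (rule form7_diff_le[OF e0 _ aB])
    fix v1 v2 v3
    let ?k = "\<lambda>x. fB x * fA (T v1 x) * ?a V2 (T v2 x) * ?a V3 (T v3 x)"
    have "E (\<lambda>x. \<bar>fB x * ?a V (T v1 x) * ?a V2 (T v2 x) * ?a V3 (T v3 x) - fB x * ?a V' (T v1 x) * ?a V2 (T v2 x) * ?a V3 (T v3 x)\<bar>)
      \<le> E (\<lambda>x. \<bar>avg V (\<lambda>s. fB (T s (T v1 x))) - avg V' (\<lambda>s. fB (T s (T v1 x)))\<bar>)"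
    proof (rule avg_mono)
      fix x
      have k: "\<bar>?k x\<bar> \<le> 1" by (intro abs_prod_le_one aA aB aa)
      have "fB x * ?a V (T v1 x) * ?a V2 (T v2 x) * ?a V3 (T v3 x) - fB x * ?a V' (T v1 x) * ?a V2 (T v2 x) * ?a V3 (T v3 x)
        = ?k x * (avg V (\<lambda>s. fB (T s (T v1 x))) - avg V' (\<lambda>s. fB (T s (T v1 x))))"
        by (simp add: algebra_simps del: T_T)
      then show "\<bar>fB x * ?a V (T v1 x) * ?a V2 (T v2 x) * ?a V3 (T v3 x) - fB x * ?a V' (T v1 x) * ?a V2 (T v2 x) * ?a V3 (T v3 x)\<bar>
        \<le> \<bar>avg V (\<lambda>s. fB (T s (T v1 x))) - avg V' (\<lambda>s. fB (T s (T v1 x)))\<bar>"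
        using k by (simp only: abs_mult[of "?k x"] mult_left_le_one_le abs_ge_zero)
    qed
    also have "\<dots> = E (\<lambda>x. \<bar>avg V (\<lambda>s. fB (T s x)) - avg V' (\<lambda>s. fB (T s x))\<bar>)"
      by (rule E_shift[of "\<lambda>x. \<bar>avg V (\<lambda>s. fB (T s x)) - avg V' (\<lambda>s. fB (T s x))\<bar>" v1])
    also have "\<dots> \<le> e" by (rule e[OF aB V])
    finally show "E (\<lambda>x. \<bar>fB x * ?a V (T v1 x) * ?a V2 (T v2 x) * ?a V3 (T v3 x) - fB x * ?a V' (T v1 x) * ?a V2 (T v2 x) * ?a V3 (T v3 x)\<bar>) \<le> e" .
  qed
  let ?F = "\<lambda>V1 V2 V3. form7 fB fB (?a V1) (?a V2) (?a V3)"
  have "\<bar>?F U1 U2 U3 S1 S2 S3 - ?F U1 U2 U3 S1' S2 S3\<bar> \<le> e" by (rule v) simp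
  moreover have "\<bar>?F U1 U2 U3 S1' S2 S3 - ?F U1 U2 U3 S1' S2' S3\<bar> \<le> e"
    unfolding form7_swap12[of fB fB "?a U1"] by (rule v) simp
  moreover have "\<bar>?F U1 U2 U3 S1' S2' S3 - ?F U1 U2 U3 S1' S2' S3'\<bar> \<le> e"
    unfolding form7_swap13[of fB fB "?a U1"] by (rule v) simp
  moreover have "\<bar>?F U1 U2 U3 S1' S2' S3' - ?F U1' U2 U3 S1' S2' S3'\<bar> \<le> e" by (rule u) simp
  moreover have "\<bar>?F U1' U2 U3 S1' S2' S3' - ?F U1' U2' U3 S1' S2' S3'\<bar> \<le> e"
    unfolding form7_swap12[of fB fB "?a U1'"] by (rule u) simp
  moreover have "\<bar>?F U1' U2' U3 S1' S2' S3' - ?F U1' U2' U3' S1' S2' S3'\<bar> \<le> e"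
    unfolding form7_swap13[of fB fB "?a U1'"] by (rule u) simp
  ultimately show ?thesis unfolding config_avg_def by linarith
qed

end

section \<open>Pair correlations along a curved graph\<close>

text \<open>The McShane extension, an infimum of cones placed at the integers. It is at least -1 by
  itself; cutting it off at 1 restores the upper bound and changes nothing at the integers.\<close>

lemma Lipschitz_extension_int:
  fixes \<sigma> :: "int \<Rightarrow> real"
  assumes b: "\<And>z. \<bar>\<sigma> z\<bar> \<le> 1" and K: "K \<ge> 0" and lip: "\<And>z w. \<bar>\<sigma> z - \<sigma> w\<bar> \<le> K * \<bar>real_of_int z - real_of_int w\<bar>"
  obtains \<rho> :: "real \<Rightarrow> real" where "\<And>z. \<bar>\<rho> z\<bar> \<le> 1" "\<And>z w. \<bar>\<rho> z - \<rho> w\<bar> \<le> K * \<bar>z - w\<bar>"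
    "\<And>z. \<rho> (of_int z) = \<sigma> z"
proof
  let ?f = "\<lambda>z w. \<sigma> w + K * \<bar>z - of_int w\<bar>"
  let ?\<rho> = "\<lambda>z. INF w. ?f z w"
  have lb: "-1 \<le> ?f z w" for z w using b[of w] K by (smt (verit) mult_nonneg_nonneg)
  then have bdd: "bdd_below (range (?f z))" for z by (auto simp: bdd_below_def)
  have le: "?\<rho> z \<le> ?\<rho> w + K * \<bar>z - w\<bar>" for z w
  proof -
    have "?\<rho> z - K * \<bar>z - w\<bar> \<le> ?\<rho> w"
    proof (rule cINF_greatest)
      fix v
      have "?\<rho> z \<le> ?f z v" by (rule cINF_lower[OF bdd]) simp
      moreover have "K * \<bar>z - of_int v\<bar> \<le> K * (\<bar>z - w\<bar> + \<bar>w - of_int v\<bar>)"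
        using K by (intro mult_left_mono) auto
      ultimately show "?\<rho> z - K * \<bar>z - w\<bar> \<le> ?f w v" by (simp add: algebra_simps)
    qed simp
    then show ?thesis by simp
  qed
  have l1: "-1 \<le> ?\<rho> z" for z by (rule cINF_greatest) (auto intro: lb)
  show "\<bar>min 1 (?\<rho> z)\<bar> \<le> 1" for z using l1[of z] by simp
  show "\<bar>min 1 (?\<rho> z) - min 1 (?\<rho> w)\<bar> \<le> K * \<bar>z - w\<bar>" for z w
    using le[of z w] le[of w z] K by (simp add: min_def abs_minus_commute) (smt (verit) abs_minus_commute mult_nonneg_nonneg)
  show "min 1 (?\<rho> (of_int z)) = \<sigma> z" for z
  proof -
    have "?\<rho> (of_int z) \<le> ?f (of_int z) z" by (rule cINF_lower[OF bdd]) simp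
    moreover have "\<sigma> z \<le> ?\<rho> (of_int z)"
    proof (rule cINF_greatest)
      fix w show "\<sigma> z \<le> ?f (of_int z) w" using lip[of z w] by linarith
    qed simp
    ultimately show ?thesis using b[of z] by simp
  qed
qed

text \<open>The function \<open>F = (P (\<psi> + y) - P \<psi>) / \<psi>'\<close>, where \<open>P' = \<rho>\<close>, is small and has derivative
  close to \<open>\<rho> (\<psi> + y) - \<rho> \<psi>\<close>, so the sum almost telescopes.\<close>

lemma shifted_sum_bound:
  fixes \<rho> \<psi> \<psi>' \<psi>'' :: "real \<Rightarrow> real" and a :: real
  assumes b: "\<And>z. \<bar>\<rho> z\<bar> \<le> 1" and K: "K \<ge> 0" and lip: "\<And>z w. \<bar>\<rho> z - \<rho> w\<bar> \<le> K * \<bar>z - w\<bar>"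
    and d1: "\<And>x. x \<in> {a..a + real q} \<Longrightarrow> (\<psi> has_real_derivative \<psi>' x) (at x)"
    and d2: "\<And>x. x \<in> {a..a + real q} \<Longrightarrow> (\<psi>' has_real_derivative \<psi>'' x) (at x)"
    and \<alpha>: "\<alpha> > 0" "\<And>x. x \<in> {a..a + real q} \<Longrightarrow> \<alpha> \<le> \<bar>\<psi>' x\<bar>"
    and A: "\<And>x. x \<in> {a..a + real q} \<Longrightarrow> \<bar>\<psi>' x\<bar> \<le> A"
    and \<beta>: "\<And>x. x \<in> {a..a + real q} \<Longrightarrow> \<bar>\<psi>'' x\<bar> \<le> \<beta>"
    and y: "y \<ge> 0"
  shows "\<bar>\<Sum>k<q. \<rho> (\<psi> (a + real k) + y) - \<rho> (\<psi> (a + real k))\<bar>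
     \<le> 2 * y / \<alpha> + real q * (2 * K * A + y * \<beta> / \<alpha>\<^sup>2)"
proof -
  let ?I = "{a..a + real q}"
  have "continuous_on ?I \<psi>" by (rule DERIV_continuous_on[of ?I \<psi> \<psi>']) (rule has_field_derivative_at_within[OF d1])
  then have "bounded (\<psi> ` ?I)" by (intro compact_imp_bounded compact_continuous_image) auto
  then obtain B where B: "\<And>x. x \<in> ?I \<Longrightarrow> \<bar>\<psi> x\<bar> \<le> B" unfolding bounded_iff real_norm_def by blast
  have B0: "B \<ge> 0" using B[of a] by auto
  have cont: "continuous_on S \<rho>" for S
    unfolding continuous_on_iff
  proof (intro ballI allI impI)
    fix x e :: real assume e: "e > 0"
    show "\<exists>d>0. \<forall>x'\<in>S. dist x' x < d \<longrightarrow> dist (\<rho> x') (\<rho> x) < e"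
    proof (intro exI conjI ballI impI)
      show "e / (K + 1) > 0" using e K by simp
      fix x' assume "dist x' x < e / (K + 1)"
      then have "(K + 1) * \<bar>x' - x\<bar> < e" using K by (simp add: dist_real_def field_simps)
      moreover have "K * \<bar>x' - x\<bar> \<le> (K + 1) * \<bar>x' - x\<bar>" by (intro mult_right_mono) auto
      ultimately show "dist (\<rho> x') (\<rho> x) < e" using lip[of x' x] by (simp add: dist_real_def)
    qed
  qed
  \<comment> \<open>The margin 1 at either end makes all relevant arguments interior, so that
    \<open>P\<close> has a two-sided derivative there.\<close>
  obtain P where P: "\<And>z. z \<in> {-B-1..B+y+1} \<Longrightarrow> (P has_vector_derivative \<rho> z) (at z within {-B-1..B+y+1})"
    using antiderivative_continuous[OF cont] by blast
  have P': "(P has_real_derivative \<rho> z) (at z)" if "-B-1 < z" "z < B+y+1" for z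
    using P[of z] that at_within_interior[of z "{-B-1..B+y+1}"]
    by (simp add: has_real_derivative_iff_has_vector_derivative)
  define F where "F x = (P (\<psi> x + y) - P (\<psi> x)) / \<psi>' x" for x
  define D where "D x = P (\<psi> x + y) - P (\<psi> x)" for x
  define e where "e x = \<rho> (\<psi> x + y) - \<rho> (\<psi> x)" for x
  have nz: "\<psi>' x \<noteq> 0" if "x \<in> ?I" for x using \<alpha>(1) \<alpha>(2)[OF that] by auto
  have D: "\<bar>D x\<bar> \<le> y" if x: "x \<in> ?I" for x
  proof (cases "y = 0")
    case False
    then have "\<psi> x < \<psi> x + y" using y by simp
    from MVT2[OF this, of P \<rho>] obtain z where "D x = (\<psi> x + y - \<psi> x) * \<rho> z"
      unfolding D_def using P' B[OF x] y by (smt (verit))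
    then show ?thesis using b[of z] y by (simp add: abs_mult mult_left_le)
  qed (simp add: D_def)
  have F': "(F has_real_derivative e x - D x * \<psi>'' x / (\<psi>' x)\<^sup>2) (at x)" if x: "x \<in> ?I" for x
  proof -
    have "(P has_real_derivative \<rho> (\<psi> x + y)) (at (\<psi> x + y))" "(P has_real_derivative \<rho> (\<psi> x)) (at (\<psi> x))"
      using B[OF x] y by (auto intro!: P')
    then have "((\<lambda>x. P (\<psi> x + y)) has_real_derivative \<rho> (\<psi> x + y) * \<psi>' x) (at x)"
      "((\<lambda>x. P (\<psi> x)) has_real_derivative \<rho> (\<psi> x) * \<psi>' x) (at x)"
      by (auto intro!: DERIV_chain2[where f = P] derivative_eq_intros d1[OF x])
    then have "((\<lambda>x. (P (\<psi> x + y) - P (\<psi> x)) / \<psi>' x) has_real_derivative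
       ((\<rho> (\<psi> x + y) * \<psi>' x - \<rho> (\<psi> x) * \<psi>' x) * \<psi>' x - (P (\<psi> x + y) - P (\<psi> x)) * \<psi>'' x) / (\<psi>' x * \<psi>' x)) (at x)"
      by (intro DERIV_divide DERIV_diff d2 x nz)
    moreover have "((\<rho> (\<psi> x + y) * \<psi>' x - \<rho> (\<psi> x) * \<psi>' x) * \<psi>' x - (P (\<psi> x + y) - P (\<psi> x)) * \<psi>'' x) / (\<psi>' x * \<psi>' x)
      = e x - D x * \<psi>'' x / (\<psi>' x)\<^sup>2"
      using nz[OF x] by (simp add: e_def D_def power2_eq_square field_simps)
    ultimately show ?thesis unfolding F_def[abs_def] by simp
  qed
  have Fb: "\<bar>F x\<bar> \<le> y / \<alpha>" if x: "x \<in> ?I" for x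
    unfolding F_def abs_divide D_def[symmetric] using \<alpha>(1) \<alpha>(2)[OF x] D[OF x] by (intro frac_le) auto
  \<comment> \<open>A mean value point \<open>z\<close> of \<open>F\<close> stands in for the
    integer. Moving from one to the other costs \<open>2 * K * A\<close> by the Lipschitz bounds,
    and the correction term in the derivative of \<open>F\<close> is at most
    \<open>y * \<beta> / \<alpha>\<^sup>2\<close>.\<close>
  have step: "\<bar>e (a + real k) - (F (a + real (Suc k)) - F (a + real k))\<bar> \<le> 2 * K * A + y * \<beta> / \<alpha>\<^sup>2"
    if k: "k < q" for k
  proof -
    have sub: "{a + real k..a + real (Suc k)} \<subseteq> ?I" using k by auto
    then have s: "x \<in> ?I" if "a + real k \<le> x" "x \<le> a + real (Suc k)" for x using that by auto
    have "\<exists>z. a + real k < z \<and> z < a + real (Suc k) \<and> F (a + real (Suc k)) - F (a + real k)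
      = (a + real (Suc k) - (a + real k)) * (e z - D z * \<psi>'' z / (\<psi>' z)\<^sup>2)"
      by (rule MVT2) (use F' s in auto)
    then obtain z where z: "a + real k < z" "z < a + real (Suc k)"
      "F (a + real (Suc k)) - F (a + real k) = e z - D z * \<psi>'' z / (\<psi>' z)\<^sup>2" by auto
    have zI: "z \<in> ?I" using s z by auto
    have "\<exists>w. a + real k < w \<and> w < z \<and> \<psi> z - \<psi> (a + real k) = (z - (a + real k)) * \<psi>' w"
      by (rule MVT2[OF z(1)]) (use d1 s z in auto)
    then obtain w where w: "a + real k < w" "w < z" "\<psi> z - \<psi> (a + real k) = (z - (a + real k)) * \<psi>' w" by auto
    have "\<bar>\<psi> z - \<psi> (a + real k)\<bar> = \<bar>z - (a + real k)\<bar> * \<bar>\<psi>' w\<bar>" using w(3) by (simp add: abs_mult)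
    also have "\<dots> \<le> 1 * A" using z w s by (intro mult_mono A) auto
    finally have "K * \<bar>\<psi> z - \<psi> (a + real k)\<bar> \<le> K * A" using K by (intro mult_left_mono) auto
    moreover have "\<bar>\<rho> (\<psi> (a + real k) + y) - \<rho> (\<psi> z + y)\<bar> \<le> K * \<bar>\<psi> z - \<psi> (a + real k)\<bar>"
      "\<bar>\<rho> (\<psi> (a + real k)) - \<rho> (\<psi> z)\<bar> \<le> K * \<bar>\<psi> z - \<psi> (a + real k)\<bar>"
      using lip[of "\<psi> (a + real k) + y" "\<psi> z + y"] lip[of "\<psi> (a + real k)" "\<psi> z"]
      by (simp_all add: abs_minus_commute)
    ultimately have "\<bar>e (a + real k) - e z\<bar> \<le> 2 * K * A" unfolding e_def by linarith
    moreover have "\<bar>D z * \<psi>'' z / (\<psi>' z)\<^sup>2\<bar> \<le> y * \<beta> / \<alpha>\<^sup>2"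
    proof -
      have "\<alpha>\<^sup>2 \<le> (\<psi>' z)\<^sup>2" using \<alpha>(1) power_mono[OF \<alpha>(2)[OF zI], of 2] by simp
      moreover have "\<bar>D z\<bar> * \<bar>\<psi>'' z\<bar> \<le> y * \<beta>" using D[OF zI] \<beta>[OF zI] y by (intro mult_mono) auto
      moreover from this have "0 \<le> y * \<beta>" by (rule order_trans[rotated]) simp
      ultimately show ?thesis unfolding abs_divide abs_mult using \<alpha>(1)
        by (intro frac_le) auto
    qed
    ultimately show ?thesis using z(3) by linarith
  qed
  have "(\<Sum>k<q. e (a + real k)) = (\<Sum>k<q. e (a + real k) - (F (a + real (Suc k)) - F (a + real k))) + (F (a + real q) - F (a + real 0))"
    using sum_lessThan_telescope[of "\<lambda>k. F (a + real k)" q] by (simp add: sum_subtractf)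
  also have "\<bar>\<dots>\<bar> \<le> (\<Sum>k<q. \<bar>e (a + real k) - (F (a + real (Suc k)) - F (a + real k))\<bar>) + (\<bar>F (a + real q)\<bar> + \<bar>F (a + real 0)\<bar>)"
    using sum_abs[of "\<lambda>k. e (a + real k) - (F (a + real (Suc k)) - F (a + real k))" "{..<q}"] by linarith
  also have "\<dots> \<le> (\<Sum>k<q. 2 * K * A + y * \<beta> / \<alpha>\<^sup>2) + (y / \<alpha> + y / \<alpha>)"
    by (intro add_mono sum_mono step Fb) auto
  finally show ?thesis by (simp add: e_def)
qed

text \<open>In the application \<open>n\<close> is \<open>t / h\<close>, the dilation in units of
  the lattice spacing. These are the columns met by the dilated graph, and
  \<open>graph_floor\<close> gives its rounded heights.\<close>

definition graph_points :: "real \<Rightarrow> real \<Rightarrow> real \<Rightarrow> int set"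
  where "graph_points \<alpha> \<beta> n = {i. \<alpha> * n \<le> of_int i \<and> of_int i \<le> \<beta> * n}"

definition graph_floor :: "(real \<Rightarrow> real) \<Rightarrow> real \<Rightarrow> int \<Rightarrow> int"
  where "graph_floor \<phi> n i = \<lfloor>n * \<phi> (of_int i / n)\<rfloor>"

lemma graph_points_eq: "graph_points \<alpha> \<beta> n = {\<lceil>\<alpha> * n\<rceil>..\<lfloor>\<beta> * n\<rfloor>}"
  by (auto simp: graph_points_def ceiling_le_iff le_floor_iff)

lemma finite_graph_points [simp]: "finite (graph_points \<alpha> \<beta> n)"
  by (simp add: graph_points_eq)

lemma card_graph_points: "(\<beta> - \<alpha>) * n - 1 \<le> real (card (graph_points \<alpha> \<beta> n))"
  unfolding graph_points_eq card_atLeastAtMost_int by (simp add: algebra_simps) linarith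

text \<open>The two-sided bound on \<open>\<phi>2\<close> keeps the first derivative of the vertical
  difference of points at horizontal distance \<open>d\<close> between multiples of
  \<open>d\<close>; the Lipschitz bound keeps its second derivative below a multiple of
  \<open>d\<close>.\<close>

locale curved_graph =
  fixes \<phi> \<phi>1 \<phi>2 :: "real \<Rightarrow> real" and \<alpha> \<beta> c C \<Lambda> :: real
  assumes \<alpha>\<beta>: "\<alpha> < \<beta>" and c: "c > 0"
    and \<phi>1: "\<And>x. x \<in> {\<alpha>..\<beta>} \<Longrightarrow> (\<phi> has_real_derivative \<phi>1 x) (at x)"
    and \<phi>2: "\<And>x. x \<in> {\<alpha>..\<beta>} \<Longrightarrow> (\<phi>1 has_real_derivative \<phi>2 x) (at x)"
    and c_le: "\<And>x. x \<in> {\<alpha>..\<beta>} \<Longrightarrow> c \<le> \<bar>\<phi>2 x\<bar>" and C: "\<And>x. x \<in> {\<alpha>..\<beta>} \<Longrightarrow> \<bar>\<phi>2 x\<bar> \<le> C"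
    and \<Lambda>: "\<And>x y. x \<in> {\<alpha>..\<beta>} \<Longrightarrow> y \<in> {\<alpha>..\<beta>} \<Longrightarrow> \<bar>\<phi>2 x - \<phi>2 y\<bar> \<le> \<Lambda> * \<bar>x - y\<bar>"
begin

lemma \<phi>1_diff:
  assumes "x \<in> {\<alpha>..\<beta>}" "y \<in> {\<alpha>..\<beta>}"
  shows "c * \<bar>x - y\<bar> \<le> \<bar>\<phi>1 x - \<phi>1 y\<bar>" "\<bar>\<phi>1 x - \<phi>1 y\<bar> \<le> C * \<bar>x - y\<bar>"
proof -
  have *: "c * \<bar>x - y\<bar> \<le> \<bar>\<phi>1 x - \<phi>1 y\<bar> \<and> \<bar>\<phi>1 x - \<phi>1 y\<bar> \<le> C * \<bar>x - y\<bar>"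
    if "x \<in> {\<alpha>..\<beta>}" "y \<in> {\<alpha>..\<beta>}" "x < y" for x y
  proof -
    have "\<exists>z. x < z \<and> z < y \<and> \<phi>1 y - \<phi>1 x = (y - x) * \<phi>2 z"
      by (rule MVT2[OF that(3)]) (use \<phi>2 that in auto)
    then obtain z where z: "x < z" "z < y" "\<phi>1 y - \<phi>1 x = (y - x) * \<phi>2 z" by auto
    then have "\<bar>\<phi>1 x - \<phi>1 y\<bar> = \<bar>x - y\<bar> * \<bar>\<phi>2 z\<bar>" by (metis abs_minus_commute abs_mult)
    moreover have "z \<in> {\<alpha>..\<beta>}" using z that by auto
    ultimately show ?thesis using c_le[of z] C[of z] by (auto simp: mult.commute intro: mult_right_mono)
  qed
  consider "x < y" | "y < x" | "x = y" by linarith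
  then have "c * \<bar>x - y\<bar> \<le> \<bar>\<phi>1 x - \<phi>1 y\<bar> \<and> \<bar>\<phi>1 x - \<phi>1 y\<bar> \<le> C * \<bar>x - y\<bar>"
  proof cases
    case 2
    then show ?thesis using *[OF assms(2,1)] by (simp add: abs_minus_commute)
  qed (use *[OF assms] in auto)
  then show "c * \<bar>x - y\<bar> \<le> \<bar>\<phi>1 x - \<phi>1 y\<bar>" "\<bar>\<phi>1 x - \<phi>1 y\<bar> \<le> C * \<bar>x - y\<bar>" by auto
qed

lemma C_pos: "C > 0" using c c_le[of \<alpha>] C[of \<alpha>] \<alpha>\<beta> by auto

lemma \<Lambda>_nonneg: "\<Lambda> \<ge> 0"
  using \<Lambda>[of \<alpha> \<beta>] \<alpha>\<beta> by (smt (verit) atLeastAtMost_iff mult_neg_pos)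

abbreviation "I \<equiv> graph_points \<alpha> \<beta>"
abbreviation "r \<equiv> graph_floor \<phi>"

text \<open>Over pairs with horizontal difference \<open>d\<close> the vertical difference
  \<open>\<psi>\<close> has a derivative of size at least \<open>c * d0\<close>, so its values
  spread out and a vertical shift hardly changes the sum. Rounding the heights moves the argument of
  \<open>\<sigma>\<close> by at most 1, at cost \<open>K\<close> in each of the two terms.\<close>

lemma shifted_fibre_sum:
  fixes \<sigma> :: "int \<Rightarrow> real" and d :: int and n d0 \<epsilon> :: real
  assumes n: "n > 0" and \<sigma>: "\<And>z. \<bar>\<sigma> z\<bar> \<le> 1" and K: "K \<ge> 0"
    and lip: "\<And>z w. \<bar>\<sigma> z - \<sigma> w\<bar> \<le> K * \<bar>real_of_int z - real_of_int w\<bar>"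
    and d: "d0 * n \<le> \<bar>d\<bar>" and d0: "d0 > 0" and y: "0 \<le> y" "of_int y \<le> \<epsilon> * n"
  shows "\<bar>\<Sum>i\<in>{i \<in> I n. i + d \<in> I n}. \<sigma> (r n (i + d) - r n i + y) - \<sigma> (r n (i + d) - r n i)\<bar>
    \<le> 2 + 2 * \<epsilon> * n / (c * d0) + real (card (I n)) * (2 * K * (C * (\<beta> - \<alpha>)) + \<epsilon> * \<Lambda> / (c\<^sup>2 * d0) + 2 * K)"
    (is "\<bar>sum ?g ?J\<bar> \<le> ?R")
proof -
  have "0 \<le> real_of_int y" using y by simp
  also have "\<dots> \<le> \<epsilon> * n" by (rule y(2))
  finally have eps: "\<epsilon> \<ge> 0" using n by (simp add: zero_le_mult_iff)
  show ?thesis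
proof (cases "?J = {}")
  case True
  have "0 \<le> ?R" using eps c d0 n K C_pos \<alpha>\<beta> \<Lambda>_nonneg by (intro add_nonneg_nonneg mult_nonneg_nonneg divide_nonneg_nonneg) auto
  then show ?thesis by (simp only: True sum.empty abs_zero)
next
  case False
  define lo where "lo = max \<lceil>\<alpha> * n\<rceil> (\<lceil>\<alpha> * n\<rceil> - d)"
  define hi where "hi = min \<lfloor>\<beta> * n\<rfloor> (\<lfloor>\<beta> * n\<rfloor> - d)"
  have J: "?J = {lo..hi}" unfolding graph_points_eq lo_def hi_def by auto
  then have lohi: "lo \<le> hi" using False by auto
  define q where "q = nat (hi - lo)"
  have hi: "hi = lo + int q" using lohi by (simp add: q_def)
  obtain \<rho> where \<rho>: "\<And>z. \<bar>\<rho> z\<bar> \<le> 1" "\<And>z w. \<bar>\<rho> z - \<rho> w\<bar> \<le> K * \<bar>z - w\<bar>" "\<And>z. \<rho> (of_int z) = \<sigma> z"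
    using Lipschitz_extension_int[OF \<sigma> K lip] by metis
  define \<psi> where "\<psi> x = n * (\<phi> ((x + of_int d) / n) - \<phi> (x / n))" for x
  define \<psi>1 where "\<psi>1 x = \<phi>1 ((x + of_int d) / n) - \<phi>1 (x / n)" for x
  define \<psi>2 where "\<psi>2 x = (\<phi>2 ((x + of_int d) / n) - \<phi>2 (x / n)) / n" for x
  have dn: "\<bar>d\<bar> / n \<ge> d0" using d n by (simp add: field_simps)
  have dpos: "real_of_int \<bar>d\<bar> > 0" using mult_pos_pos[OF d0 n] d by linarith
  have mem: "x / n \<in> {\<alpha>..\<beta>} \<and> (x + of_int d) / n \<in> {\<alpha>..\<beta>}" if x: "x \<in> {of_int lo..of_int lo + real q}" for x
  proof -
    have "lo \<in> ?J" "hi \<in> ?J" using J lohi by auto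
    then have "\<alpha> * n \<le> lo" "\<alpha> * n \<le> lo + d" "hi \<le> \<beta> * n" "hi + d \<le> \<beta> * n" by (auto simp: graph_points_def)
    moreover have "of_int lo \<le> x" "x \<le> of_int hi" using x by (auto simp: hi)
    ultimately have "\<alpha> * n \<le> x" "\<alpha> * n \<le> x + d" "x \<le> \<beta> * n" "x + d \<le> \<beta> * n" by linarith+
    then show ?thesis using n by (auto simp: field_simps)
  qed
  have diff: "(x + of_int d) / n - x / n = of_int d / n" for x by (simp add: add_divide_distrib)
  have s: "\<bar>\<Sum>k<q. \<rho> (\<psi> (of_int lo + real k) + of_int y) - \<rho> (\<psi> (of_int lo + real k))\<bar>
     \<le> 2 * of_int y / (c * (\<bar>d\<bar> / n)) + real q * (2 * K * (C * (\<beta> - \<alpha>)) + of_int y * (\<Lambda> * (\<bar>d\<bar> / n) / n) / (c * (\<bar>d\<bar> / n))\<^sup>2)"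
  proof (rule shifted_sum_bound[where \<psi>' = \<psi>1 and \<psi>'' = \<psi>2])
    fix x assume "x \<in> {of_int lo..of_int lo + real q}"
    note m = mem[OF this]
    have A: "((\<lambda>x. (x + of_int d) / n) has_real_derivative 1 / n) (at x)"
      "((\<lambda>x. x / n) has_real_derivative 1 / n) (at x)"
      using n by (auto intro!: derivative_eq_intros)
    have "((\<lambda>x. n * (\<phi> ((x + of_int d) / n) - \<phi> (x / n))) has_real_derivative
      n * (\<phi>1 ((x + of_int d) / n) * (1 / n) - \<phi>1 (x / n) * (1 / n))) (at x)"
      using m n by (intro DERIV_cmult DERIV_diff DERIV_chain2[OF _ A(1)] DERIV_chain2[OF _ A(2)] \<phi>1) auto
    moreover have "n * (\<phi>1 ((x + of_int d) / n) * (1 / n) - \<phi>1 (x / n) * (1 / n)) = \<psi>1 x"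
      using n by (simp add: \<psi>1_def right_diff_distrib)
    ultimately show "(\<psi> has_real_derivative \<psi>1 x) (at x)" unfolding \<psi>_def[abs_def] by simp
    have "((\<lambda>x. \<phi>1 ((x + of_int d) / n) - \<phi>1 (x / n)) has_real_derivative
      \<phi>2 ((x + of_int d) / n) * (1 / n) - \<phi>2 (x / n) * (1 / n)) (at x)"
      using m n by (intro DERIV_diff DERIV_chain2[OF _ A(1)] DERIV_chain2[OF _ A(2)] \<phi>2) auto
    moreover have "\<phi>2 ((x + of_int d) / n) * (1 / n) - \<phi>2 (x / n) * (1 / n) = \<psi>2 x"
      by (simp add: \<psi>2_def diff_divide_distrib)
    ultimately show "(\<psi>1 has_real_derivative \<psi>2 x) (at x)" unfolding \<psi>1_def[abs_def] by simp
    have \<psi>1b: "c * (\<bar>d\<bar> / n) \<le> \<bar>\<psi>1 x\<bar>" "\<bar>\<psi>1 x\<bar> \<le> C * (\<bar>d\<bar> / n)"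
      using \<phi>1_diff[of "(x + of_int d) / n" "x / n"] m n by (simp_all add: \<psi>1_def diff abs_divide)
    show "c * (\<bar>d\<bar> / n) \<le> \<bar>\<psi>1 x\<bar>" by fact
    have "\<bar>(x + of_int d) / n - x / n\<bar> \<le> \<beta> - \<alpha>" using m by auto
    then have "\<bar>d\<bar> / n \<le> \<beta> - \<alpha>" using n by (simp add: diff abs_divide)
    then have "C * (\<bar>d\<bar> / n) \<le> C * (\<beta> - \<alpha>)" using C_pos by (intro mult_left_mono) auto
    then show "\<bar>\<psi>1 x\<bar> \<le> C * (\<beta> - \<alpha>)" using \<psi>1b by linarith
    show "\<bar>\<psi>2 x\<bar> \<le> \<Lambda> * (\<bar>d\<bar> / n) / n"
      using divide_right_mono[OF \<Lambda>[of "(x + of_int d) / n" "x / n"], of n] m n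
      by (simp add: \<psi>2_def diff abs_divide)
  qed (use \<rho> K y n c dpos in auto)
  have e1: "2 * of_int y / (c * (\<bar>d\<bar> / n)) \<le> 2 * \<epsilon> * n / (c * d0)"
    using y dn c d0 eps n by (intro frac_le mult_left_mono) auto
  have e2: "of_int y * (\<Lambda> * (\<bar>d\<bar> / n) / n) / (c * (\<bar>d\<bar> / n))\<^sup>2 \<le> \<epsilon> * \<Lambda> / (c\<^sup>2 * d0)"
  proof -
    have "of_int y * (\<Lambda> * (\<bar>d\<bar> / n) / n) / (c * (\<bar>d\<bar> / n))\<^sup>2 = (of_int y / n) * \<Lambda> / (c\<^sup>2 * (\<bar>d\<bar> / n))"
      using n dpos c by (simp add: field_simps power2_eq_square)
    also have "\<dots> \<le> \<epsilon> * \<Lambda> / (c\<^sup>2 * d0)"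
      using y dn c d0 n \<Lambda>_nonneg eps by (intro frac_le mult_right_mono mult_left_mono mult_nonneg_nonneg) (auto simp: divide_le_eq)
    finally show ?thesis .
  qed
  have near: "\<bar>\<sigma> (r n (i + d) - r n i + y') - \<rho> (\<psi> (of_int i) + of_int y')\<bar> \<le> K" for i y'
  proof -
    have "\<bar>real_of_int (r n (i + d) - r n i) - \<psi> (of_int i)\<bar> \<le> 1"
      unfolding graph_floor_def \<psi>_def using n by (simp add: right_diff_distrib) linarith
    then have "K * \<bar>real_of_int (r n (i + d) - r n i + y') - (\<psi> (of_int i) + of_int y')\<bar> \<le> K * 1"
      using K by (intro mult_left_mono) auto
    then show ?thesis using \<rho>(2)[of "of_int (r n (i + d) - r n i + y')" "\<psi> (of_int i) + of_int y'", unfolded \<rho>(3)]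
      by linarith
  qed
  let ?h = "\<lambda>i. \<rho> (\<psi> (of_int i) + of_int y) - \<rho> (\<psi> (of_int i))"
  have gh: "\<bar>?g i - ?h i\<bar> \<le> 2 * K" for i using near[of i y] near[of i 0] by simp
  \<comment> \<open>The last point is split off, since the estimate covers the left endpoints of
    \<open>q\<close> unit intervals; it accounts for the constant 2.\<close>
  have J': "?J = insert hi {lo..<hi}" unfolding J using lohi by (simp add: atLeastLessThan_eq_atLeastAtMost_diff insert_absorb)
  have "(\<Sum>i\<in>{lo..<hi}. ?h i) = (\<Sum>k<q. ?h (lo + int k))"
    by (rule sum.reindex_bij_witness[where i = "\<lambda>k. lo + int k" and j = "\<lambda>i. nat (i - lo)"]) (auto simp: hi)
  also have "\<dots> = (\<Sum>k<q. \<rho> (\<psi> (of_int lo + real k) + of_int y) - \<rho> (\<psi> (of_int lo + real k)))" by simp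
  finally have h1: "\<bar>\<Sum>i\<in>{lo..<hi}. ?h i\<bar> \<le> 2 * \<epsilon> * n / (c * d0) + real q * (2 * K * (C * (\<beta> - \<alpha>)) + \<epsilon> * \<Lambda> / (c\<^sup>2 * d0))"
    using s e1 mult_left_mono[OF e2, of "real q"] by (simp add: algebra_simps)
  have "\<bar>sum ?g {lo..<hi} - sum ?h {lo..<hi}\<bar> \<le> (\<Sum>i\<in>{lo..<hi}. \<bar>?g i - ?h i\<bar>)"
    unfolding sum_subtractf[symmetric] by (rule sum_abs)
  also have "\<dots> \<le> real (card {lo..<hi}) * (2 * K)" by (rule sum_bounded_above) (rule gh)
  finally have h2: "\<bar>sum ?g {lo..<hi} - sum ?h {lo..<hi}\<bar> \<le> real q * (2 * K)" by (simp add: q_def)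
  have "sum ?g ?J = ?g hi + sum ?g {lo..<hi}" unfolding J' by simp
  moreover have "\<bar>?g hi\<bar> \<le> 2" using \<sigma>[of "r n (hi + d) - r n hi + y"] \<sigma>[of "r n (hi + d) - r n hi"] by linarith
  ultimately have "\<bar>sum ?g ?J\<bar> \<le> 2 + 2 * \<epsilon> * n / (c * d0) + real q * (2 * K * (C * (\<beta> - \<alpha>)) + \<epsilon> * \<Lambda> / (c\<^sup>2 * d0) + 2 * K)"
    using h1 h2 by (simp add: algebra_simps)
  also have "\<dots> \<le> ?R"
  proof -
    have "{lo..<hi} \<subseteq> I n" using J' by blast
    then have "card {lo..<hi} \<le> card (I n)" by (intro card_mono) auto
    then have "real q \<le> card (I n)" by (simp add: q_def)
    then show ?thesis using K C_pos \<alpha>\<beta> eps \<Lambda>_nonneg c d0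
      by (intro add_left_mono mult_right_mono add_nonneg_nonneg mult_nonneg_nonneg divide_nonneg_nonneg) auto
  qed
  finally show ?thesis .
qed
qed

text \<open>Pairs are grouped by \<open>d = i - j\<close>. The few fibres with
  \<open>\<bar>d\<bar> < d0 * n\<close> are bounded trivially, the others by the curvature estimate.
  The range \<open>?D\<close> of \<open>d\<close> has \<open>2 * card (I n) + 1\<close> elements, at
  most \<open>3 * card (I n)\<close>.\<close>

lemma pair_shift_bound:
  fixes \<sigma> :: "int \<Rightarrow> int \<Rightarrow> real" and n d0 \<epsilon> K :: real
  assumes n: "n > 0" and q: "card (I n) > 0" and \<sigma>: "\<And>d z. \<bar>\<sigma> d z\<bar> \<le> 1" and K: "K \<ge> 0"
    and lip: "\<And>d z w. \<bar>\<sigma> d z - \<sigma> d w\<bar> \<le> K * \<bar>real_of_int z - real_of_int w\<bar>"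
    and d0: "d0 > 0" and y: "0 \<le> y" "of_int y \<le> \<epsilon> * n"
  shows "\<bar>avg (I n) (\<lambda>i. avg (I n) (\<lambda>j. \<sigma> (i - j) (r n i - r n j + y)))
      - avg (I n) (\<lambda>i. avg (I n) (\<lambda>j. \<sigma> (i - j) (r n i - r n j)))\<bar>
    \<le> (3 * (2 + 2 * \<epsilon> * n / (c * d0) + real (card (I n)) * (2 * K * (C * (\<beta> - \<alpha>)) + \<epsilon> * \<Lambda> / (c\<^sup>2 * d0) + 2 * K))
       + (4 * d0 * n + 2)) / card (I n)"
proof -
  let ?q = "card (I n)"
  let ?B = "2 + 2 * \<epsilon> * n / (c * d0) + real ?q * (2 * K * (C * (\<beta> - \<alpha>)) + \<epsilon> * \<Lambda> / (c\<^sup>2 * d0) + 2 * K)"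
  let ?h = "\<lambda>d j. \<sigma> d (r n (j + d) - r n j + y) - \<sigma> d (r n (j + d) - r n j)"
  let ?J = "\<lambda>d. {j \<in> I n. j + d \<in> I n}"
  let ?D = "{- int ?q..int ?q}"
  have "0 \<le> real_of_int y" using y by simp
  also have "\<dots> \<le> \<epsilon> * n" by (rule y(2))
  finally have eps: "\<epsilon> \<ge> 0" using n by (simp add: zero_le_mult_iff)
  have B0: "0 \<le> ?B" using c d0 n K C_pos \<alpha>\<beta> \<Lambda>_nonneg eps
    by (intro add_nonneg_nonneg mult_nonneg_nonneg divide_nonneg_nonneg) auto
  have "(\<Sum>i\<in>I n. \<Sum>j\<in>I n. ?h (i - j) j) = (\<Sum>(i,j)\<in>I n \<times> I n. ?h (i - j) j)"
    by (simp add: sum.cartesian_product)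
  also have "\<dots> = (\<Sum>(d,j)\<in>Sigma ?D ?J. ?h d j)"
  proof (rule sum.reindex_bij_witness[where i = "\<lambda>(d,j). (j + d, j)" and j = "\<lambda>(i,j). (i - j, j)"])
    fix a assume a: "a \<in> I n \<times> I n"
    then obtain i j where ij: "a = (i, j)" "i \<in> I n" "j \<in> I n" by auto
    then have "\<bar>i - j\<bar> \<le> int ?q" unfolding graph_points_eq by auto
    then show "(case a of (i, j) \<Rightarrow> (i - j, j)) \<in> Sigma ?D ?J" using ij by auto
  qed auto
  also have "\<dots> = (\<Sum>d\<in>?D. \<Sum>j\<in>?J d. ?h d j)" by (subst sum.Sigma) auto
  finally have "\<bar>\<Sum>i\<in>I n. \<Sum>j\<in>I n. ?h (i - j) j\<bar> \<le> (\<Sum>d\<in>?D. \<bar>\<Sum>j\<in>?J d. ?h d j\<bar>)"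
    by (simp only: sum_abs)
  also have "\<dots> \<le> (\<Sum>d\<in>?D. ?B + (if \<bar>real_of_int d\<bar> < d0 * n then 2 * real ?q else 0))"
  proof (rule sum_mono)
    fix d
    show "\<bar>\<Sum>j\<in>?J d. ?h d j\<bar> \<le> ?B + (if \<bar>real_of_int d\<bar> < d0 * n then 2 * real ?q else 0)"
    proof (cases "\<bar>real_of_int d\<bar> < d0 * n")
      case True
      have h2: "\<bar>?h d j\<bar> \<le> 2" for j
        using \<sigma>[of d "r n (j + d) - r n j + y"] \<sigma>[of d "r n (j + d) - r n j"] by linarith
      have "\<bar>\<Sum>j\<in>?J d. ?h d j\<bar> \<le> (\<Sum>j\<in>?J d. \<bar>?h d j\<bar>)" by (rule sum_abs)
      also have "\<dots> \<le> real (card (?J d)) * 2" by (rule sum_bounded_above) (rule h2)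
      also have "\<dots> \<le> real ?q * 2" by (intro mult_right_mono of_nat_mono card_mono) auto
      finally show ?thesis using True B0 by simp
    next
      case False
      then have "d0 * n \<le> \<bar>d\<bar>" by simp
      from shifted_fibre_sum[OF n \<sigma> K lip this d0 y] show ?thesis using False by simp
    qed
  qed
  also have "\<dots> \<le> real (card ?D) * ?B + real (card {- \<lfloor>d0 * n\<rfloor>..\<lfloor>d0 * n\<rfloor>}) * (2 * real ?q)"
  proof -
    have "(\<Sum>d\<in>?D. if \<bar>real_of_int d\<bar> < d0 * n then 2 * real ?q else 0)
      = (\<Sum>d\<in>{d \<in> ?D. \<bar>real_of_int d\<bar> < d0 * n}. 2 * real ?q)"
      by (rule sum.inter_filter[symmetric]) simp
    also have "\<dots> \<le> (\<Sum>d\<in>{- \<lfloor>d0 * n\<rfloor>..\<lfloor>d0 * n\<rfloor>}. 2 * real ?q)"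
      by (rule sum_mono2) (auto simp: abs_less_iff, linarith+)
    finally have "(\<Sum>d\<in>?D. if \<bar>real_of_int d\<bar> < d0 * n then 2 * real ?q else 0)
      \<le> real (card {- \<lfloor>d0 * n\<rfloor>..\<lfloor>d0 * n\<rfloor>}) * (2 * real ?q)" by (simp only: sum_constant)
    moreover have "(\<Sum>d\<in>?D. ?B + (if \<bar>real_of_int d\<bar> < d0 * n then 2 * real ?q else 0))
      = real (card ?D) * ?B + (\<Sum>d\<in>?D. if \<bar>real_of_int d\<bar> < d0 * n then 2 * real ?q else 0)"
      unfolding sum.distrib[of "\<lambda>_. ?B"] by (simp only: sum_constant)
    ultimately show ?thesis by linarith
  qed
  also have "\<dots> \<le> (3 * real ?q) * ?B + (2 * d0 * n + 1) * (2 * real ?q)"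
  proof (intro add_mono mult_right_mono B0)
    show "real (card ?D) \<le> 3 * real ?q" using q by simp
    have "0 \<le> \<lfloor>d0 * n\<rfloor>" using d0 n by simp
    then show "real (card {- \<lfloor>d0 * n\<rfloor>..\<lfloor>d0 * n\<rfloor>}) \<le> 2 * d0 * n + 1" by simp
  qed simp
  also have "\<dots> = (3 * ?B + (4 * d0 * n + 2)) * real ?q" by (simp add: algebra_simps)
  finally have *: "\<bar>\<Sum>i\<in>I n. \<Sum>j\<in>I n. ?h (i - j) j\<bar> \<le> (3 * ?B + (4 * d0 * n + 2)) * real ?q" .
  have "avg (I n) (\<lambda>i. avg (I n) (\<lambda>j. \<sigma> (i - j) (r n i - r n j + y)))
      - avg (I n) (\<lambda>i. avg (I n) (\<lambda>j. \<sigma> (i - j) (r n i - r n j)))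
    = (\<Sum>i\<in>I n. \<Sum>j\<in>I n. ?h (i - j) j) / (real ?q * real ?q)"
    by (simp add: avg_def sum_divide_distrib[symmetric] diff_divide_distrib[symmetric] sum_subtractf)
  moreover have "\<bar>s / (q * q)\<bar> \<le> X / q" if "\<bar>s\<bar> \<le> X * q" "q > 0" for s q X :: real
    using that by (simp add: abs_divide divide_le_eq)
  ultimately show ?thesis using * q by (simp only: of_nat_0_less_iff)
qed

text \<open>There are four error terms, from pairs close to the diagonal, from the shift, from the
  Lipschitz constant and from counting, and each is made at most \<open>e / 4\<close>. The choice of
  \<open>d0\<close> precedes that of \<open>\<epsilon>\<close>, because the curvature terms divide
  by \<open>d0\<close>.\<close>

lemma pair_shift_small:
  assumes e: "e > 0"
  obtains \<epsilon> K n0 where "\<epsilon> > 0" "K > 0" "n0 > 0"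
    "\<And>n (\<sigma> :: int \<Rightarrow> int \<Rightarrow> real) (y :: int). n \<ge> n0 \<Longrightarrow> (\<And>d z. \<bar>\<sigma> d z\<bar> \<le> 1) \<Longrightarrow>
      (\<And>d z w. \<bar>\<sigma> d z - \<sigma> d w\<bar> \<le> K * \<bar>real_of_int z - real_of_int w\<bar>) \<Longrightarrow>
      0 \<le> y \<Longrightarrow> of_int y \<le> \<epsilon> * n \<Longrightarrow>
      \<bar>avg (I n) (\<lambda>i. avg (I n) (\<lambda>j. \<sigma> (i - j) (r n i - r n j + y)))
        - avg (I n) (\<lambda>i. avg (I n) (\<lambda>j. \<sigma> (i - j) (r n i - r n j)))\<bar> \<le> e"
proof -
  \<comment> \<open>\<open>w\<close> bounds \<open>n / card (I n)\<close> as soon as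
    \<open>n \<ge> w\<close>: the factor 2 absorbs the point that may be missing in the count of
    columns.\<close>
  define w where "w = 2 / (\<beta> - \<alpha>)"
  have w: "w > 0" using \<alpha>\<beta> by (simp add: w_def)
  define d0 where "d0 = e / (16 * w)"
  have d0: "d0 > 0" using e w by (simp add: d0_def)
  define Z where "Z = 6 * w / (c * d0) + 3 * \<Lambda> / (c\<^sup>2 * d0)"
  have Z: "Z \<ge> 0" using w c d0 \<Lambda>_nonneg by (simp add: Z_def)
  define \<epsilon> where "\<epsilon> = e / (4 * (Z + 1))"
  define V where "V = C * (\<beta> - \<alpha>) + 1"
  have V: "V > 0" using C_pos \<alpha>\<beta> by (simp add: V_def add_pos_pos)
  define K where "K = e / (24 * V)"
  define n0 where "n0 = max w (32 * w / e)"
  show ?thesis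
  proof (rule that)
    show "\<epsilon> > 0" "K > 0" "n0 > 0" using e Z V w by (auto simp: \<epsilon>_def K_def n0_def)
    fix n and \<sigma> :: "int \<Rightarrow> int \<Rightarrow> real" and y :: int assume n: "n \<ge> n0" and \<sigma>: "\<And>d z. \<bar>\<sigma> d z\<bar> \<le> (1::real)"
      and lip: "\<And>d z w. \<bar>\<sigma> d z - \<sigma> d w\<bar> \<le> K * \<bar>real_of_int z - real_of_int w\<bar>"
      and y: "0 \<le> y" "of_int y \<le> \<epsilon> * n"
    have n1: "n \<ge> w" "n \<ge> 32 * w / e" using n by (auto simp: n0_def)
    then have n_pos: "n > 0" using w by linarith
    let ?q = "real (card (I n))"
    have "n / w \<ge> 1" using n1 w by simp
    moreover have "n / w = (\<beta> - \<alpha>) * n / 2" using \<alpha>\<beta> by (simp add: w_def)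
    ultimately have q: "n / w \<le> ?q" using card_graph_points[of \<beta> \<alpha> n] by linarith
    then have qp: "?q > 0" using \<open>n / w \<ge> 1\<close> by linarith
    have nq: "n / ?q \<le> w" using q w qp by (simp add: field_simps)
    have iq: "1 / ?q \<le> e / 32"
    proof -
      have "1 / ?q \<le> w / n" using q w qp n_pos by (simp add: field_simps)
      also have "\<dots> \<le> e / 32" using n1 e n_pos by (simp add: field_simps)
      finally show ?thesis .
    qed
    have "\<bar>avg (I n) (\<lambda>i. avg (I n) (\<lambda>j. \<sigma> (i - j) (r n i - r n j + y)))
        - avg (I n) (\<lambda>i. avg (I n) (\<lambda>j. \<sigma> (i - j) (r n i - r n j)))\<bar> \<le>
     (3 * (2 + 2 * \<epsilon> * n / (c * d0) + ?q * (2 * K * (C * (\<beta> - \<alpha>)) + \<epsilon> * \<Lambda> / (c\<^sup>2 * d0) + 2 * K))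
       + (4 * d0 * n + 2)) / ?q"
      by (rule pair_shift_bound) (use n_pos qp \<sigma> lip d0 y \<open>K > 0\<close> in auto)
    also have "\<dots> = 8 * (1 / ?q) + (n / ?q) * (6 * \<epsilon> / (c * d0) + 4 * d0) + 3 * \<epsilon> * \<Lambda> / (c\<^sup>2 * d0) + 6 * K * V"
    proof -
      have alg: "(3 * (2 + P * n + q * S) + (4 * d0 * n + 2)) / q = 8 * (1 / q) + (n / q) * (3 * P + 4 * d0) + 3 * S"
        if "q > 0" for P q S :: real using that by (simp add: field_simps)
      show ?thesis
        using alg[OF qp, of "2 * \<epsilon> / (c * d0)" "2 * K * (C * (\<beta> - \<alpha>)) + \<epsilon> * \<Lambda> / (c\<^sup>2 * d0) + 2 * K"]
        by (simp add: V_def algebra_simps)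
    qed
    also have "\<dots> \<le> 8 * (e / 32) + w * (6 * \<epsilon> / (c * d0) + 4 * d0) + 3 * \<epsilon> * \<Lambda> / (c\<^sup>2 * d0) + 6 * K * V"
      using iq nq \<open>\<epsilon> > 0\<close> c d0 by (intro add_mono mult_right_mono mult_left_mono order_refl) auto
    also have "\<dots> = e / 4 + \<epsilon> * Z + 4 * d0 * w + 6 * K * V"
      by (simp add: Z_def algebra_simps)
    also have "4 * d0 * w = e / 4" using w by (simp add: d0_def)
    also have "6 * K * V = e / 4" using V by (simp add: K_def)
    also have "\<epsilon> * Z \<le> \<epsilon> * (Z + 1)" using \<open>\<epsilon> > 0\<close> by simp
    also have "\<epsilon> * (Z + 1) = e / 4" using Z unfolding \<epsilon>_def by (simp add: field_simps add_nonneg_eq_0_iff)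
    finally show "\<bar>avg (I n) (\<lambda>i. avg (I n) (\<lambda>j. \<sigma> (i - j) (r n i - r n j + y)))
        - avg (I n) (\<lambda>i. avg (I n) (\<lambda>j. \<sigma> (i - j) (r n i - r n j)))\<bar> \<le> e" by simp
  qed
qed

end

section \<open>Averages over strips along a graph\<close>

definition strip :: "int set \<Rightarrow> (int \<Rightarrow> int) \<Rightarrow> nat \<Rightarrow> (int \<times> int) set"
  where "strip I r m = (SIGMA i:I. {r i..<r i + int m})"

lemma finite_strip: "finite I \<Longrightarrow> finite (strip I r m)" by (simp add: strip_def)
lemma card_strip: "finite I \<Longrightarrow> card (strip I r m) = card I * m" by (simp add: strip_def)

lemma avg_strip:
  assumes "finite I"
  shows "avg (strip I r m) g = avg I (\<lambda>i. avg {0..<int m} (\<lambda>y. g (i, r i + y)))"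
proof -
  have "(\<Sum>v\<in>strip I r m. g v) = (\<Sum>i\<in>I. \<Sum>y\<in>{r i..<r i + int m}. g (i, y))"
    unfolding strip_def using assms by (subst sum.Sigma) auto
  also have "\<dots> = (\<Sum>i\<in>I. \<Sum>y\<in>{0..<int m}. g (i, r i + y))"
  proof (rule sum.cong[OF refl])
    fix i
    show "(\<Sum>y\<in>{r i..<r i + int m}. g (i, y)) = (\<Sum>y\<in>{0..<int m}. g (i, r i + y))"
      by (rule sum.reindex_bij_witness[where i = "\<lambda>y. r i + y" and j = "\<lambda>y. y - r i"]) auto
  qed
  finally show ?thesis using assms
    by (simp add: avg_def card_strip sum_divide_distrib[symmetric] mult.commute)
qed

text \<open>A point of the strip outside its translate by \<open>p = (a, b)\<close> either lies in
  one of the first \<open>a\<close> columns, or belongs to a column \<open>i\<close> whose fibre and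
  the translated fibre from \<open>i - a\<close> are offset by at most
  \<open>L * l + 1 + l\<close>.\<close>

lemma strip_sym_diff:
  fixes r :: "int \<Rightarrow> int"
  assumes r: "\<And>i j. i \<in> {lo..hi} \<Longrightarrow> j \<in> {lo..hi} \<Longrightarrow> real_of_int \<bar>r i - r j\<bar> \<le> L * real_of_int \<bar>i - j\<bar> + 1"
    and L: "L \<ge> 0" and p: "p \<in> Box l"
  shows "real (sym_diff_card (strip {lo..hi} r m) p)
    \<le> real l * real m + real (card {lo..hi}) * (L * l + 1 + l)"
proof -
  obtain a b where ab: "p = (a, b)" "0 \<le> a" "a < int l" "0 \<le> b" "b < int l" using p by (auto simp: Box_def)
  let ?I = "{lo..hi}" and ?R = "\<lambda>i. {r i..<r i + int m}"
  let ?P = "Sigma {lo..<lo + a} ?R"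
  let ?K = "\<lambda>i. if i - a \<in> ?I then ?R i - {r (i - a) + b..<r (i - a) + b + int m} else {}"
  have sub: "strip ?I r m - (+) p ` strip ?I r m \<subseteq> ?P \<union> Sigma ?I ?K"
  proof
    fix v assume v: "v \<in> strip ?I r m - (+) p ` strip ?I r m"
    obtain i y where iy: "v = (i, y)" by (cases v)
    have m: "i \<in> ?I" "y \<in> ?R i" using v iy by (auto simp: strip_def)
    have "v = p + (i - a, y - b)" using iy ab by simp
    then have "(i - a, y - b) \<notin> strip ?I r m" using v by blast
    then show "v \<in> ?P \<union> Sigma ?I ?K" using m iy ab by (auto simp: strip_def)
  qed
  have k: "real (card (?K i)) \<le> L * l + 1 + l" if i: "i \<in> ?I" for i
  proof (cases "i - a \<in> ?I")
    case True
    let ?s = "r (i - a) + b - r i"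
    have "?K i \<subseteq> (if ?s \<ge> 0 then {r i..<r i + ?s} else {r i + ?s + int m..<r i + int m})" using True by auto
    then have "card (?K i) \<le> card (if ?s \<ge> 0 then {r i..<r i + ?s} else {r i + ?s + int m..<r i + int m})"
      by (intro card_mono) auto
    also have "\<dots> = nat \<bar>?s\<bar>" by simp
    finally have "real (card (?K i)) \<le> real_of_int \<bar>?s\<bar>" by linarith
    also have "\<dots> \<le> real_of_int \<bar>r (i - a) - r i\<bar> + b" using ab by simp
    also have "\<dots> \<le> (L * real_of_int \<bar>i - a - i\<bar> + 1) + l"
      using r[OF True i] ab by linarith
    also have "L * real_of_int \<bar>i - a - i\<bar> \<le> L * l" using L ab by (intro mult_left_mono) auto
    finally show ?thesis by simp
  next
    case False
    then have "?K i = {}" by (simp only: if_False)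
    then show ?thesis using L by (simp only: card.empty) simp
  qed
  have "sym_diff_card (strip ?I r m) p \<le> card (?P \<union> Sigma ?I ?K)"
    unfolding sym_diff_card_def by (rule card_mono[OF _ sub]) auto
  also have "\<dots> \<le> card ?P + card (Sigma ?I ?K)" by (rule card_Un_le)
  finally have "real (sym_diff_card (strip ?I r m) p) \<le> real (card ?P) + real (card (Sigma ?I ?K))" by linarith
  also have "real (card ?P) \<le> real l * real m" using ab by (auto intro!: mult_right_mono)
  also have "real (card (Sigma ?I ?K)) = (\<Sum>i\<in>?I. real (card (?K i)))"
    by (subst card_SigmaI) auto
  also have "\<dots> \<le> (\<Sum>i\<in>?I. L * l + 1 + l)" by (rule sum_mono) (rule k)
  finally show ?thesis by simp
qed

text \<open>A unit step exchanges one term of the window sum for another, and each has absolute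
  value at most 1.\<close>

lemma window_avg_Lipschitz:
  fixes k :: "int \<Rightarrow> real"
  assumes k: "\<And>z. \<bar>k z\<bar> \<le> 1" and M: "M > 0"
  shows "\<bar>avg {0..<int M} (\<lambda>y. k (z - y)) - avg {0..<int M} (\<lambda>y. k (w - y))\<bar>
    \<le> 2 / M * \<bar>real_of_int z - real_of_int w\<bar>"
proof -
  define f where "f z = (\<Sum>y\<in>{0..<int M}. k (z - y))" for z
  have f: "f z = (\<Sum>j<M. k (z - int j))" for z unfolding f_def
    by (rule sum.reindex_bij_witness[where i = int and j = nat]) auto
  have "f (z + 1) - f z = k (z + 1) - k (z + 1 - int M)" for z
    using sum_lessThan_telescope'[of "\<lambda>j. k (z + 1 - int j)" M]
    by (simp add: f sum_subtractf algebra_simps)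
  then have one: "\<bar>f (z + 1) - f z\<bar> \<le> 2" for z using k[of "z + 1"] k[of "z + 1 - int M"] by (smt (verit))
  have many: "\<bar>f (z + int j) - f z\<bar> \<le> 2 * real j" for z j
  proof (induction j)
    case (Suc j)
    have "\<bar>f (z + int (Suc j)) - f (z + int j)\<bar> \<le> 2" using one[of "z + int j"] by (simp add: add.commute add.left_commute)
    then show ?case using Suc.IH by (simp add: distrib_left)
  qed simp
  have "\<bar>f z - f w\<bar> \<le> 2 * \<bar>real_of_int z - real_of_int w\<bar>"
  proof (cases "z \<le> w")
    case True
    then show ?thesis using many[of z "nat (w - z)"] by simp
  next
    case False
    then show ?thesis using many[of w "nat (z - w)"] by simp
  qed
  then have "\<bar>f z - f w\<bar> / M \<le> 2 * \<bar>real_of_int z - real_of_int w\<bar> / M"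
    by (rule divide_right_mono) simp
  then show ?thesis
    unfolding avg_def f_def[symmetric] diff_divide_distrib[symmetric] abs_divide by simp
qed

context shift_system begin

text \<open>By invariance only differences of points matter. The offset \<open>y\<close> in the
  first strip is pulled out and acts as a common vertical shift of all pairs of columns, while the
  offset \<open>z\<close> in the second smooths the correlation function.\<close>

lemma E_strip_corr:
  assumes "finite I"
  shows "E (\<lambda>x. avg (strip I r m) (\<lambda>v. G (T v x)) * avg (strip I r M) (\<lambda>v. G (T v x)))
    = avg {0..<int m} (\<lambda>y. avg I (\<lambda>i. avg I (\<lambda>j. avg {0..<int M} (\<lambda>z.
        E (\<lambda>x. G (T (i - j, r i - r j + y - z) x) * G x)))))"
proof -
  have "E (\<lambda>x. avg (strip I r m) (\<lambda>v. G (T v x)) * avg (strip I r M) (\<lambda>v. G (T v x)))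
    = E (\<lambda>x. avg (strip I r m) (\<lambda>v. avg (strip I r M) (\<lambda>w. G (T v x) * G (T w x))))"
    by (simp only: avg_mult_avg)
  also have "\<dots> = avg (strip I r m) (\<lambda>v. E (\<lambda>x. avg (strip I r M) (\<lambda>w. G (T v x) * G (T w x))))"
    by (rule avg_swap)
  also have "\<dots> = avg (strip I r m) (\<lambda>v. avg (strip I r M) (\<lambda>w. E (\<lambda>x. G (T v x) * G (T w x))))"
    by (rule avg_cong) (rule avg_swap)
  also have "\<dots> = avg (strip I r m) (\<lambda>v. avg (strip I r M) (\<lambda>w. E (\<lambda>x. G (T (v - w) x) * G x)))"
  proof (rule avg_cong, rule avg_cong)
    fix v w
    show "E (\<lambda>x. G (T v x) * G (T w x)) = E (\<lambda>x. G (T (v - w) x) * G x)"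
      using E_shift[of "\<lambda>x. G (T (v - w) x) * G x" w] by simp
  qed
  also have "\<dots> = avg I (\<lambda>i. avg {0..<int m} (\<lambda>y. avg I (\<lambda>j. avg {0..<int M} (\<lambda>z.
        E (\<lambda>x. G (T (i - j, r i - r j + y - z) x) * G x)))))"
    unfolding avg_strip[OF assms] by (simp add: algebra_simps)
  also have "\<dots> = avg {0..<int m} (\<lambda>y. avg I (\<lambda>i. avg I (\<lambda>j. avg {0..<int M} (\<lambda>z.
        E (\<lambda>x. G (T (i - j, r i - r j + y - z) x) * G x)))))"
    by (rule avg_swap)
  finally show ?thesis .
qed

text \<open>Expanding the square leaves averages of the correlation function of \<open>G\<close> over pairs of strips.
  The average over the thinner strip makes that function Lipschitz in the vertical variable.\<close>

lemma strip_pair_bound: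
  assumes I: "finite I" and m: "m > 0" "m \<le> M" and G: "\<And>x. \<bar>G x\<bar> \<le> 1" and e: "e \<ge> 0"
    and pair: "\<And>(\<sigma> :: int \<Rightarrow> int \<Rightarrow> real) y. (\<And>d z. \<bar>\<sigma> d z\<bar> \<le> 1) \<Longrightarrow>
      (\<And>d z w. \<bar>\<sigma> d z - \<sigma> d w\<bar> \<le> 2 / m * \<bar>real_of_int z - real_of_int w\<bar>) \<Longrightarrow>
      0 \<le> y \<Longrightarrow> y < int M \<Longrightarrow>
      \<bar>avg I (\<lambda>i. avg I (\<lambda>j. \<sigma> (i - j) (r i - r j + y))) - avg I (\<lambda>i. avg I (\<lambda>j. \<sigma> (i - j) (r i - r j)))\<bar> \<le> e"
  shows "E (\<lambda>x. (avg (strip I r m) (\<lambda>v. G (T v x)) - avg (strip I r M) (\<lambda>v. G (T v x)))\<^sup>2) \<le> 4 * e"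
proof -
  define \<rho> where "\<rho> d z = E (\<lambda>x. G (T (d, z) x) * G x)" for d z
  define \<sigma> where "\<sigma> k d z = avg {0..<int k} (\<lambda>y. \<rho> d (z - y))" for k :: nat and d z
  define W where "W k y = avg I (\<lambda>i. avg I (\<lambda>j. \<sigma> k (i - j) (r i - r j + y)))" for k :: nat and y
  define \<Theta> where "\<Theta> k k' = E (\<lambda>x. avg (strip I r k) (\<lambda>v. G (T v x)) * avg (strip I r k') (\<lambda>v. G (T v x)))" for k k' :: nat
  have \<rho>1: "\<bar>\<rho> d z\<bar> \<le> 1" for d z unfolding \<rho>_def by (intro abs_avg_le_const abs_prod_le_one G) auto
  have \<Theta>: "\<Theta> k k' = avg {0..<int k} (W k')" for k k'
    unfolding \<Theta>_def E_strip_corr[OF I] W_def \<sigma>_def \<rho>_def ..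
  have sym: "\<Theta> k k' = \<Theta> k' k" for k k' unfolding \<Theta>_def by (simp add: mult.commute)
  have W: "\<bar>W k y - W k 0\<bar> \<le> e" if k: "m \<le> k" and y: "y \<in> {0..<int M}" for k y
  proof -
    have "\<bar>avg I (\<lambda>i. avg I (\<lambda>j. \<sigma> k (i - j) (r i - r j + y))) - avg I (\<lambda>i. avg I (\<lambda>j. \<sigma> k (i - j) (r i - r j)))\<bar> \<le> e"
    proof (rule pair)
      show "\<bar>\<sigma> k d z\<bar> \<le> 1" for d z unfolding \<sigma>_def by (intro abs_avg_le_const \<rho>1) auto
      fix d z w
      have "\<bar>\<sigma> k d z - \<sigma> k d w\<bar> \<le> 2 / k * \<bar>real_of_int z - real_of_int w\<bar>"
        unfolding \<sigma>_def by (rule window_avg_Lipschitz) (use \<rho>1 m k in auto)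
      also have "\<dots> \<le> 2 / m * \<bar>real_of_int z - real_of_int w\<bar>"
        using m k by (intro mult_right_mono divide_left_mono) auto
      finally show "\<bar>\<sigma> k d z - \<sigma> k d w\<bar> \<le> 2 / m * \<bar>real_of_int z - real_of_int w\<bar>" .
    qed (use y in auto)
    then show ?thesis by (simp add: W_def)
  qed
  have near: "\<bar>\<Theta> k k' - W k' 0\<bar> \<le> e" if k: "0 < k" "k \<le> M" "m \<le> k'" for k k'
  proof -
    have "W k' 0 = avg {0..<int k} (\<lambda>_. W k' 0)" using k by (simp add: avg_const)
    then have "\<bar>\<Theta> k k' - W k' 0\<bar> \<le> avg {0..<int k} (\<lambda>y. \<bar>W k' y - W k' 0\<bar>)"
      unfolding \<Theta> using abs_avg_diff_le[of "{0..<int k}" "W k'" "\<lambda>_. W k' 0"] by linarith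
    also have "\<dots> \<le> e" by (rule avg_le_const[OF W e]) (use k in auto)
    finally show ?thesis .
  qed
  have "E (\<lambda>x. (avg (strip I r m) (\<lambda>v. G (T v x)) - avg (strip I r M) (\<lambda>v. G (T v x)))\<^sup>2)
    = \<Theta> m m - \<Theta> m M - \<Theta> M m + \<Theta> M M"
    unfolding \<Theta>_def power2_eq_square
    by (simp only: left_diff_distrib right_diff_distrib avg_diff)
  \<comment> \<open>\<open>\<Theta> m m\<close> and \<open>\<Theta> M m\<close> are both within
    \<open>e\<close> of \<open>W m 0\<close>, and \<open>\<Theta> m M\<close> and
    \<open>\<Theta> M M\<close> within \<open>e\<close> of \<open>W M 0\<close>; with their signs
    the main terms cancel.\<close>
  also have "\<dots> \<le> 4 * e"
    using near[of m m] near[of M m] near[of m M] near[of M M] m sym[of m M] by (simp add: abs_le_iff)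
  finally show ?thesis .
qed

text \<open>The second moment is at most \<open>e\<^sup>2\<close>, and \<open>\<theta> = e\<close>
  balances the two terms of the weighted inequality; hence the quadratic precision asked of
  \<open>pair\<close>.\<close>

lemma strip_L1_bound:
  assumes I: "finite I" and m: "m > 0" "m \<le> M" and G: "\<And>x. \<bar>G x\<bar> \<le> 1" and e: "e > 0"
    and pair: "\<And>(\<sigma> :: int \<Rightarrow> int \<Rightarrow> real) y. (\<And>d z. \<bar>\<sigma> d z\<bar> \<le> 1) \<Longrightarrow>
      (\<And>d z w. \<bar>\<sigma> d z - \<sigma> d w\<bar> \<le> 2 / m * \<bar>real_of_int z - real_of_int w\<bar>) \<Longrightarrow>
      0 \<le> y \<Longrightarrow> y < int M \<Longrightarrow>
      \<bar>avg I (\<lambda>i. avg I (\<lambda>j. \<sigma> (i - j) (r i - r j + y))) - avg I (\<lambda>i. avg I (\<lambda>j. \<sigma> (i - j) (r i - r j)))\<bar> \<le> e\<^sup>2 / 4"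
  shows "E (\<lambda>x. \<bar>avg (strip I r m) (\<lambda>v. G (T v x)) - avg (strip I r M) (\<lambda>v. G (T v x))\<bar>) \<le> e"
proof -
  let ?D = "\<lambda>x. avg (strip I r m) (\<lambda>v. G (T v x)) - avg (strip I r M) (\<lambda>v. G (T v x))"
  have "E (\<lambda>x. (?D x)\<^sup>2) \<le> 4 * (e\<^sup>2 / 4)"
    by (rule strip_pair_bound[OF I m G _ pair]) auto
  then have "E (\<lambda>x. (?D x)\<^sup>2) / e \<le> e\<^sup>2 / e" using e by (intro divide_right_mono) auto
  then show ?thesis using avg_abs_le_square[OF e, of X ?D] e by (simp add: power2_eq_square)
qed

text \<open>Both losses of \<open>strip_sym_diff\<close> are small in proportion when
  \<open>l\<close> is much smaller than the number of columns and than the width \<open>m\<close>.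
  This is why the structured argument works with thick arcs.\<close>

lemma well_spread_strip:
  fixes r :: "int \<Rightarrow> int"
  assumes r: "\<And>i j. i \<in> {lo..hi} \<Longrightarrow> j \<in> {lo..hi} \<Longrightarrow> real_of_int \<bar>r i - r j\<bar> \<le> \<Lambda> * real_of_int \<bar>i - j\<bar> + 1"
    and \<Lambda>: "\<Lambda> \<ge> 0" and q: "lo \<le> hi" and m: "m > 0" and D: "2 * D \<le> L"
    and i: "\<And>i. i \<in> {lo..hi} \<Longrightarrow> real_of_int \<bar>i\<bar> \<le> D" "\<And>i. i \<in> {lo..hi} \<Longrightarrow> real_of_int \<bar>r i\<bar> + m \<le> D"
    and Q: "(real L)\<^sup>2 \<le> Q * (real (card {lo..hi}) * real m)"
    and \<eta>: "2 * real l / real (card {lo..hi}) + 2 * (\<Lambda> * l + 1 + l) / m \<le> \<eta>"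
  shows "well_spread l L D \<eta> Q (strip {lo..hi} r m)"
  unfolding well_spread_def
proof (intro conjI ballI)
  let ?S = "strip {lo..hi} r m"
  have cS: "card ?S = card {lo..hi} * m" by (rule card_strip) simp
  have c: "real (card {lo..hi}) > 0" using q by simp
  show "finite ?S" by (rule finite_strip) simp
  have "(lo, r lo) \<in> ?S" using q m by (simp add: strip_def)
  then show "?S \<noteq> {}" by blast
  show "2 * D \<le> real L" by fact
  show "(real L)\<^sup>2 \<le> Q * card ?S" using Q by (simp add: cS)
  fix v assume "v \<in> ?S"
  then have v: "fst v \<in> {lo..hi}" "r (fst v) \<le> snd v" "snd v < r (fst v) + int m" by (auto simp: strip_def)
  show "real_of_int \<bar>fst v\<bar> \<le> D" by (rule i(1)[OF v(1)])
  have "\<bar>snd v\<bar> \<le> \<bar>r (fst v)\<bar> + int m" using v by linarith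
  then have "real_of_int \<bar>snd v\<bar> \<le> real_of_int \<bar>r (fst v)\<bar> + m" by linarith
  then show "real_of_int \<bar>snd v\<bar> \<le> D" using i(2)[OF v(1)] by linarith
next
  fix p assume p: "p \<in> Box l"
  let ?S = "strip {lo..hi} r m"
  have cS: "card ?S = card {lo..hi} * m" by (rule card_strip) simp
  have c: "real (card {lo..hi}) > 0" using q by simp
  have m0: "real m > 0" using m by simp
  have "2 * real (sym_diff_card ?S p) \<le> 2 * (real l * real m + real (card {lo..hi}) * (\<Lambda> * l + 1 + l))"
    using strip_sym_diff[of lo hi r \<Lambda> p l m, OF r \<Lambda> p] by simp
  also have "\<dots> = (2 * real l / real (card {lo..hi}) + 2 * (\<Lambda> * l + 1 + l) / m) * (real (card {lo..hi}) * real m)"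
  proof -
    have "2 * (a * m + c * b) = (2 * a / c + 2 * b / m) * (c * m)" if "c > 0" "m > 0" for a b c m :: real
      using that by (simp add: field_simps)
    from this[OF c m0] show ?thesis .
  qed
  also have "\<dots> \<le> \<eta> * (real (card {lo..hi}) * real m)"
    by (intro mult_right_mono \<eta>) auto
  finally show "2 * real (sym_diff_card ?S p) \<le> \<eta> * card ?S" by (simp add: cS)
qed

end

section \<open>A graph inside the curve\<close>

lemma nth_vector_derivative_component:
  assumes "smooth \<gamma>"
  shows "((\<lambda>t. nth_vector_derivative n \<gamma> t $ i) has_real_derivative nth_vector_derivative (Suc n) \<gamma> t $ i) (at t)"
proof -
  have "nth_vector_derivative n \<gamma> differentiable (at t)" using assms by (simp add: smooth_def)
  then have "(nth_vector_derivative n \<gamma> has_vector_derivative vector_derivative (nth_vector_derivative n \<gamma>) (at t)) (at t)"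
    by (simp add: vector_derivative_works)
  also have "vector_derivative (nth_vector_derivative n \<gamma>) (at t) = nth_vector_derivative (Suc n) \<gamma> t"
    by (simp add: nth_vector_derivative_def)
  finally show ?thesis
    unfolding has_real_derivative_iff_has_vector_derivative
    by (rule bounded_linear.has_vector_derivative[OF bounded_linear_vec_nth])
qed

text \<open>Away from vertical tangents the curve is a graph over its first coordinate, with second
  derivative \<open>N / x 1 ^ 3\<close>, where \<open>N\<close> is the numerator of the curvature.
  On a compact interval this is bounded away from 0. The interval avoids 0, which later keeps the
  ten points apart.\<close>

lemma curve_contains_curved_graph:
  assumes "closed_smooth_curve_nonvanishing_curvature \<Gamma>"
  obtains \<phi> \<phi>1 \<phi>2 :: "real \<Rightarrow> real" and a b c C \<Lambda> :: real
  where "curved_graph \<phi> \<phi>1 \<phi>2 a b c C \<Lambda>" "\<And>u. u \<in> {a..b} \<Longrightarrow> vector [u, \<phi> u] \<in> \<Gamma>" "0 < a \<or> b < 0"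
proof -
  obtain \<gamma> L where g: "closed_smooth_param \<gamma> L \<Gamma>" "\<And>t. curvature \<gamma> t \<noteq> 0"
    using assms by (auto simp: closed_smooth_curve_nonvanishing_curvature_def)
  then have sm: "smooth \<gamma>" and \<Gamma>: "\<Gamma> = range \<gamma>" by (auto simp: closed_smooth_param_def)
  define x where "x n t = nth_vector_derivative n \<gamma> t $ 1" for n t
  define y where "y n t = nth_vector_derivative n \<gamma> t $ 2" for n t
  have dx: "(x n has_real_derivative x (Suc n) t) (at t)" for n t
    unfolding x_def[abs_def] by (rule nth_vector_derivative_component[OF sm])
  have dy: "(y n has_real_derivative y (Suc n) t) (at t)" for n t
    unfolding y_def[abs_def] by (rule nth_vector_derivative_component[OF sm])
  have cx: "continuous_on A (x n)" and cy: "continuous_on A (y n)" for A n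
    using DERIV_continuous[OF dx] DERIV_continuous[OF dy]
    by (auto simp: continuous_on_eq_continuous_within intro: continuous_at_imp_continuous_at_within)
  define N where "N t = x 1 t * y 2 t - y 1 t * x 2 t" for t
  have N: "N t \<noteq> 0" for t
    using g(2)[of t] by (auto simp: curvature_def Let_def N_def x_def y_def)
  \<comment> \<open>If the derivative of the first coordinate vanished everywhere, so would the
    second derivative, and with it \<open>N\<close>.\<close>
  have "\<exists>t0. x 1 t0 \<noteq> 0"
  proof (rule ccontr)
    assume "\<nexists>t0. x 1 t0 \<noteq> 0"
    then have z: "x 1 = (\<lambda>_. 0)" by auto
    have "x (Suc 1) 0 = 0" using dx[of 1 0] unfolding z by (rule DERIV_unique) simp
    then show False using N[of 0] z by (simp add: N_def numeral_2_eq_2)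
  qed
  then obtain t0 where t0: "x 1 t0 \<noteq> 0" by blast
  have "open {t. x 1 t \<noteq> 0}" by (intro open_Collect_neq cx continuous_on_const)
  then obtain e where e: "e > 0" "ball t0 e \<subseteq> {t. x 1 t \<noteq> 0}" using t0 unfolding open_contains_ball by blast
  \<comment> \<open>A first coordinate that vanished on the whole ball would have derivative 0 at
    \<open>t0\<close>.\<close>
  have "\<exists>t\<in>ball t0 e. x 0 t \<noteq> 0"
  proof (rule ccontr)
    assume "\<not> ?thesis"
    then have z: "\<And>t. t \<in> ball t0 e \<Longrightarrow> x 0 t = 0" by blast
    have "((\<lambda>_. 0) has_real_derivative x (Suc 0) t0) (at t0)"
      by (rule DERIV_cong_ev[THEN iffD1, OF refl _ refl dx[of 0 t0]])
        (use z e(1) in \<open>auto intro!: eventually_nhds[THEN iffD2] exI[of _ "ball t0 e"]\<close>)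
    then have "x (Suc 0) t0 = 0" by (rule DERIV_unique) simp
    then show False using t0 by simp
  qed
  then obtain t1 where t1: "x 1 t1 \<noteq> 0" "x 0 t1 \<noteq> 0" using e by blast
  have "open ({t. x 1 t \<noteq> 0} \<inter> {t. x 0 t \<noteq> 0})" by (intro open_Int open_Collect_neq cx continuous_on_const)
  then obtain r where r: "r > 0" "ball t1 r \<subseteq> {t. x 1 t \<noteq> 0} \<inter> {t. x 0 t \<noteq> 0}"
    using t1 unfolding open_contains_ball by blast
  let ?S = "ball t1 r"
  have S: "x 1 t \<noteq> 0" "x 0 t \<noteq> 0" if "t \<in> ?S" for t using r that by auto
  have inj: "inj_on (x 0) ?S"
  proof (rule linorder_inj_onI')
    fix s t assume st: "s \<in> ?S" "t \<in> ?S" "s < t"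
    have "\<exists>z. s < z \<and> z < t \<and> x 0 t - x 0 s = (t - s) * x (Suc 0) z"
      by (rule MVT2[OF st(3)]) (rule dx)
    then obtain z where z: "s < z" "z < t" "x 0 t - x 0 s = (t - s) * x 1 z" by auto
    have "z \<in> ?S" using st z by (auto simp: dist_real_def abs_less_iff)
    then show "x 0 s \<noteq> x 0 t" using z S(1)[of z] st by auto
  qed
  obtain h where hom: "homeomorphism ?S (x 0 ` ?S) (x 0) h"
    using invariance_of_domain_homeomorphism[of ?S "x 0"] cx inj by auto
  let ?T = "x 0 ` ?S"
  have "open ?T" by (rule invariance_of_domain[OF cx _ inj]) simp
  moreover have "x 0 t1 \<in> ?T" using r(1) by simp
  ultimately obtain \<rho> where \<rho>: "\<rho> > 0" "cball (x 0 t1) \<rho> \<subseteq> ?T" unfolding open_contains_cball by blast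
  define a b where "a = x 0 t1 - \<rho>" and "b = x 0 t1 + \<rho>"
  have ab: "a < b" and abT: "{a..b} \<subseteq> ?T" using \<rho> by (auto simp: a_def b_def cball_eq_atLeastAtMost)
  have hS: "h u \<in> ?S" "x 0 (h u) = u" if "u \<in> ?T" for u
    using hom that by (auto simp: homeomorphism_def)
  have ch: "continuous_on ?T h" using hom by (simp add: homeomorphism_def)
  have dh: "(h has_real_derivative inverse (x 1 (h u))) (at u)" if u: "u \<in> ?T" for u
  proof (rule has_field_derivative_inverse_basic[where f = "x 0" and t = ?T])
    show "(x 0 has_real_derivative x 1 (h u)) (at (h u))" using dx[of 0] by simp
    show "x 1 (h u) \<noteq> 0" using S hS u by blast
    show "isCont h u" using ch u unfolding continuous_on_eq_continuous_at[OF \<open>open ?T\<close>] by blast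
    show "\<And>z. z \<in> ?T \<Longrightarrow> x 0 (h z) = z" by (rule hS)
  qed (use u \<open>open ?T\<close> in auto)
  \<comment> \<open>The derivatives of order one, two and three of the second coordinate with
    respect to the first, as functions of the curve parameter. \<open>f3\<close> supplies the
    Lipschitz constant.\<close>
  define f1 where "f1 t = y 1 t / x 1 t" for t
  define f2 where "f2 t = N t / x 1 t ^ 3" for t
  define f3 where "f3 t = ((x 1 t * y 3 t - y 1 t * x 3 t) * x 1 t - 3 * N t * x 2 t) / x 1 t ^ 5" for t
  have x1: "x 1 (h u) \<noteq> 0" if "u \<in> ?T" for u using S hS that by blast
  have dx1: "(x 1 has_real_derivative x 2 t) (at t)" "(y 1 has_real_derivative y 2 t) (at t)"
    "(x 2 has_real_derivative x 3 t) (at t)" "(y 2 has_real_derivative y 3 t) (at t)" for t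
    using dx[of 1] dy[of 1] dx[of 2] dy[of 2] by (simp_all add: numeral_2_eq_2 numeral_3_eq_3)
  have df1: "(f1 has_real_derivative f2 t * x 1 t) (at t)" if "x 1 t \<noteq> 0" for t
    unfolding f1_def[abs_def] f2_def N_def
    by (rule derivative_eq_intros dx1 that refl)+ (use that in \<open>simp add: field_simps power3_eq_cube\<close>)
  have dN: "(N has_real_derivative x 1 t * y 3 t - y 1 t * x 3 t) (at t)" for t
    unfolding N_def[abs_def]
    by (rule derivative_eq_intros dx1 refl)+ (simp add: algebra_simps)
  have df2: "(f2 has_real_derivative f3 t * x 1 t) (at t)" if "x 1 t \<noteq> 0" for t
  proof -
    have "((\<lambda>t. N t / x 1 t ^ 3) has_real_derivative
       ((x 1 t * y 3 t - y 1 t * x 3 t) * x 1 t ^ 3 - N t * (3 * x 1 t ^ 2 * x 2 t)) / (x 1 t ^ 3 * x 1 t ^ 3)) (at t)"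
      by (rule derivative_eq_intros dx1 dN refl)+ (use that in \<open>simp_all add: algebra_simps\<close>)
    moreover have "((x 1 t * y 3 t - y 1 t * x 3 t) * x 1 t ^ 3 - N t * (3 * x 1 t ^ 2 * x 2 t)) / (x 1 t ^ 3 * x 1 t ^ 3) = f3 t * x 1 t"
    proof -
      have "(P * a ^ 3 - M * (3 * a ^ 2 * z)) / (a ^ 3 * a ^ 3) = ((P * a - 3 * M * z) / a ^ 5) * a" if "a \<noteq> 0" for P a M z :: real
        using that by (simp add: field_simps power2_eq_square power3_eq_cube power_numeral_reduce)
      from this[OF that] show ?thesis unfolding f3_def by simp
    qed
    ultimately show ?thesis unfolding f2_def[abs_def] by simp
  qed
  let ?\<phi> = "\<lambda>u. y 0 (h u)" and ?\<phi>1 = "\<lambda>u. f1 (h u)" and ?\<phi>2 = "\<lambda>u. f2 (h u)" and ?\<phi>3 = "\<lambda>u. f3 (h u)"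
  have d0: "(?\<phi> has_real_derivative ?\<phi>1 u) (at u)" if u: "u \<in> ?T" for u
    using DERIV_chain2[OF dy[of 0] dh[OF u]] by (simp add: f1_def divide_inverse)
  have d1: "(?\<phi>1 has_real_derivative ?\<phi>2 u) (at u)" if u: "u \<in> ?T" for u
    using DERIV_chain2[OF df1[OF x1[OF u]] dh[OF u]] x1[OF u] by (simp add: mult.assoc)
  have d2: "(?\<phi>2 has_real_derivative ?\<phi>3 u) (at u)" if u: "u \<in> ?T" for u
    using DERIV_chain2[OF df2[OF x1[OF u]] dh[OF u]] x1[OF u] by (simp add: mult.assoc)
  have ch': "continuous_on {a..b} h" by (rule continuous_on_subset[OF ch abT])
  have cxh: "continuous_on {a..b} (\<lambda>u. x n (h u))" "continuous_on {a..b} (\<lambda>u. y n (h u))" for n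
    using continuous_on_compose[OF ch' cx] continuous_on_compose[OF ch' cy] by (simp_all add: comp_def)
  have xh: "\<forall>u\<in>{a..b}. x 1 (h u) ^ k \<noteq> 0" for k using x1 abT by auto
  have c2: "continuous_on {a..b} ?\<phi>2" unfolding f2_def N_def
    by (intro continuous_intros cxh xh)
  have c3: "continuous_on {a..b} ?\<phi>3" unfolding f3_def N_def
    by (intro continuous_intros cxh xh)
  have "bounded (?\<phi>3 ` {a..b})" by (intro compact_imp_bounded compact_continuous_image c3) auto
  then obtain \<Lambda> where \<Lambda>: "\<And>u. u \<in> {a..b} \<Longrightarrow> \<bar>?\<phi>3 u\<bar> \<le> \<Lambda>" unfolding bounded_iff real_norm_def by blast
  have "bounded (?\<phi>2 ` {a..b})" by (intro compact_imp_bounded compact_continuous_image c2) auto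
  then obtain C where C: "\<And>u. u \<in> {a..b} \<Longrightarrow> \<bar>?\<phi>2 u\<bar> \<le> C" unfolding bounded_iff real_norm_def by blast
  have "\<exists>w\<in>{a..b}. \<forall>u\<in>{a..b}. \<bar>?\<phi>2 w\<bar> \<le> \<bar>?\<phi>2 u\<bar>"
    by (rule continuous_attains_inf) (use ab c2 in \<open>auto intro: continuous_on_rabs\<close>)
  then obtain w where w: "w \<in> {a..b}" "\<And>u. u \<in> {a..b} \<Longrightarrow> \<bar>?\<phi>2 w\<bar> \<le> \<bar>?\<phi>2 u\<bar>" by blast
  have "\<bar>?\<phi>2 w\<bar> > 0" using x1[of w] w(1) abT N by (auto simp: f2_def)
  show ?thesis
  proof (rule that)
    show "curved_graph ?\<phi> ?\<phi>1 ?\<phi>2 a b \<bar>?\<phi>2 w\<bar> C \<Lambda>"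
    proof
      fix u v assume uv: "u \<in> {a..b}" "v \<in> {a..b}"
      show "\<bar>?\<phi>2 u - ?\<phi>2 v\<bar> \<le> \<Lambda> * \<bar>u - v\<bar>"
      proof -
        have "norm (?\<phi>2 u - ?\<phi>2 v) \<le> \<Lambda> * norm (u - v)"
        proof (rule field_differentiable_bound[where S = "{a..b}" and f' = ?\<phi>3])
          fix z assume z: "z \<in> {a..b}"
          then show "norm (?\<phi>3 z) \<le> \<Lambda>" using \<Lambda> by simp
          have "z \<in> ?T" using z abT by blast
          then show "(?\<phi>2 has_real_derivative ?\<phi>3 z) (at z within {a..b})"
            by (rule has_field_derivative_at_within[OF d2])
        qed (use uv in auto)
        then show ?thesis by simp
      qed
    qed (use ab \<open>\<bar>?\<phi>2 w\<bar> > 0\<close> d0 d1 abT w C in auto)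
    show "vector [u, ?\<phi> u] \<in> \<Gamma>" if "u \<in> {a..b}" for u
    proof -
      have "u \<in> ?T" using that abT by auto
      then have "vector [u, ?\<phi> u] = \<gamma> (h u)" using hS(2)[of u]
        by (simp add: vec_eq_iff forall_2 x_def y_def nth_vector_derivative_def)
      then show ?thesis unfolding \<Gamma> by simp
    qed
    show "0 < a \<or> b < 0"
    proof (rule ccontr)
      assume "\<not> ?thesis"
      then have "0 \<in> ?T" using abT by auto
      then show False using S(2) by auto
    qed
  qed
qed

section \<open>From the integral to a lattice sum\<close>

definition lat :: "int \<times> int \<Rightarrow> real^2"
  where "lat n = vector [of_int (fst n), of_int (snd n)]"

definition cell :: "real \<Rightarrow> real^2 \<Rightarrow> int \<times> int"
  where "cell h v = (\<lfloor>v $ 1 / h\<rfloor>, \<lfloor>v $ 2 / h\<rfloor>)"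

lemma lat_nth [simp]: "lat n $ 1 = of_int (fst n)" "lat n $ 2 = of_int (snd n)"
  by (simp_all add: lat_def)

lemma lat_add: "lat (m + n) = lat m + lat n"
  by (simp add: vec_eq_iff forall_2)

lemma norm_vec2_le: "norm (v :: real^2) \<le> \<bar>v $ 1\<bar> + \<bar>v $ 2\<bar>"
  using norm_le_l1_cart[of v] by (simp add: sum_2)

lemma cell_bounds:
  assumes "h > 0"
  shows "h * lat (cell h v) $ 1 \<le> v $ 1" "v $ 1 < h * lat (cell h v) $ 1 + h"
    "h * lat (cell h v) $ 2 \<le> v $ 2" "v $ 2 < h * lat (cell h v) $ 2 + h"
proof -
  have *: "h * of_int \<lfloor>a / h\<rfloor> \<le> a \<and> a < h * of_int \<lfloor>a / h\<rfloor> + h" for a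
    using floor_divide_lower[OF assms, of a] floor_divide_upper[OF assms, of a]
    by (simp add: algebra_simps)
  show "h * lat (cell h v) $ 1 \<le> v $ 1" "v $ 1 < h * lat (cell h v) $ 1 + h"
    "h * lat (cell h v) $ 2 \<le> v $ 2" "v $ 2 < h * lat (cell h v) $ 2 + h"
    using *[of "v $ 1"] *[of "v $ 2"] by (auto simp: cell_def)
qed

lemma cell_dist:
  assumes "h > 0" shows "norm (v - h *\<^sub>R lat (cell h v)) \<le> 2 * h"
  using norm_vec2_le[of "v - h *\<^sub>R lat (cell h v)"] cell_bounds[OF assms, of v] by simp

lemma emeasure_square_cbox:
  assumes "0 \<le> s" shows "emeasure lborel (cbox (a::real^2) (a + vec s)) = ennreal (s\<^sup>2)"
proof -
  have i: "vec s \<bullet> b = s" if "b \<in> Basis" for b :: "real^2"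
    using that by (auto simp: Basis_vec_def inner_axis)
  have "emeasure lborel (cbox a (a + vec s)) = ennreal (\<Prod>b\<in>Basis. (a + vec s - a) \<bullet> b)"
    using assms by (intro emeasure_lborel_cbox) (simp add: inner_add_left i)
  also have "(\<Prod>b\<in>Basis. (a + vec s - a) \<bullet> b) = (\<Prod>b\<in>(Basis :: (real^2) set). s)"
    by (intro prod.cong refl) (simp add: i)
  finally show ?thesis by simp
qed

lemma square_eq: "square r = cbox (vec (- r)) (vec (- r) + vec (2 * r))"
proof -
  have "vec (- r) + vec (2 * r) = (vec r :: real^2)" by (simp add: vec_eq_iff)
  then show ?thesis by (simp only: square_def)
qed

lemma emeasure_square: "0 \<le> r \<Longrightarrow> emeasure lborel (square r) = ennreal (4 * r\<^sup>2)"
  unfolding square_eq by (subst emeasure_square_cbox) (auto simp: power_mult_distrib)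

lemma nn_integral_Times_lborel:
  fixes f :: "'a::euclidean_space \<times> 'b::euclidean_space \<Rightarrow> ennreal"
  assumes f: "f \<in> borel_measurable borel" and A: "A \<in> sets borel" and B: "B \<in> sets borel"
  shows "(\<integral>\<^sup>+p\<in>A \<times> B. f p \<partial>lborel) = (\<integral>\<^sup>+x\<in>A. (\<integral>\<^sup>+y\<in>B. f (x, y) \<partial>lborel) \<partial>lborel)"
proof -
  have fm: "f \<in> borel_measurable (lborel \<Otimes>\<^sub>M lborel)" using f by (simp add: lborel_prod)
  have AB: "A \<times> B \<in> sets (lborel \<Otimes>\<^sub>M lborel)" using A B by auto
  have g: "(\<lambda>p. f p * indicator (A \<times> B) p) \<in> borel_measurable (lborel \<Otimes>\<^sub>M lborel)"
    using fm AB by simp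
  have "(\<integral>\<^sup>+p\<in>A \<times> B. f p \<partial>lborel) = (\<integral>\<^sup>+x. \<integral>\<^sup>+y. f (x, y) * indicator (A \<times> B) (x, y) \<partial>lborel \<partial>lborel)"
    unfolding lborel_prod[symmetric] by (rule lborel.nn_integral_fst[OF g, symmetric])
  also have "\<dots> = (\<integral>\<^sup>+x. (\<integral>\<^sup>+y. (f (x, y) * indicator B y) * indicator A x \<partial>lborel) \<partial>lborel)"
    by (intro nn_integral_cong) (simp add: indicator_times mult.commute mult.left_commute)
  also have "\<dots> = (\<integral>\<^sup>+x\<in>A. (\<integral>\<^sup>+y\<in>B. f (x, y) \<partial>lborel) \<partial>lborel)"
  proof (rule nn_integral_cong)
    fix x
    have "(\<lambda>y. f (x, y)) \<in> borel_measurable lborel" using fm by (rule measurable_Pair2) simp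
    then show "(\<integral>\<^sup>+y. (f (x, y) * indicator B y) * indicator A x \<partial>lborel) = (\<integral>\<^sup>+y\<in>B. f (x, y) \<partial>lborel) * indicator A x"
      using B by (intro nn_integral_multc) simp
  qed
  finally show ?thesis .
qed

lemma section_borel:
  fixes f :: "'a::euclidean_space \<times> 'b::euclidean_space \<Rightarrow> ennreal"
  assumes "f \<in> borel_measurable borel" shows "(\<lambda>y. f (x, y)) \<in> borel_measurable borel"
proof -
  have "f \<in> borel_measurable (lborel \<Otimes>\<^sub>M lborel)" using assms by (simp add: lborel_prod)
  then have "(\<lambda>y. f (x, y)) \<in> borel_measurable lborel" by (rule measurable_Pair2) simp
  then show ?thesis by simp
qed

section \<open>Integrals over seven planar variables\<close>

type_synonym tup7 = "(real^2) \<times> (real^2) \<times> (real^2) \<times> (real^2) \<times> (real^2) \<times> (real^2) \<times> (real^2)"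

lemma nn_integral_7:
  fixes f :: "tup7 \<Rightarrow> ennreal"
  assumes f: "f \<in> borel_measurable borel" and Q: "Q \<in> sets borel" and S: "S \<in> sets borel"
  shows "(\<integral>\<^sup>+p\<in>Q \<times> S \<times> S \<times> S \<times> S \<times> S \<times> S. f p \<partial>lborel) =
    (\<integral>\<^sup>+x\<in>Q. (\<integral>\<^sup>+v1\<in>S. (\<integral>\<^sup>+v2\<in>S. (\<integral>\<^sup>+v3\<in>S. (\<integral>\<^sup>+s1\<in>S. (\<integral>\<^sup>+s2\<in>S. (\<integral>\<^sup>+s3\<in>S.
      f (x, v1, v2, v3, s1, s2, s3) \<partial>lborel) \<partial>lborel) \<partial>lborel) \<partial>lborel) \<partial>lborel) \<partial>lborel) \<partial>lborel)"
proof -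
  note T = nn_integral_Times_lborel
  note b = borel_Times
  have b2: "S \<times> S \<in> sets borel" using S by (intro b)
  have b3: "S \<times> S \<times> S \<in> sets borel" using S b2 by (intro b)
  have b4: "S \<times> S \<times> S \<times> S \<in> sets borel" using S b3 by (intro b)
  have b5: "S \<times> S \<times> S \<times> S \<times> S \<in> sets borel" using S b4 by (intro b)
  have b6: "S \<times> S \<times> S \<times> S \<times> S \<times> S \<in> sets borel" using S b5 by (intro b)
  note f1 = section_borel[OF f]
  note f2 = section_borel[OF f1]
  note f3 = section_borel[OF f2]
  note f4 = section_borel[OF f3]
  note f5 = section_borel[OF f4]
  show ?thesis
    by (simp only: T[OF f Q b6] T[OF f1 S b5] T[OF f2 S b4] T[OF f3 S b3] T[OF f4 S b2] T[OF f5 S S])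
qed

text \<open>A non-integrable function has Bochner integral 0. Only upper bounds on
  \<open>vc_average\<close> are wanted, so passing to nonnegative integrals in this way is enough,
  and the measurability of \<open>vc_form\<close> and of its inner integral never comes up.\<close>

lemma ennreal_integral_le_nn_integral:
  assumes "\<And>x. 0 \<le> f x"
  shows "ennreal (integral\<^sup>L M f) \<le> (\<integral>\<^sup>+x. ennreal (f x) \<partial>M)"
proof (cases "integrable M f")
  case True
  then show ?thesis using assms by (simp add: nn_integral_eq_integral)
qed (simp add: not_integrable_integral_eq)

lemma nn_integral_translate_indicator:
  assumes "O' \<in> sets borel"
  shows "(\<integral>\<^sup>+v\<in>S. indicator O' (y + v) * c \<partial>lborel) \<le> c * emeasure lborel (O' :: (real^2) set)"
proof -
  have "(\<integral>\<^sup>+v\<in>S. indicator O' (y + v) * c \<partial>lborel) \<le> (\<integral>\<^sup>+v. c * indicator O' (y + v) \<partial>lborel)"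
    by (intro nn_integral_mono) (auto simp: indicator_def)
  also have "\<dots> = (\<integral>\<^sup>+v. c * indicator O' v \<partial>distr lborel borel ((+) y))"
    using assms by (subst nn_integral_distr) auto
  also have "\<dots> = c * emeasure lborel O'"
    using assms by (simp add: lborel_distr_plus nn_integral_cmult_indicator)
  finally show ?thesis .
qed

lemma nn_integral_const_on:
  "S \<in> sets borel \<Longrightarrow> (\<integral>\<^sup>+v\<in>S. c \<partial>lborel) = c * emeasure lborel (S :: (real^2) set)"
  by (simp add: nn_integral_cmult_indicator)

definition config_points :: "(tup7 \<Rightarrow> real^2) set"
  where "config_points = set [\<lambda>(x, v1, v2, v3, s1, s2, s3). x, \<lambda>(x, v1, v2, v3, s1, s2, s3). x + v1,
    \<lambda>(x, v1, v2, v3, s1, s2, s3). x + v2, \<lambda>(x, v1, v2, v3, s1, s2, s3). x + v3,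
    \<lambda>(x, v1, v2, v3, s1, s2, s3). x + v1 + v2, \<lambda>(x, v1, v2, v3, s1, s2, s3). x + v1 + v3,
    \<lambda>(x, v1, v2, v3, s1, s2, s3). x + v2 + v3, \<lambda>(x, v1, v2, v3, s1, s2, s3). x + v1 + s1,
    \<lambda>(x, v1, v2, v3, s1, s2, s3). x + v2 + s2, \<lambda>(x, v1, v2, v3, s1, s2, s3). x + v3 + s3]"

lemma config_points_continuous: "f \<in> config_points \<Longrightarrow> continuous_on UNIV f"
  unfolding config_points_def by (auto simp: split_beta' intro!: continuous_intros)

lemma card_config_points: "finite config_points" "card config_points \<le> 10"
proof -
  show "finite config_points" unfolding config_points_def by simp
  show "card config_points \<le> 10" unfolding config_points_def
    by (rule order_trans[OF card_length]) simp
qed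

text \<open>Once the other variables are fixed, each of the ten points is a translate of one
  variable, and the integral over that variable is at most \<open>\<eta>\<close>. The rest
  contributes a product of volumes, which \<open>1 \<le> V\<close> and \<open>1 \<le> W\<close>
  allow to be rounded up to \<open>V ^ 6 * W\<close>.\<close>

lemma config_point_measure:
  assumes f: "f \<in> config_points" and O': "open O'" "emeasure lborel O' \<le> \<eta>"
    and Q: "Q \<in> sets borel" "1 \<le> emeasure lborel Q" and S: "S \<in> sets borel" "1 \<le> emeasure lborel S"
  shows "emeasure lborel ((f -` O') \<inter> (Q \<times> S \<times> S \<times> S \<times> S \<times> S \<times> S))
    \<le> \<eta> * (emeasure lborel S ^ 6 * emeasure lborel Q)"
proof -
  define V where "V = emeasure lborel S"
  define W where "W = emeasure lborel Q"
  have V1: "1 \<le> V" and W1: "1 \<le> W" using Q S by (auto simp: V_def W_def)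
  define I where "I g = (\<integral>\<^sup>+v\<in>S. g v \<partial>lborel)" for g :: "real^2 \<Rightarrow> ennreal"
  define J where "J g = (\<integral>\<^sup>+v\<in>Q. g v \<partial>lborel)" for g :: "real^2 \<Rightarrow> ennreal"
  have Ic: "I (\<lambda>_. c) = c * V" for c unfolding I_def V_def by (rule nn_integral_const_on[OF S(1)])
  have mono: "(\<integral>\<^sup>+v\<in>R. g v \<partial>lborel) \<le> c * emeasure lborel R"
    if "R \<in> sets borel" "\<And>v. g v \<le> c" for R :: "(real^2) set" and g c
    unfolding nn_integral_const_on[OF that(1), symmetric]
    by (intro nn_integral_mono mult_right_mono that) simp
  have Im: "(\<And>v. g v \<le> c) \<Longrightarrow> I g \<le> c * V" for g c unfolding I_def V_def by (rule mono[OF S(1)])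
  have Jm: "(\<And>v. g v \<le> c) \<Longrightarrow> J g \<le> c * W" for g c unfolding J_def W_def by (rule mono[OF Q(1)])
  have crit: "(\<integral>\<^sup>+v\<in>R. indicator O' (y + v) * c \<partial>lborel) \<le> c * \<eta>" for R y c
    by (rule order_trans[OF nn_integral_translate_indicator mult_left_mono[OF O'(2)]]) (use O'(1) in auto)
  have Icr: "I (\<lambda>v. indicator O' (y + v) * c) \<le> c * \<eta>" for y c unfolding I_def by (rule crit)
  have Icr1: "I (\<lambda>v. indicator O' (y + v)) \<le> \<eta>" for y using Icr[of y 1] by simp
  have Jcr: "J (\<lambda>v. indicator O' v * c) \<le> c * \<eta>" for c unfolding J_def using crit[of 0 c Q] by simp
  have fb: "(f -` O') \<in> sets borel"
    using config_points_continuous[OF f] O'(1) by (intro borel_open open_vimage) (auto simp: continuous_on_eq_continuous_at)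
  have "emeasure lborel ((f -` O') \<inter> (Q \<times> S \<times> S \<times> S \<times> S \<times> S \<times> S))
    = (\<integral>\<^sup>+p\<in>Q \<times> S \<times> S \<times> S \<times> S \<times> S \<times> S. indicator (f -` O') p \<partial>lborel)"
  proof -
    have "Q \<times> S \<times> S \<times> S \<times> S \<times> S \<times> S \<in> sets borel" by (intro borel_Times Q S)
    then have "f -` O' \<inter> (Q \<times> S \<times> S \<times> S \<times> S \<times> S \<times> S) \<in> sets lborel" using fb by (simp add: sets.Int)
    from nn_integral_indicator[OF this] show ?thesis by (simp only: indicator_inter_arith)
  qed
  also have "\<dots> = (\<integral>\<^sup>+p\<in>Q \<times> S \<times> S \<times> S \<times> S \<times> S \<times> S. indicator O' (f p) \<partial>lborel)"
    by (simp add: indicator_def)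
  also have "\<dots> = J (\<lambda>x. I (\<lambda>v1. I (\<lambda>v2. I (\<lambda>v3. I (\<lambda>s1. I (\<lambda>s2. I (\<lambda>s3.
     indicator O' (f (x, v1, v2, v3, s1, s2, s3)))))))))"
  proof -
    have "(\<lambda>p. indicator O' (f p) :: ennreal) = indicator (f -` O')" by (auto simp: indicator_def)
    then have "(\<lambda>p. indicator O' (f p) :: ennreal) \<in> borel_measurable borel" using fb by simp
    from nn_integral_7[OF this Q(1) S(1)] show ?thesis unfolding I_def J_def .
  qed
  also have "\<dots> \<le> \<eta> * (V ^ 6 * W)"
  proof -
    have V5: "\<eta> * (V ^ 5 * W) \<le> \<eta> * (V ^ 6 * W)"
      using V1 by (intro mult_left_mono mult_right_mono power_increasing) auto
    have V6: "\<eta> * V ^ 6 \<le> \<eta> * (V ^ 6 * W)"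
      using mult_left_mono[OF W1, of "\<eta> * V ^ 6"] by (simp add: mult.assoc)
    have Rm: "x \<le> c \<Longrightarrow> x * k \<le> c * k" for x c k :: ennreal by (rule mult_right_mono) auto
    note le5 = order_trans[OF eq_refl V5]
    note e = eval_nat_numeral
    show ?thesis
      using f unfolding config_points_def list.set
      \<comment> \<open>One subgoal for each point, in the order of the definition. The decisive
        variable is the innermost one that occurs in the point, and the nested rules peel off the
        integrals around it.\<close>
      apply (elim insertE emptyE; simp only: split Ic mult.assoc)
      subgoal by (rule order_trans[OF Jcr order_trans[OF eq_refl V6]]) (simp add: e ac_simps)
      subgoal by (rule order_trans[OF Jm[OF Icr] le5]) (simp add: e ac_simps)
      subgoal by (rule order_trans[OF Jm[OF Rm[OF Icr]] le5]) (simp add: e ac_simps)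
      subgoal by (rule order_trans[OF Jm[OF Rm[OF Icr]] le5]) (simp add: e ac_simps)
      subgoal by (rule order_trans[OF Jm[OF Im[OF Icr]] le5]) (simp add: e ac_simps)
      subgoal by (rule order_trans[OF Jm[OF Im[OF Rm[OF Icr]]] le5]) (simp add: e ac_simps)
      subgoal by (rule order_trans[OF Jm[OF Rm[OF Im[OF Icr]]] le5]) (simp add: e ac_simps)
      subgoal by (rule order_trans[OF Jm[OF Im[OF Rm[OF Icr]]] le5]) (simp add: e ac_simps)
      subgoal by (rule order_trans[OF Jm[OF Rm[OF Im[OF Rm[OF Icr]]]] le5]) (simp add: e ac_simps)
      subgoal by (rule order_trans[OF Jm[OF Rm[OF Im[OF Rm[OF Icr1]]]] le5]) (simp add: e ac_simps)
      done
  qed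
  finally show ?thesis unfolding V_def W_def .
qed

text \<open>Each of the ten points is a sum of at most three vectors, and rounding one of them to
  the lattice with origin \<open>a\<close> costs at most \<open>2 * h\<close>. So
  \<open>6 * h\<close> is needed, and the radius \<open>10 * h\<close> leaves room.\<close>

definition near :: "(real^2) set \<Rightarrow> real^2 \<Rightarrow> real \<Rightarrow> int \<times> int \<Rightarrow> bool"
  where "near K a h n \<longleftrightarrow> (\<exists>p\<in>K. dist (a + h *\<^sub>R lat n) p \<le> 10 * h)"

text \<open>The shift operation \<open>T\<close> is arbitrary, so that one predicate serves the
  plane and the lattice, where \<open>T\<close> is addition, as well as the torus.\<close>

definition config :: "('x \<Rightarrow> bool) \<Rightarrow> ('x \<Rightarrow> bool) \<Rightarrow> ('v::plus \<Rightarrow> 'x \<Rightarrow> 'x) \<Rightarrow> 'x \<Rightarrow>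
    'v \<Rightarrow> 'v \<Rightarrow> 'v \<Rightarrow> 'v \<Rightarrow> 'v \<Rightarrow> 'v \<Rightarrow> bool"
  where "config a b T x m1 m2 m3 k1 k2 k3 \<longleftrightarrow> b x \<and> a (T m1 x) \<and> a (T m2 x) \<and> a (T m3 x) \<and>
    b (T (m1 + m2) x) \<and> b (T (m1 + m3) x) \<and> b (T (m2 + m3) x) \<and>
    b (T (k1 + m1) x) \<and> b (T (k2 + m2) x) \<and> b (T (k3 + m3) x)"

lemma vc_form_bounds: "0 \<le> vc_form A B x v1 v2 v3 s1 s2 s3"
  "vc_form A B x v1 v2 v3 s1 s2 s3 \<le> 1"
  unfolding vc_form_def by (auto simp: indicator_def)

lemma near_cell_sum:
  assumes h: "h > 0" and p: "p \<in> K" "norm (p - (a + h *\<^sub>R lat n)) \<le> 10 * h"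
  shows "near K a h n"
  using p unfolding near_def by (auto simp: dist_norm norm_minus_commute)

text \<open>Where the integrand is not 0, the ten points lie in the compact sets, being inside the
  window \<open>W\<close> and outside \<open>O'\<close>; rounding all seven variables leaves each
  point near its set.\<close>

lemma vc_form_le_config:
  assumes h: "h > 0"
    and W: "\<And>f. f \<in> config_points \<Longrightarrow> f (x, v1, v2, v3, s1, s2, s3) \<in> W"
    and A: "A \<inter> W \<subseteq> KA \<union> O'" and B: "B \<inter> W \<subseteq> KB \<union> O'"
    and O: "\<And>f. f \<in> config_points \<Longrightarrow> f (x, v1, v2, v3, s1, s2, s3) \<notin> O'"
  shows "vc_form A B x v1 v2 v3 s1 s2 s3 \<le> of_bool (config (near KA a h) (near KB a h) (+)
    (cell h (x - a)) (cell h v1) (cell h v2) (cell h v3) (cell h s1) (cell h s2) (cell h s3))"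
proof (cases "vc_form A B x v1 v2 v3 s1 s2 s3 = 0")
  case False
  then have "x \<in> B" "x + v1 \<in> A" "x + v2 \<in> A" "x + v3 \<in> A" "x + v1 + v2 \<in> B" "x + v1 + v3 \<in> B"
    "x + v2 + v3 \<in> B" "x + v1 + s1 \<in> B" "x + v2 + s2 \<in> B" "x + v3 + s3 \<in> B"
    unfolding vc_form_def by (auto simp: indicator_def split: if_splits)
  moreover have "\<forall>f\<in>config_points. f (x, v1, v2, v3, s1, s2, s3) \<in> W - O'" using W O by blast
  then have "x \<in> W - O'" "x + v1 \<in> W - O'" "x + v2 \<in> W - O'" "x + v3 \<in> W - O'"
    "x + v1 + v2 \<in> W - O'" "x + v1 + v3 \<in> W - O'" "x + v2 + v3 \<in> W - O'"
    "x + v1 + s1 \<in> W - O'" "x + v2 + s2 \<in> W - O'" "x + v3 + s3 \<in> W - O'"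
    unfolding config_points_def list.set ball_simps split by blast+
  ultimately have K: "x \<in> KB" "x + v1 \<in> KA" "x + v2 \<in> KA" "x + v3 \<in> KA" "x + v1 + v2 \<in> KB" "x + v1 + v3 \<in> KB"
    "x + v2 + v3 \<in> KB" "x + v1 + s1 \<in> KB" "x + v2 + s2 \<in> KB" "x + v3 + s3 \<in> KB"
    using A B by blast+
  have d: "norm (w - h *\<^sub>R lat (cell h w)) \<le> 2 * h" for w by (rule cell_dist[OF h])
  have n1: "near K a h (cell h (x - a))" if "x \<in> K" for K
    by (rule near_cell_sum[OF h that]) (use d[of "x - a"] h in \<open>simp add: algebra_simps\<close>)
  have n2: "near K a h (cell h v + cell h (x - a))" if "x + v \<in> K" for K v
  proof (rule near_cell_sum[OF h that])
    have "x + v - (a + h *\<^sub>R lat (cell h v + cell h (x - a)))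
      = (x - a - h *\<^sub>R lat (cell h (x - a))) + (v - h *\<^sub>R lat (cell h v))"
      by (simp add: lat_add algebra_simps)
    also have "norm \<dots> \<le> 2 * h + 2 * h" by (rule norm_triangle_mono[OF d d])
    finally show "norm (x + v - (a + h *\<^sub>R lat (cell h v + cell h (x - a)))) \<le> 10 * h" using h by simp
  qed
  have n3: "near K a h (cell h v + cell h w + cell h (x - a))" if "x + v + w \<in> K" for K v w
  proof (rule near_cell_sum[OF h that])
    have "x + v + w - (a + h *\<^sub>R lat (cell h v + cell h w + cell h (x - a)))
      = (x - a - h *\<^sub>R lat (cell h (x - a))) + (v - h *\<^sub>R lat (cell h v)) + (w - h *\<^sub>R lat (cell h w))"
      by (simp add: lat_add algebra_simps)
    also have "norm \<dots> \<le> 2 * h + 2 * h + 2 * h" by (intro norm_triangle_mono d)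
    finally show "norm (x + v + w - (a + h *\<^sub>R lat (cell h v + cell h w + cell h (x - a)))) \<le> 10 * h" using h by simp
  qed
  have n3': "near K a h (cell h w + cell h v + cell h (x - a))" if "x + v + w \<in> K" for K v w
    using n3[OF that] by (simp only: add.commute)
  have "config (near KA a h) (near KB a h) (+)
    (cell h (x - a)) (cell h v1) (cell h v2) (cell h v3) (cell h s1) (cell h s2) (cell h s3)"
    unfolding config_def using K by (intro conjI n1 n2 n3 n3')
  then show ?thesis using vc_form_bounds by simp
qed simp

lemma emeasure_Times_lborel:
  assumes "A \<in> sets borel" "B \<in> sets borel"
  shows "emeasure lborel ((A :: 'a::euclidean_space set) \<times> (B :: 'b::euclidean_space set)) = emeasure lborel A * emeasure lborel B"
  unfolding lborel_prod[symmetric] using assms by (intro lborel.emeasure_pair_measure_Times) auto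

text \<open>Closed cells overlap along their boundaries, which does no harm in an upper
  bound.\<close>

definition cell_box :: "real \<Rightarrow> real^2 \<Rightarrow> int \<times> int \<Rightarrow> (real^2) set"
  where "cell_box h a n = cbox (a + h *\<^sub>R lat n) (a + h *\<^sub>R lat n + vec h)"

lemma cell_box_borel [simp]: "cell_box h a n \<in> sets borel" by (simp add: cell_box_def)

lemma in_cell_box: "h > 0 \<Longrightarrow> x \<in> cell_box h a (cell h (x - a))"
  using cell_bounds[of h "x - a"] by (auto simp: cell_box_def mem_box_cart forall_2)

lemma emeasure_cell_box: "h \<ge> 0 \<Longrightarrow> emeasure lborel (cell_box h a n) = ennreal (h\<^sup>2)"
  unfolding cell_box_def by (rule emeasure_square_cbox)

definition tup_box :: "real \<Rightarrow> real^2 \<Rightarrow> _ \<Rightarrow> tup7 set"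
  where "tup_box h a = (\<lambda>(n, m1, m2, m3, k1, k2, k3). cell_box h a n \<times> cell_box h 0 m1 \<times> cell_box h 0 m2 \<times>
     cell_box h 0 m3 \<times> cell_box h 0 k1 \<times> cell_box h 0 k2 \<times> cell_box h 0 k3)"

lemma tup_box_borel: "tup_box h a i \<in> sets borel"
  by (cases i) (auto simp: tup_box_def intro!: borel_Times)

lemma emeasure_tup_box:
  assumes "h \<ge> 0" shows "emeasure lborel (tup_box h a i) = ennreal (h ^ 14)"
proof -
  obtain n m1 m2 m3 k1 k2 k3 where i: "i = (n, m1, m2, m3, k1, k2, k3)" by (cases i)
  have "emeasure lborel (tup_box h a i) = ennreal (h\<^sup>2) * (ennreal (h\<^sup>2) * (ennreal (h\<^sup>2) * (ennreal (h\<^sup>2) * (ennreal (h\<^sup>2) * (ennreal (h\<^sup>2) * ennreal (h\<^sup>2))))))"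
    unfolding i tup_box_def split
    by (simp only: emeasure_Times_lborel borel_Times cell_box_borel emeasure_cell_box[OF assms])
  also have "\<dots> = ennreal (h ^ 14)"
    by (simp add: ennreal_mult[symmetric] power_add[symmetric])
  finally show ?thesis .
qed

text \<open>The integrand is majorized by \<open>H\<close>: the product cells, each of measure
  \<open>h ^ 14\<close>, of tuples that form a lattice configuration, together with the set
  \<open>U\<close> of tuples with one of the ten points in \<open>O'\<close>. Read backwards, this
  bounds the number of lattice configurations from below.\<close>

lemma discrete_lower_bound:
  assumes h: "h > 0" and A: "A \<inter> W \<subseteq> KA \<union> O'" and B: "B \<inter> W \<subseteq> KB \<union> O'"
    and O': "open O'" "emeasure lborel O' \<le> ennreal \<eta>" and \<eta>: "\<eta> \<ge> 0" and R: "R \<ge> 1" and r: "r \<ge> 1"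
    and W: "\<And>x u w. x \<in> cbox z (z + vec R) \<Longrightarrow> u \<in> square r \<Longrightarrow> w \<in> square r \<Longrightarrow> x \<in> W \<and> x + u \<in> W \<and> x + u + w \<in> W"
    and N: "finite N" "\<And>x. x \<in> cbox z (z + vec R) \<Longrightarrow> cell h (x - a) \<in> N"
    and M: "finite M" "\<And>v. v \<in> square r \<Longrightarrow> cell h v \<in> M"
  shows "vc_average A B R z r * ((2 * r) ^ 12 * R\<^sup>2) \<le>
    h ^ 14 * (\<Sum>(n, m1, m2, m3, k1, k2, k3)\<in>N \<times> M \<times> M \<times> M \<times> M \<times> M \<times> M.
       of_bool (config (near KA a h) (near KB a h) (+) n m1 m2 m3 k1 k2 k3))
    + 10 * \<eta> * ((2 * r) ^ 12 * R\<^sup>2)"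
proof -
  let ?Q = "cbox z (z + vec R)" and ?S = "square r"
  let ?S6 = "?S \<times> ?S \<times> ?S \<times> ?S \<times> ?S \<times> ?S"
  let ?I = "N \<times> M \<times> M \<times> M \<times> M \<times> M \<times> M"
  define \<Phi> where "\<Phi> = (\<lambda>(n, m1, m2, m3, k1, k2, k3).
    of_bool (config (near KA a h) (near KB a h) (+) n m1 m2 m3 k1 k2 k3) :: real)"
  define V :: "tup7 \<Rightarrow> real" where "V = (\<lambda>(x, v1, v2, v3, s1, s2, s3). vc_form A B x v1 v2 v3 s1 s2 s3)"
  define U where "U = (\<Union>f\<in>config_points. f -` O')"
  define H where "H p = (\<Sum>i\<in>?I. ennreal (\<Phi> i) * indicator (tup_box h a i) p) + indicator U p" for p
  have Qb: "?Q \<in> sets borel" and Sb: "?S \<in> sets borel" by (auto simp: square_def)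
  have S6b: "?S6 \<in> sets borel" by (intro borel_Times Sb)
  have fI: "finite ?I" using N M by (intro finite_cartesian_product)
  have fO: "open (f -` O')" if "f \<in> config_points" for f
    using config_points_continuous[OF that] O'(1) by (simp add: open_vimage)
  then have Ub: "U \<in> sets borel" unfolding U_def by (intro borel_open open_UN) auto
  have Hb: "H \<in> borel_measurable borel"
    unfolding H_def[abs_def] using tup_box_borel Ub by (intro borel_measurable_add borel_measurable_sum) auto
  have V0: "0 \<le> V p" for p by (auto simp: V_def vc_form_bounds split: prod.split)
  have VH: "ennreal (V (x, q)) \<le> H (x, q)" if x: "x \<in> ?Q" and q: "q \<in> ?S6" for x q
  proof (cases "(x, q) \<in> U")
    case True
    have "V (x, q) \<le> 1" by (auto simp: V_def vc_form_bounds split: prod.split)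
    then have "ennreal (V (x, q)) \<le> 1" by (simp add: ennreal_le_1)
    also have "1 \<le> H (x, q)" using True by (simp add: H_def)
    finally show ?thesis .
  next
    case False
    obtain v1 v2 v3 s1 s2 s3 where q': "q = (v1, v2, v3, s1, s2, s3)" by (cases q)
    have v: "v1 \<in> ?S" "v2 \<in> ?S" "v3 \<in> ?S" "s1 \<in> ?S" "s2 \<in> ?S" "s3 \<in> ?S" using q q' by auto
    let ?i = "(cell h (x - a), cell h v1, cell h v2, cell h v3, cell h s1, cell h s2, cell h s3)"
    have "V (x, q) \<le> \<Phi> ?i"
      unfolding V_def \<Phi>_def q' split
    proof (rule vc_form_le_config[OF h _ A B])
      fix f assume f: "f \<in> config_points"
      then show "f (x, v1, v2, v3, s1, s2, s3) \<notin> O'" using False by (auto simp: U_def q')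
      show "f (x, v1, v2, v3, s1, s2, s3) \<in> W" using f W[OF x] v unfolding config_points_def list.set
        by (elim insertE emptyE) auto
    qed
    then have "ennreal (V (x, q)) \<le> ennreal (\<Phi> ?i) * indicator (tup_box h a ?i) (x, q)"
      using in_cell_box[OF h, of x a] in_cell_box[OF h, of _ 0]
      by (simp add: tup_box_def q' indicator_def ennreal_leI)
    also have "\<dots> \<le> (\<Sum>i\<in>?I. ennreal (\<Phi> i) * indicator (tup_box h a i) (x, q))"
      by (rule member_le_sum[where f = "\<lambda>i. ennreal (\<Phi> i) * indicator (tup_box h a i) (x, q)"])
        (use N(2)[OF x] M(2) v fI in auto)
    also have "\<dots> \<le> H (x, q)" by (simp add: H_def)
    finally show ?thesis .
  qed
  define J where "J x = (LINT q:?S6|lebesgue. V (x, q))" for x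
  have J0: "0 \<le> J x" for x unfolding J_def set_lebesgue_integral_def
    by (intro Bochner_Integration.integral_nonneg) (auto simp: V0)
  have J: "ennreal (J x) \<le> (\<integral>\<^sup>+q\<in>?S6. H (x, q) \<partial>lborel)" if x: "x \<in> ?Q" for x
  proof -
    have "ennreal (J x) \<le> (\<integral>\<^sup>+q. ennreal (indicator ?S6 q *\<^sub>R V (x, q)) \<partial>lebesgue)"
      unfolding J_def set_lebesgue_integral_def by (rule ennreal_integral_le_nn_integral) (auto simp: V0)
    also have "\<dots> = (\<integral>\<^sup>+q. ennreal (indicator ?S6 q *\<^sub>R V (x, q)) \<partial>lborel)"
      by (rule nn_integral_completion)
    also have "\<dots> \<le> (\<integral>\<^sup>+q\<in>?S6. H (x, q) \<partial>lborel)"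
    proof (rule nn_integral_mono)
      fix q show "ennreal (indicator ?S6 q *\<^sub>R V (x, q)) \<le> H (x, q) * indicator ?S6 q"
        using VH[OF x, of q] by (cases "q \<in> ?S6") auto
    qed
    finally show ?thesis .
  qed
  have "ennreal (LINT x:?Q|lebesgue. J x) \<le> (\<integral>\<^sup>+x. ennreal (indicator ?Q x *\<^sub>R J x) \<partial>lebesgue)"
    unfolding set_lebesgue_integral_def by (rule ennreal_integral_le_nn_integral) (auto simp: J0)
  also have "\<dots> = (\<integral>\<^sup>+x. ennreal (indicator ?Q x *\<^sub>R J x) \<partial>lborel)"
    by (rule nn_integral_completion)
  also have "\<dots> \<le> (\<integral>\<^sup>+x\<in>?Q. (\<integral>\<^sup>+q\<in>?S6. H (x, q) \<partial>lborel) \<partial>lborel)"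
  proof (rule nn_integral_mono)
    fix x show "ennreal (indicator ?Q x *\<^sub>R J x) \<le> (\<integral>\<^sup>+q\<in>?S6. H (x, q) \<partial>lborel) * indicator ?Q x"
      using J[of x] by (cases "x \<in> ?Q") auto
  qed
  also have "\<dots> = (\<integral>\<^sup>+p\<in>?Q \<times> ?S6. H p \<partial>lborel)"
    by (rule nn_integral_Times_lborel[OF Hb Qb S6b, symmetric])
  also have "\<dots> \<le> (\<integral>\<^sup>+p. (\<Sum>i\<in>?I. ennreal (\<Phi> i) * indicator (tup_box h a i) p) + indicator (U \<inter> ?Q \<times> ?S6) p \<partial>lborel)"
    by (intro nn_integral_mono) (auto simp: H_def indicator_def)
  also have "\<dots> = (\<integral>\<^sup>+p. (\<Sum>i\<in>?I. ennreal (\<Phi> i) * indicator (tup_box h a i) p) \<partial>lborel) + emeasure lborel (U \<inter> ?Q \<times> ?S6)"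
  proof -
    have "U \<inter> ?Q \<times> ?S6 \<in> sets borel" using Ub by (intro sets.Int borel_Times Qb S6b)
    then show ?thesis using tup_box_borel
      by (subst nn_integral_add) (auto intro!: borel_measurable_sum)
  qed
  also have "(\<integral>\<^sup>+p. (\<Sum>i\<in>?I. ennreal (\<Phi> i) * indicator (tup_box h a i) p) \<partial>lborel) = ennreal (h ^ 14 * (\<Sum>i\<in>?I. \<Phi> i))"
  proof -
    have "(\<integral>\<^sup>+p. (\<Sum>i\<in>?I. ennreal (\<Phi> i) * indicator (tup_box h a i) p) \<partial>lborel)
       = (\<Sum>i\<in>?I. \<integral>\<^sup>+p. ennreal (\<Phi> i) * indicator (tup_box h a i) p \<partial>lborel)"
      using tup_box_borel by (intro nn_integral_sum) auto
    also have "\<dots> = (\<Sum>i\<in>?I. ennreal (\<Phi> i * h ^ 14))"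
    proof (rule sum.cong[OF refl])
      fix i
      have "(\<integral>\<^sup>+p. ennreal (\<Phi> i) * indicator (tup_box h a i) p \<partial>lborel) = ennreal (\<Phi> i) * ennreal (h ^ 14)"
        using tup_box_borel[of h a i] h by (simp add: nn_integral_cmult_indicator emeasure_tup_box)
      also have "\<dots> = ennreal (\<Phi> i * h ^ 14)" using h by (simp add: ennreal_mult'')
      finally show "(\<integral>\<^sup>+p. ennreal (\<Phi> i) * indicator (tup_box h a i) p \<partial>lborel) = ennreal (\<Phi> i * h ^ 14)" .
    qed
    also have "\<dots> = ennreal (\<Sum>i\<in>?I. \<Phi> i * h ^ 14)"
      using h by (intro sum_ennreal) (auto simp: \<Phi>_def)
    finally show ?thesis by (simp add: sum_distrib_left mult.commute)
  qed
  also have "emeasure lborel (U \<inter> ?Q \<times> ?S6) \<le> ennreal (10 * \<eta> * ((2 * r) ^ 12 * R\<^sup>2))"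
  proof -
    have S1: "emeasure lborel ?S = ennreal (4 * r\<^sup>2)" using r by (intro emeasure_square) simp
    have Q1: "emeasure lborel ?Q = ennreal (R\<^sup>2)" using R by (intro emeasure_square_cbox) simp
    have "1 * 1 \<le> r * r" using r by (intro mult_mono) auto
    then have S1': "1 \<le> emeasure lborel ?S" unfolding S1 by (simp add: power2_eq_square)
    have Q1': "1 \<le> emeasure lborel ?Q" unfolding Q1 using R by simp
    have eq: "U \<inter> ?Q \<times> ?S6 = (\<Union>f\<in>config_points. (f -` O') \<inter> (?Q \<times> ?S6))" unfolding U_def by blast
    have "emeasure lborel (U \<inter> ?Q \<times> ?S6) \<le> (\<Sum>f\<in>config_points. emeasure lborel ((f -` O') \<inter> (?Q \<times> ?S6)))"
      unfolding eq
    proof (rule emeasure_subadditive_finite[OF card_config_points(1)])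
      show "(\<lambda>f. (f -` O') \<inter> (?Q \<times> ?S6)) ` config_points \<subseteq> sets lborel"
        using fO by (auto intro!: sets.Int borel_Times Qb S6b Sb)
    qed
    also have "\<dots> \<le> (\<Sum>f\<in>config_points. ennreal \<eta> * (emeasure lborel ?S ^ 6 * emeasure lborel ?Q))"
      by (intro sum_mono config_point_measure O' Qb Sb S1' Q1')
    also have "\<dots> = of_nat (card config_points) * (ennreal \<eta> * (emeasure lborel ?S ^ 6 * emeasure lborel ?Q))" by simp
    also have "\<dots> \<le> of_nat 10 * (ennreal \<eta> * (emeasure lborel ?S ^ 6 * emeasure lborel ?Q))"
      by (intro mult_right_mono of_nat_mono card_config_points(2)) simp
    also have "\<dots> = ennreal (10 * \<eta> * ((2 * r) ^ 12 * R\<^sup>2))"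
    proof -
      have "(4 * r\<^sup>2) ^ 6 = (2 * r) ^ 12" by (simp add: power_mult_distrib power_mult[symmetric])
      then show ?thesis unfolding S1 Q1 using \<eta> r
        by (simp add: ennreal_power ennreal_mult[symmetric] ennreal_numeral[symmetric] mult.assoc del: ennreal_numeral)
    qed
    finally show ?thesis .
  qed
  finally have "ennreal (LINT x:?Q|lebesgue. J x) \<le> ennreal (h ^ 14 * (\<Sum>i\<in>?I. \<Phi> i)) + ennreal (10 * \<eta> * ((2 * r) ^ 12 * R\<^sup>2))"
    by (simp add: add_left_mono)
  also have "\<dots> = ennreal (h ^ 14 * (\<Sum>i\<in>?I. \<Phi> i) + 10 * \<eta> * ((2 * r) ^ 12 * R\<^sup>2))"
    using h \<eta> r by (intro ennreal_plus[symmetric]) (auto intro!: mult_nonneg_nonneg sum_nonneg simp: \<Phi>_def)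
  finally have le: "(LINT x:?Q|lebesgue. J x) \<le> h ^ 14 * (\<Sum>i\<in>?I. \<Phi> i) + 10 * \<eta> * ((2 * r) ^ 12 * R\<^sup>2)"
    using h \<eta> r by (subst (asm) ennreal_le_iff) (auto intro!: add_nonneg_nonneg mult_nonneg_nonneg sum_nonneg simp: \<Phi>_def)
  have "vc_average A B R z r = 1 / ((2 * r) ^ 12 * R\<^sup>2) * (LINT x:?Q|lebesgue. J x)"
    unfolding vc_average_def J_def V_def by (simp add: split_beta')
  then have "vc_average A B R z r * ((2 * r) ^ 12 * R\<^sup>2) = (LINT x:?Q|lebesgue. J x)" using r R by simp
  then show ?thesis using le by (simp add: \<Phi>_def)
qed

text \<open>The exact configuration is found as a limit, which calls for closed sets. What the
  compact subset misses is put into an open set, because its preimages under the ten continuous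
  points are again open and hence Borel.\<close>

lemma compact_plus_small_open:
  fixes E :: "(real^2) set"
  assumes E: "E \<in> sets lebesgue" and W: "bounded W" "W \<in> sets lebesgue" and e: "e > 0"
  obtains K O' where "compact K" "K \<subseteq> E \<inter> W" "E \<inter> W \<subseteq> K \<union> O'" "open O'" "emeasure lborel O' \<le> ennreal e"
proof -
  have S: "E \<inter> W \<in> sets lebesgue" using E W by auto
  obtain K where K: "closed K" "K \<subseteq> E \<inter> W" "E \<inter> W - K \<in> lmeasurable" "emeasure lebesgue (E \<inter> W - K) < ennreal (e / 2)"
    using sets_lebesgue_inner_closed[OF S, of "e / 2"] e by auto
  have D: "E \<inter> W - K \<in> sets lebesgue" using K(3) by (simp add: fmeasurableD)
  obtain O' where O': "open O'" "E \<inter> W - K \<subseteq> O'" "O' - (E \<inter> W - K) \<in> lmeasurable"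
    "emeasure lebesgue (O' - (E \<inter> W - K)) < ennreal (e / 2)"
    using sets_lebesgue_outer_open[OF D, of "e / 2"] e by auto
  have "compact K" using K(1,2) W(1) by (meson bounded_subset compact_eq_bounded_closed inf_le2 order_trans)
  moreover have "E \<inter> W \<subseteq> K \<union> O'" using O'(2) by blast
  moreover have "emeasure lborel O' \<le> ennreal e"
  proof -
    have "emeasure lborel O' = emeasure lebesgue O'" using O'(1) by (simp add: borel_open)
    also have "\<dots> = emeasure lebesgue ((O' - (E \<inter> W - K)) \<union> (E \<inter> W - K))"
      using O'(2) by (intro arg_cong[where f = "emeasure lebesgue"]) blast
    also have "\<dots> \<le> emeasure lebesgue (O' - (E \<inter> W - K)) + emeasure lebesgue (E \<inter> W - K)"
      using O'(3) D by (intro emeasure_subadditive) (auto simp: fmeasurableD)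
    also have "\<dots> \<le> ennreal (e / 2) + ennreal (e / 2)" using K(4) O'(4) by (intro add_mono) auto
    also have "\<dots> = ennreal e" using e by (subst ennreal_plus[symmetric]) auto
    finally show ?thesis .
  qed
  ultimately show ?thesis using that K(2) O'(1) by blast
qed

text \<open>The sum of the ten distances is continuous and attains its minimum over a compact set,
  in which \<open>x\<close> is confined to the 1-neighbourhood of \<open>KB\<close>; the minimum is
  0. The sets are assumed nonempty because \<open>infdist\<close> to the empty set is 0 by
  convention.\<close>

lemma compact_config:
  fixes KA KB :: "(real^2) set"
  assumes K: "compact KA" "KA \<noteq> {}" "compact KB" "KB \<noteq> {}"
    and C: "compact C1" "compact C2" "compact C3" "compact C4" "compact C5" "compact C6"
    and app: "\<And>e. e > 0 \<Longrightarrow> \<exists>x. \<exists>v1\<in>C1. \<exists>v2\<in>C2. \<exists>v3\<in>C3. \<exists>s1\<in>C4. \<exists>s2\<in>C5. \<exists>s3\<in>C6.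
      config (\<lambda>p. infdist p KA \<le> e) (\<lambda>p. infdist p KB \<le> e) (+) x v1 v2 v3 s1 s2 s3"
  shows "\<exists>x. \<exists>v1\<in>C1. \<exists>v2\<in>C2. \<exists>v3\<in>C3. \<exists>s1\<in>C4. \<exists>s2\<in>C5. \<exists>s3\<in>C6.
      config (\<lambda>p. p \<in> KA) (\<lambda>p. p \<in> KB) (+) x v1 v2 v3 s1 s2 s3"
proof -
  define D where "D = {x. infdist x KB \<le> 1} \<times> C1 \<times> C2 \<times> C3 \<times> C4 \<times> C5 \<times> C6"
  define \<Psi> where "\<Psi> = (\<lambda>(x, v1, v2, v3, s1, s2, s3). infdist x KB + infdist (v1 + x) KA + infdist (v2 + x) KA
    + infdist (v3 + x) KA + infdist (v1 + v2 + x) KB + infdist (v1 + v3 + x) KB + infdist (v2 + v3 + x) KB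
    + infdist (s1 + v1 + x) KB + infdist (s2 + v2 + x) KB + infdist (s3 + v3 + x) KB)"
  have small: "\<exists>q\<in>D. \<Psi> q \<le> 10 * e" if e: "e > 0" "e \<le> 1" for e
  proof -
    obtain x v1 v2 v3 s1 s2 s3 where q: "v1 \<in> C1" "v2 \<in> C2" "v3 \<in> C3" "s1 \<in> C4" "s2 \<in> C5" "s3 \<in> C6"
      "config (\<lambda>p. infdist p KA \<le> e) (\<lambda>p. infdist p KB \<le> e) (+) x v1 v2 v3 s1 s2 s3"
      using app[OF e(1)] by blast
    then have "(x, v1, v2, v3, s1, s2, s3) \<in> D" using e by (auto simp: D_def config_def)
    moreover have "\<Psi> (x, v1, v2, v3, s1, s2, s3) \<le> 10 * e" using q(7) by (simp add: \<Psi>_def config_def)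
    ultimately show ?thesis by blast
  qed
  have cD: "compact D" unfolding D_def using K C by (intro compact_Times compact_infdist_le) auto
  have nD: "D \<noteq> {}" using small[of 1] by auto
  have "continuous_on D \<Psi>" unfolding \<Psi>_def split_beta' by (intro continuous_intros)
  from continuous_attains_inf[OF cD nD this]
  obtain q where q: "q \<in> D" "\<And>q'. q' \<in> D \<Longrightarrow> \<Psi> q \<le> \<Psi> q'" by auto
  have "\<Psi> q \<le> 0"
  proof (rule field_le_epsilon)
    fix e :: real assume "e > 0"
    then obtain q' where "q' \<in> D" "\<Psi> q' \<le> 10 * min 1 (e / 10)" using small[of "min 1 (e / 10)"] by auto
    then show "\<Psi> q \<le> 0 + e" using q(2)[of q'] by auto
  qed
  obtain x v1 v2 v3 s1 s2 s3 where q': "q = (x, v1, v2, v3, s1, s2, s3)" by (cases q)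
  have le: "infdist (x) KB + infdist (v1 + x) KA + infdist (v2 + x) KA + infdist (v3 + x) KA + infdist (v1 + v2 + x) KB + infdist (v1 + v3 + x) KB + infdist (v2 + v3 + x) KB + infdist (s1 + v1 + x) KB + infdist (s2 + v2 + x) KB + infdist (s3 + v3 + x) KB \<le> 0"
    using \<open>\<Psi> q \<le> 0\<close> by (simp add: \<Psi>_def q')
  have z: "infdist (x) KB = 0" "infdist (v1 + x) KA = 0" "infdist (v2 + x) KA = 0" "infdist (v3 + x) KA = 0" "infdist (v1 + v2 + x) KB = 0" "infdist (v1 + v3 + x) KB = 0" "infdist (v2 + v3 + x) KB = 0" "infdist (s1 + v1 + x) KB = 0" "infdist (s2 + v2 + x) KB = 0" "infdist (s3 + v3 + x) KB = 0"
    using le infdist_nonneg[of "x" KB] infdist_nonneg[of "v1 + x" KA] infdist_nonneg[of "v2 + x" KA] infdist_nonneg[of "v3 + x" KA] infdist_nonneg[of "v1 + v2 + x" KB] infdist_nonneg[of "v1 + v3 + x" KB] infdist_nonneg[of "v2 + v3 + x" KB] infdist_nonneg[of "s1 + v1 + x" KB] infdist_nonneg[of "s2 + v2 + x" KB] infdist_nonneg[of "s3 + v3 + x" KB]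
    by linarith+
  have "p \<in> KA" if "infdist p KA = 0" for p
    using that K in_closed_iff_infdist_zero[of KA p] by (simp add: compact_imp_closed)
  moreover have "p \<in> KB" if "infdist p KB = 0" for p
    using that K in_closed_iff_infdist_zero[of KB p] by (simp add: compact_imp_closed)
  ultimately have "config (\<lambda>p. p \<in> KA) (\<lambda>p. p \<in> KB) (+) x v1 v2 v3 s1 s2 s3"
    using z by (simp add: config_def)
  then show ?thesis using q(1) unfolding D_def q' by blast
qed

context shift_system begin

lemma config_avg_of_bool:
  "config_avg (\<lambda>x. of_bool (a x)) (\<lambda>x. of_bool (b x)) S1 S2 S3 U1 U2 U3 =
    E (\<lambda>x. avg S1 (\<lambda>v1. avg S2 (\<lambda>v2. avg S3 (\<lambda>v3. avg U1 (\<lambda>s1. avg U2 (\<lambda>s2. avg U3 (\<lambda>s3.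
      of_bool (config a b T x v1 v2 v3 s1 s2 s3))))))))"
proof -
  let ?A = "\<lambda>x. of_bool (a x) :: real" and ?B = "\<lambda>x. of_bool (b x) :: real"
  have eq: "?B x * (?A (T v1 x) * avg U1 (\<lambda>s. ?B (T s (T v1 x)))) * (?A (T v2 x) * avg U2 (\<lambda>s. ?B (T s (T v2 x))))
      * (?A (T v3 x) * avg U3 (\<lambda>s. ?B (T s (T v3 x)))) * ?B (T (v1 + v2) x) * ?B (T (v1 + v3) x) * ?B (T (v2 + v3) x)
    = avg U1 (\<lambda>s1. avg U2 (\<lambda>s2. avg U3 (\<lambda>s3. of_bool (config a b T x v1 v2 v3 s1 s2 s3))))" for x v1 v2 v3
  proof -
    let ?c = "?B x * ?A (T v1 x) * ?A (T v2 x) * ?A (T v3 x) * ?B (T (v1 + v2) x) * ?B (T (v1 + v3) x) * ?B (T (v2 + v3) x)"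
    have "of_bool (config a b T x v1 v2 v3 s1 s2 s3) = ?c * (?B (T (s1 + v1) x) * (?B (T (s2 + v2) x) * ?B (T (s3 + v3) x)))" for s1 s2 s3
      by (simp add: config_def of_bool_conj)
    then have "avg U1 (\<lambda>s1. avg U2 (\<lambda>s2. avg U3 (\<lambda>s3. of_bool (config a b T x v1 v2 v3 s1 s2 s3))))
      = ?c * (avg U1 (\<lambda>s. ?B (T (s + v1) x)) * (avg U2 (\<lambda>s. ?B (T (s + v2) x)) * avg U3 (\<lambda>s. ?B (T (s + v3) x))))"
      by (simp only: avg_cmult avg_multc)
    then show ?thesis by (simp only: T_T mult.assoc mult.commute mult.left_commute)
  qed
  show ?thesis unfolding config_avg_def form7_def eq ..
qed

lemma config_exists:
  assumes "config_avg (\<lambda>x. of_bool (a x)) (\<lambda>x. of_bool (b x)) S1 S2 S3 U1 U2 U3 > 0"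
  shows "\<exists>x\<in>X. \<exists>v1\<in>S1. \<exists>v2\<in>S2. \<exists>v3\<in>S3. \<exists>s1\<in>U1. \<exists>s2\<in>U2. \<exists>s3\<in>U3. config a b T x v1 v2 v3 s1 s2 s3"
proof (rule ccontr)
  assume n: "\<not> ?thesis"
  have z: "avg S f \<le> 0" if "\<And>v. v \<in> S \<Longrightarrow> f v \<le> 0" for S :: "'c set" and f using that by (rule avg_le_const) auto
  have "config_avg (\<lambda>x. of_bool (a x)) (\<lambda>x. of_bool (b x)) S1 S2 S3 U1 U2 U3 \<le> 0"
    unfolding config_avg_of_bool
    by (rule avg_le_const[OF avg_le_const[OF avg_le_const[OF avg_le_const[OF avg_le_const[OF avg_le_const[OF avg_le_const]]]]]])
      (use n in auto)
  then show False using assms by linarith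
qed

lemma config_avg_sum:
  "config_avg (\<lambda>x. of_bool (a x)) (\<lambda>x. of_bool (b x)) M M M M M M * (real (card X) * real (card M) ^ 6)
    = (\<Sum>(x, v1, v2, v3, s1, s2, s3)\<in>X \<times> M \<times> M \<times> M \<times> M \<times> M \<times> M. of_bool (config a b T x v1 v2 v3 s1 s2 s3))"
  (is "?L * _ = ?R")
proof (cases "card M = 0")
  case True
  then have "M = {} \<or> infinite M" by auto
  then have "?R = 0"
  proof
    assume "infinite M"
    then have "infinite (X \<times> M \<times> M \<times> M \<times> M \<times> M \<times> M)"
      using X_ne by (auto dest!: finite_cartesian_productD2)
    then show ?thesis by simp
  qed simp
  then show ?thesis using True by simp
next
  case False
  let ?I = "X \<times> M \<times> M \<times> M \<times> M \<times> M \<times> M"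
  let ?f = "\<lambda>(x, v1, v2, v3, s1, s2, s3). of_bool (config a b T x v1 v2 v3 s1 s2 s3)"
  have L: "?L = avg ?I ?f"
    unfolding config_avg_of_bool by (simp add: avg_Times)
  have c: "card ?I = card X * card M ^ 6"
    by (simp only: card_cartesian_product) (simp add: eval_nat_numeral)
  have "real (card X) * real (card M) ^ 6 \<noteq> 0" using False finite_X X_ne by simp
  then show ?thesis unfolding L avg_def c by simp
qed

end

section \<open>Configurations on a discrete torus\<close>

definition torus_shift :: "int \<Rightarrow> int \<times> int \<Rightarrow> int \<times> int \<Rightarrow> int \<times> int"
  where "torus_shift N v x = ((fst v + fst x) mod N, (snd v + snd x) mod N)"

definition torus :: "int \<Rightarrow> (int \<times> int) set"
  where "torus N = {0..<N} \<times> {0..<N}"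

lemma torus_shift_system: "N > 0 \<Longrightarrow> shift_system (torus N) (torus_shift N)"
proof
  fix u v x :: "int \<times> int"
  show "torus_shift N u (torus_shift N v x) = torus_shift N (u + v) x"
    by (simp add: torus_shift_def mod_add_right_eq add.assoc)
qed (auto simp: torus_shift_def torus_def)

lemma torus_shift_eq: "v + x \<in> torus N \<Longrightarrow> torus_shift N v x = v + x"
  by (cases v; cases x) (auto simp: torus_shift_def torus_def)

lemma config_torus:
  assumes "config a b (+) x v1 v2 v3 s1 s2 s3" and "\<And>y. a y \<or> b y \<Longrightarrow> y \<in> torus N"
  shows "config a b (torus_shift N) x v1 v2 v3 s1 s2 s3"
  using assms unfolding config_def by (metis torus_shift_eq)

text \<open>In this direction the sets say nothing about the unreduced sums, so their position is
  assumed; it will follow from the size of the vectors.\<close>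

lemma config_no_wrap:
  assumes "config a b (torus_shift N) x v1 v2 v3 s1 s2 s3"
    and "\<And>v. v \<in> {v1, v2, v3, v1 + v2, v1 + v3, v2 + v3, s1 + v1, s2 + v2, s3 + v3} \<Longrightarrow> v + x \<in> torus N"
  shows "config a b (+) x v1 v2 v3 s1 s2 s3"
  using assms unfolding config_def by (simp add: torus_shift_eq)

text \<open>The six vectors range over different arcs but share one thickness and one threshold. The
  least \<open>\<epsilon>\<close> and \<open>K\<close> and the largest \<open>n0\<close> serve all
  arcs, as the estimate persists when the former shrink and the latter grows.\<close>

lemma uniform_params:
  fixes \<alpha> \<beta> :: "nat \<Rightarrow> real"
  assumes cg: "\<And>i. i < k \<Longrightarrow> curved_graph \<phi> \<phi>1 \<phi>2 (\<alpha> i) (\<beta> i) c C \<Lambda>" and e: "e > 0" and k: "k > 0"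
  obtains \<epsilon> K n0 where "\<epsilon> > 0" "K > 0" "n0 > 0"
    "\<And>i n (\<sigma> :: int \<Rightarrow> int \<Rightarrow> real) (y :: int). i < k \<Longrightarrow> n \<ge> n0 \<Longrightarrow> (\<And>d z. \<bar>\<sigma> d z\<bar> \<le> 1) \<Longrightarrow>
      (\<And>d z w. \<bar>\<sigma> d z - \<sigma> d w\<bar> \<le> K * \<bar>real_of_int z - real_of_int w\<bar>) \<Longrightarrow>
      0 \<le> y \<Longrightarrow> of_int y \<le> \<epsilon> * n \<Longrightarrow>
      \<bar>avg (graph_points (\<alpha> i) (\<beta> i) n) (\<lambda>p. avg (graph_points (\<alpha> i) (\<beta> i) n) (\<lambda>q. \<sigma> (p - q) (graph_floor \<phi> n p - graph_floor \<phi> n q + y)))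
        - avg (graph_points (\<alpha> i) (\<beta> i) n) (\<lambda>p. avg (graph_points (\<alpha> i) (\<beta> i) n) (\<lambda>q. \<sigma> (p - q) (graph_floor \<phi> n p - graph_floor \<phi> n q)))\<bar> \<le> e"
proof -
  define good where "good i \<epsilon> K n0 \<longleftrightarrow> \<epsilon> > 0 \<and> K > 0 \<and> n0 > 0 \<and>
    (\<forall>n (\<sigma> :: int \<Rightarrow> int \<Rightarrow> real) (y :: int). n \<ge> n0 \<longrightarrow> (\<forall>d z. \<bar>\<sigma> d z\<bar> \<le> 1) \<longrightarrow>
      (\<forall>d z w. \<bar>\<sigma> d z - \<sigma> d w\<bar> \<le> K * \<bar>real_of_int z - real_of_int w\<bar>) \<longrightarrow>
      0 \<le> y \<longrightarrow> of_int y \<le> \<epsilon> * n \<longrightarrow>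
      \<bar>avg (graph_points (\<alpha> i) (\<beta> i) n) (\<lambda>p. avg (graph_points (\<alpha> i) (\<beta> i) n) (\<lambda>q. \<sigma> (p - q) (graph_floor \<phi> n p - graph_floor \<phi> n q + y)))
        - avg (graph_points (\<alpha> i) (\<beta> i) n) (\<lambda>p. avg (graph_points (\<alpha> i) (\<beta> i) n) (\<lambda>q. \<sigma> (p - q) (graph_floor \<phi> n p - graph_floor \<phi> n q)))\<bar> \<le> e)"
    for i \<epsilon> K n0
  have "\<exists>t. case t of (\<epsilon>, K, n0) \<Rightarrow> good i \<epsilon> K n0" if "i < k" for i
  proof -
    interpret curved_graph \<phi> \<phi>1 \<phi>2 "\<alpha> i" "\<beta> i" c C \<Lambda> by (rule cg[OF that])
    show ?thesis
    proof (rule pair_shift_small[OF e])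
      fix \<epsilon> K n0 assume *: "\<epsilon> > 0" "K > 0" "n0 > 0"
        "\<And>n (\<sigma> :: int \<Rightarrow> int \<Rightarrow> real) (y :: int). n \<ge> n0 \<Longrightarrow> (\<And>d z. \<bar>\<sigma> d z\<bar> \<le> 1) \<Longrightarrow>
        (\<And>d z w. \<bar>\<sigma> d z - \<sigma> d w\<bar> \<le> K * \<bar>real_of_int z - real_of_int w\<bar>) \<Longrightarrow>
        0 \<le> y \<Longrightarrow> of_int y \<le> \<epsilon> * n \<Longrightarrow>
        \<bar>avg (I n) (\<lambda>i. avg (I n) (\<lambda>j. \<sigma> (i - j) (r n i - r n j + y)))
          - avg (I n) (\<lambda>i. avg (I n) (\<lambda>j. \<sigma> (i - j) (r n i - r n j)))\<bar> \<le> e"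
      have "good i \<epsilon> K n0" unfolding good_def
        by (intro conjI allI impI *) auto
      then show ?thesis by blast
    qed
  qed
  then obtain t where t: "\<And>i. i < k \<Longrightarrow> case t i of (\<epsilon>, K, n0) \<Rightarrow> good i \<epsilon> K n0" by metis
  let ?E = "\<lambda>i. fst (t i)" and ?K = "\<lambda>i. fst (snd (t i))" and ?N = "\<lambda>i. snd (snd (t i))"
  have g: "good i (?E i) (?K i) (?N i)" if "i < k" for i using t[OF that] by (simp add: split_beta)
  have ne: "{..<k} \<noteq> {}" "finite {..<k}" using k by auto
  define \<epsilon> where "\<epsilon> = Min (?E ` {..<k})"
  define K where "K = Min (?K ` {..<k})"
  define n0 where "n0 = Max (?N ` {..<k})"
  have le: "\<epsilon> \<le> ?E i" "K \<le> ?K i" "?N i \<le> n0" if "i < k" for i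
    using that by (auto simp: \<epsilon>_def K_def n0_def)
  have pos: "\<epsilon> > 0" "K > 0" "n0 > 0"
  proof -
    have gp: "0 < ?E i" "0 < ?K i" "0 < ?N i" if "i < k" for i using g[OF that] by (auto simp: good_def)
    show "\<epsilon> > 0" "K > 0" unfolding \<epsilon>_def K_def using ne gp by auto
    show "n0 > 0" using gp(3)[OF k] le(3)[OF k] by linarith
  qed
  show ?thesis
  proof (rule that[OF pos])
    fix i n and \<sigma> :: "int \<Rightarrow> int \<Rightarrow> real" and y :: int
    assume i: "i < k" and n: "n \<ge> n0" and \<sigma>: "\<And>d z. \<bar>\<sigma> d z\<bar> \<le> 1"
      and lip: "\<And>d z w. \<bar>\<sigma> d z - \<sigma> d w\<bar> \<le> K * \<bar>real_of_int z - real_of_int w\<bar>"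
      and y: "0 \<le> y" "of_int y \<le> \<epsilon> * n"
    have n': "n \<ge> ?N i" using n le(3)[OF i] by linarith
    have lip': "\<bar>\<sigma> d z - \<sigma> d w\<bar> \<le> ?K i * \<bar>real_of_int z - real_of_int w\<bar>" for d z w
      using lip[of d z w] mult_right_mono[OF le(2)[OF i], of "\<bar>real_of_int z - real_of_int w\<bar>"] by linarith
    have "n > 0" using n pos by linarith
    then have y': "of_int y \<le> ?E i * n" using y(2) mult_right_mono[OF le(1)[OF i], of n] by linarith
    show "\<bar>avg (graph_points (\<alpha> i) (\<beta> i) n) (\<lambda>p. avg (graph_points (\<alpha> i) (\<beta> i) n) (\<lambda>q. \<sigma> (p - q) (graph_floor \<phi> n p - graph_floor \<phi> n q + y)))
        - avg (graph_points (\<alpha> i) (\<beta> i) n) (\<lambda>p. avg (graph_points (\<alpha> i) (\<beta> i) n) (\<lambda>q. \<sigma> (p - q) (graph_floor \<phi> n p - graph_floor \<phi> n q)))\<bar> \<le> e"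
      using g[OF i] n' \<sigma> lip' y(1) y' unfolding good_def by blast
  qed
qed

section \<open>Arcs and boxes as well-spread sets\<close>

definition arc :: "(real \<Rightarrow> real) \<Rightarrow> real \<Rightarrow> real \<Rightarrow> real \<Rightarrow> nat \<Rightarrow> (int \<times> int) set"
  where "arc \<phi> \<alpha> \<beta> n m = strip (graph_points \<alpha> \<beta> n) (graph_floor \<phi> n) m"

text \<open>The square of all lattice points with coordinates between
  \<open>- \<lceil>n\<rceil>\<close> and \<open>\<lceil>n\<rceil>\<close>, written as a strip over a
  constant graph so that one criterion covers arcs and boxes.\<close>

definition full_box :: "real \<Rightarrow> (int \<times> int) set"
  where "full_box n = strip {- \<lceil>n\<rceil>..\<lceil>n\<rceil>} (\<lambda>_. - \<lceil>n\<rceil>) (nat (2 * \<lceil>n\<rceil> + 1))"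

context shift_system begin

text \<open>All lengths are proportional to \<open>n\<close>, so that \<open>Q\<close> and
  \<open>\<eta>\<close> depend neither on the dilation nor on the spacing: \<open>l\<close> is a
  small multiple of \<open>n\<close>, the width of the strip at least
  \<open>\<epsilon> * n / 2\<close>, and \<open>L\<close> a large multiple.\<close>

lemma well_spread_strip_scaled:
  fixes r :: "int \<Rightarrow> int" and n \<kappa> \<kappa>' w \<epsilon> \<eta> P :: real
  assumes P: "P \<ge> 1" and w: "0 < w" and \<epsilon>: "0 < \<epsilon>" and \<eta>: "0 < \<eta>"
    and n: "n \<ge> 1" "n \<ge> 8 / (\<epsilon> * \<eta>)"
    and l: "real l \<le> \<kappa> * n" and \<kappa>: "4 * \<kappa> / w + 4 * (P + 1) * \<kappa> / \<epsilon> \<le> \<eta> / 2"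
    and L: "\<kappa>' * n \<le> L" "real L \<le> 2 * \<kappa>' * n" and \<kappa>': "2 * (P + 7) \<le> \<kappa>'"
    and r: "\<And>i j. i \<in> {lo..hi} \<Longrightarrow> j \<in> {lo..hi} \<Longrightarrow> real_of_int \<bar>r i - r j\<bar> \<le> P * real_of_int \<bar>i - j\<bar> + 1"
    and i: "\<And>i. i \<in> {lo..hi} \<Longrightarrow> real_of_int \<bar>i\<bar> \<le> (P + 7) * n" "\<And>i. i \<in> {lo..hi} \<Longrightarrow> real_of_int \<bar>r i\<bar> + m \<le> (P + 7) * n"
    and q: "w * n / 2 \<le> real (card {lo..hi})" and m: "\<epsilon> * n / 2 \<le> real m"
  shows "well_spread l L ((P + 7) * n) \<eta> (16 * \<kappa>'\<^sup>2 / (w * \<epsilon>)) (strip {lo..hi} r m)"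
proof (rule well_spread_strip[OF r])
  have n0: "n > 0" using n by simp
  have q0: "w * n / 2 > 0" and m0: "\<epsilon> * n / 2 > 0" using w \<epsilon> n0 by auto
  have qp: "real (card {lo..hi}) > 0" using q q0 by linarith
  show "lo \<le> hi" using qp by (cases "lo \<le> hi") auto
  show mp: "0 < m" using m m0 by (cases m) auto
  show "0 \<le> P" using P by simp
  have "2 * ((P + 7) * n) = 2 * (P + 7) * n" by simp
  also have "\<dots> \<le> \<kappa>' * n" using \<kappa>' n0 by (intro mult_right_mono) auto
  finally show "2 * ((P + 7) * n) \<le> real L" using L by linarith
  have "0 < 2 * (P + 7)" using P by simp
  then have \<kappa>'0: "\<kappa>' > 0" using \<kappa>' by (rule less_le_trans)
  have "(real L)\<^sup>2 \<le> (2 * \<kappa>' * n)\<^sup>2" using L by (intro power_mono) auto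
  also have "\<dots> = 16 * \<kappa>'\<^sup>2 / (w * \<epsilon>) * ((w * n / 2) * (\<epsilon> * n / 2))"
    using w \<epsilon> by (simp add: power2_eq_square)
  also have "\<dots> \<le> 16 * \<kappa>'\<^sup>2 / (w * \<epsilon>) * (real (card {lo..hi}) * real m)"
    using q m q0 m0 w \<epsilon> by (intro mult_left_mono mult_mono) auto
  finally show "(real L)\<^sup>2 \<le> 16 * \<kappa>'\<^sup>2 / (w * \<epsilon>) * (real (card {lo..hi}) * real m)" .
  have "2 * real l / real (card {lo..hi}) \<le> 2 * (\<kappa> * n) / (w * n / 2)"
    using l q q0 by (intro frac_le) auto
  also have "\<dots> = 4 * \<kappa> / w" using n0 w by (simp add: field_simps)
  finally have 1: "2 * real l / real (card {lo..hi}) \<le> 4 * \<kappa> / w" .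
  have "P * real l + 1 + real l = (P + 1) * real l + 1" by (simp add: algebra_simps)
  also have "\<dots> \<le> (P + 1) * (\<kappa> * n) + 1" using P l by (intro add_right_mono mult_left_mono) auto
  finally have "2 * (P * real l + 1 + real l) / real m \<le> 2 * ((P + 1) * (\<kappa> * n) + 1) / (\<epsilon> * n / 2)"
    using m m0 P mult_nonneg_nonneg[of "P + 1" "\<kappa> * n"] order_trans[OF of_nat_0_le_iff l]
    by (intro frac_le) auto
  also have "\<dots> = 4 * (P + 1) * \<kappa> / \<epsilon> + 4 / (\<epsilon> * n)" using n0 \<epsilon> by (simp add: field_simps)
  also have "4 / (\<epsilon> * n) \<le> \<eta> / 2"
    using n(2) \<epsilon> \<eta> n0 by (simp add: field_simps)
  finally show "2 * real l / real (card {lo..hi}) + 2 * (P * real l + 1 + real l) / real m \<le> \<eta>"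
    using 1 \<kappa> by linarith
qed (use i in auto)

lemma well_spread_arc:
  assumes cg: "curved_graph \<phi> \<phi>1 \<phi>2 \<alpha> \<beta> c C \<Lambda>" and P: "P \<ge> 1"
    and b: "\<And>u. u \<in> {\<alpha>..\<beta>} \<Longrightarrow> \<bar>u\<bar> \<le> P \<and> \<bar>\<phi> u\<bar> \<le> P \<and> \<bar>\<phi>1 u\<bar> \<le> P"
    and w: "0 < w" "w \<le> \<beta> - \<alpha>" and \<epsilon>: "0 < \<epsilon>" "\<epsilon> \<le> 1" and \<eta>: "0 < \<eta>"
    and n: "n \<ge> 1" "n \<ge> 8 / (\<epsilon> * \<eta>)" "n \<ge> 2 / \<epsilon>" "n \<ge> 2 / w"
    and l: "real l \<le> \<kappa> * n" and \<kappa>: "4 * \<kappa> / w + 4 * (P + 1) * \<kappa> / \<epsilon> \<le> \<eta> / 2"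
    and L: "\<kappa>' * n \<le> L" "real L \<le> 2 * \<kappa>' * n" and \<kappa>': "2 * (P + 7) \<le> \<kappa>'"
  shows "well_spread l L ((P + 7) * n) \<eta> (16 * \<kappa>'\<^sup>2 / (w * \<epsilon>)) (arc \<phi> \<alpha> \<beta> n (nat \<lfloor>\<epsilon> * n\<rfloor>))"
  unfolding arc_def graph_points_eq
proof (rule well_spread_strip_scaled[OF P w(1) \<epsilon>(1) \<eta> n(1,2) l \<kappa> L \<kappa>'])
  interpret curved_graph \<phi> \<phi>1 \<phi>2 \<alpha> \<beta> c C \<Lambda> by (rule cg)
  have n0: "n > 0" using n by simp
  have I: "{\<lceil>\<alpha> * n\<rceil>..\<lfloor>\<beta> * n\<rfloor>} = graph_points \<alpha> \<beta> n" by (simp add: graph_points_eq)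
  have mem: "real_of_int i / n \<in> {\<alpha>..\<beta>}" if "i \<in> graph_points \<alpha> \<beta> n" for i
    using that n0 by (auto simp: graph_points_def field_simps)
  have "2 \<le> w * n" "2 \<le> \<epsilon> * n" using n w \<epsilon> by (auto simp: field_simps)
  show "w * n / 2 \<le> real (card {\<lceil>\<alpha> * n\<rceil>..\<lfloor>\<beta> * n\<rfloor>})"
  proof -
    have "w * n \<le> (\<beta> - \<alpha>) * n" using w n0 by (intro mult_right_mono) auto
    then show ?thesis unfolding I using card_graph_points[of \<beta> \<alpha> n] \<open>2 \<le> w * n\<close> by linarith
  qed
  show "\<epsilon> * n / 2 \<le> real (nat \<lfloor>\<epsilon> * n\<rfloor>)" using \<open>2 \<le> \<epsilon> * n\<close> by linarith
  fix i assume i: "i \<in> {\<lceil>\<alpha> * n\<rceil>..\<lfloor>\<beta> * n\<rfloor>}"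
  then have iI: "i \<in> graph_points \<alpha> \<beta> n" unfolding I .
  have "\<bar>real_of_int i / n\<bar> \<le> P" using b[OF mem[OF iI]] by simp
  then have iP: "real_of_int \<bar>i\<bar> \<le> P * n" using n0 by (simp add: abs_divide field_simps)
  then show "real_of_int \<bar>i\<bar> \<le> (P + 7) * n" using n0 by (simp add: algebra_simps)
  have "\<bar>\<phi> (real_of_int i / n)\<bar> \<le> P" using b[OF mem[OF iI]] by simp
  then have "\<bar>n * \<phi> (real_of_int i / n)\<bar> \<le> P * n" using n0 by (simp add: abs_mult mult.commute)
  then have "real_of_int \<bar>graph_floor \<phi> n i\<bar> \<le> P * n + 1" unfolding graph_floor_def by linarith
  moreover have "real (nat \<lfloor>\<epsilon> * n\<rfloor>) \<le> n"
  proof -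
    have "\<epsilon> * n \<le> 1 * n" using \<epsilon> n0 by (intro mult_right_mono) auto
    then show ?thesis using n0 by linarith
  qed
  ultimately show "real_of_int \<bar>graph_floor \<phi> n i\<bar> + real (nat \<lfloor>\<epsilon> * n\<rfloor>) \<le> (P + 7) * n"
    using n by (simp add: algebra_simps)
next
  interpret curved_graph \<phi> \<phi>1 \<phi>2 \<alpha> \<beta> c C \<Lambda> by (rule cg)
  have n0: "n > 0" using n by simp
  have mem: "real_of_int i / n \<in> {\<alpha>..\<beta>}" if "i \<in> {\<lceil>\<alpha> * n\<rceil>..\<lfloor>\<beta> * n\<rfloor>}" for i
    using that n0 unfolding graph_points_eq[symmetric] by (auto simp: graph_points_def field_simps)
  fix i j assume ij: "i \<in> {\<lceil>\<alpha> * n\<rceil>..\<lfloor>\<beta> * n\<rfloor>}" "j \<in> {\<lceil>\<alpha> * n\<rceil>..\<lfloor>\<beta> * n\<rfloor>}"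
  have "norm (\<phi> (real_of_int i / n) - \<phi> (real_of_int j / n)) \<le> P * norm (real_of_int i / n - real_of_int j / n)"
  proof (rule field_differentiable_bound[where S = "{\<alpha>..\<beta>}" and f' = \<phi>1])
    fix u assume u: "u \<in> {\<alpha>..\<beta>}"
    show "(\<phi> has_real_derivative \<phi>1 u) (at u within {\<alpha>..\<beta>})" by (rule has_field_derivative_at_within[OF \<phi>1[OF u]])
    show "norm (\<phi>1 u) \<le> P" using b[OF u] by simp
  qed (use mem ij in auto)
  then have "n * \<bar>\<phi> (real_of_int i / n) - \<phi> (real_of_int j / n)\<bar> \<le> n * (P * \<bar>real_of_int i / n - real_of_int j / n\<bar>)"
    using n0 by (intro mult_left_mono) auto
  also have "\<dots> = P * real_of_int \<bar>i - j\<bar>" using n0 by (simp add: diff_divide_distrib[symmetric] abs_divide)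
  finally have "\<bar>n * \<phi> (real_of_int i / n) - n * \<phi> (real_of_int j / n)\<bar> \<le> P * real_of_int \<bar>i - j\<bar>"
    using n0 by (simp add: right_diff_distrib[symmetric] abs_mult)
  then show "real_of_int \<bar>graph_floor \<phi> n i - graph_floor \<phi> n j\<bar> \<le> P * real_of_int \<bar>i - j\<bar> + 1"
    unfolding graph_floor_def by linarith
qed

lemma well_spread_full_box:
  assumes P: "P \<ge> 1"
    and w: "0 < w" "w \<le> 1" and \<epsilon>: "0 < \<epsilon>" "\<epsilon> \<le> 1" and \<eta>: "0 < \<eta>"
    and n: "n \<ge> 1" "n \<ge> 8 / (\<epsilon> * \<eta>)"
    and l: "real l \<le> \<kappa> * n" and \<kappa>: "4 * \<kappa> / w + 4 * (P + 1) * \<kappa> / \<epsilon> \<le> \<eta> / 2"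
    and L: "\<kappa>' * n \<le> L" "real L \<le> 2 * \<kappa>' * n" and \<kappa>': "2 * (P + 7) \<le> \<kappa>'"
  shows "well_spread l L ((P + 7) * n) \<eta> (16 * \<kappa>'\<^sup>2 / (w * \<epsilon>)) (full_box n)"
  unfolding full_box_def
proof (rule well_spread_strip_scaled[OF P w(1) \<epsilon>(1) \<eta> n(1,2) l \<kappa> L \<kappa>'])
  have k: "n \<le> \<lceil>n\<rceil>" "\<lceil>n\<rceil> \<le> n + 1" by linarith+
  have Pn: "0 \<le> P * n" using P n by simp
  have wn: "w * n \<le> 1 * n" "\<epsilon> * n \<le> 1 * n" using w \<epsilon> n by (intro mult_right_mono; simp)+
  have c: "real (card {- \<lceil>n\<rceil>..\<lceil>n\<rceil>}) = 2 * real_of_int \<lceil>n\<rceil> + 1" using n k by simp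
  show "w * n / 2 \<le> real (card {- \<lceil>n\<rceil>..\<lceil>n\<rceil>})" unfolding c using wn k n by linarith
  show "\<epsilon> * n / 2 \<le> real (nat (2 * \<lceil>n\<rceil> + 1))"
  proof -
    have "real (nat (2 * \<lceil>n\<rceil> + 1)) = 2 * real_of_int \<lceil>n\<rceil> + 1" using n k by simp
    then show ?thesis using wn k n by linarith
  qed
  fix i assume "i \<in> {- \<lceil>n\<rceil>..\<lceil>n\<rceil>}"
  then have "\<bar>i\<bar> \<le> \<lceil>n\<rceil>" by auto
  then have "real_of_int \<bar>i\<bar> \<le> real_of_int \<lceil>n\<rceil>" by linarith
  then show "real_of_int \<bar>i\<bar> \<le> (P + 7) * n" unfolding distrib_right using k n Pn by linarith
  \<comment> \<open>For \<open>n \<ge> 1\<close> this sum is at most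
    \<open>3 * n + 4 \<le> 7 * n\<close>, the origin of the 7 in \<open>P + 7\<close>.\<close>
  have "real_of_int \<bar>- \<lceil>n\<rceil>\<bar> + real (nat (2 * \<lceil>n\<rceil> + 1)) = 3 * real_of_int \<lceil>n\<rceil> + 1" using k n by simp
  then show "real_of_int \<bar>- \<lceil>n\<rceil>\<bar> + real (nat (2 * \<lceil>n\<rceil> + 1)) \<le> (P + 7) * n"
    unfolding distrib_right using k n Pn by linarith
qed (use P in simp)

text \<open>At one scale \<open>j\<close> the structured estimate passes from full boxes to thick
  arcs; the curvature estimate then passes from thick to thin arcs. The total error
  \<open>36 * c1 / 200 + c1 / 20 + c1 / 4\<close> is less than \<open>c1 / 2\<close>, so positivity
  survives.\<close>

lemma thin_config:
  fixes n :: "nat \<Rightarrow> real" and l m :: "nat \<Rightarrow> nat" and \<alpha> \<beta> :: "nat \<Rightarrow> real" and c1 :: real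
  assumes fA: "\<And>x. 0 \<le> fA x \<and> fA x \<le> 1" and fB: "\<And>x. 0 \<le> fB x \<and> fB x \<le> 1"
    and cg: "\<And>i. i < 6 \<Longrightarrow> curved_graph \<phi> \<phi>1 \<phi>2 (\<alpha> i) (\<beta> i) c C \<Lambda>" and P: "P \<ge> 1"
    and b: "\<And>i u. i < 6 \<Longrightarrow> u \<in> {\<alpha> i..\<beta> i} \<Longrightarrow> \<bar>u\<bar> \<le> P \<and> \<bar>\<phi> u\<bar> \<le> P \<and> \<bar>\<phi>1 u\<bar> \<le> P"
    and w: "0 < w" "w \<le> 1" "\<And>i. i < 6 \<Longrightarrow> w \<le> \<beta> i - \<alpha> i" and \<epsilon>: "0 < \<epsilon>" "\<epsilon> \<le> 1"
    and c1: "c1 > 0"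
    and pair: "\<And>i n (\<sigma> :: int \<Rightarrow> int \<Rightarrow> real) (y :: int). i < 6 \<Longrightarrow> n \<ge> n0 \<Longrightarrow> (\<And>d z. \<bar>\<sigma> d z\<bar> \<le> 1) \<Longrightarrow>
      (\<And>d z w. \<bar>\<sigma> d z - \<sigma> d w\<bar> \<le> K * \<bar>real_of_int z - real_of_int w\<bar>) \<Longrightarrow>
      0 \<le> y \<Longrightarrow> of_int y \<le> \<epsilon> * n \<Longrightarrow>
      \<bar>avg (graph_points (\<alpha> i) (\<beta> i) n) (\<lambda>p. avg (graph_points (\<alpha> i) (\<beta> i) n) (\<lambda>q. \<sigma> (p - q) (graph_floor \<phi> n p - graph_floor \<phi> n q + y)))
        - avg (graph_points (\<alpha> i) (\<beta> i) n) (\<lambda>p. avg (graph_points (\<alpha> i) (\<beta> i) n) (\<lambda>q. \<sigma> (p - q) (graph_floor \<phi> n p - graph_floor \<phi> n q)))\<bar> \<le> (c1 / 24)\<^sup>2 / 4"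
    and \<kappa>: "4 * \<kappa> / w + 4 * (P + 1) * \<kappa> / \<epsilon> \<le> c1 / 400"
    and \<kappa>': "2 * (P + 7) \<le> \<kappa>'" "8 * (P + 7) / \<kappa>' \<le> c1 / 200"
    and l: "\<And>j. l j > 0" "\<And>j. l j dvd l (Suc j)" "\<And>j. j < J \<Longrightarrow> real (l j) \<le> \<kappa> * n j"
      "\<And>j. j < J \<Longrightarrow> \<kappa>' * n j \<le> l (Suc j)" "\<And>j. j < J \<Longrightarrow> real (l (Suc j)) \<le> 2 * \<kappa>' * n j"
    and n: "\<And>j. j < J \<Longrightarrow> n j \<ge> 1" "\<And>j. j < J \<Longrightarrow> n j \<ge> 1600 / (\<epsilon> * c1)" "\<And>j. j < J \<Longrightarrow> n j \<ge> 2 / \<epsilon>"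
      "\<And>j. j < J \<Longrightarrow> n j \<ge> 2 / w" "\<And>j. j < J \<Longrightarrow> n j \<ge> n0"
    and J: "J > 0" "6 / real J \<le> \<delta>" and \<delta>: "(6 + 96 * (16 * \<kappa>'\<^sup>2 / (w * \<epsilon>))\<^sup>2) * \<delta> / (c1 / 200) \<le> c1 / 20"
    and m: "\<And>j. j < J \<Longrightarrow> 0 < m j" "\<And>j. j < J \<Longrightarrow> m j \<le> nat \<lfloor>\<epsilon> * n j\<rfloor>" "\<And>j. j < J \<Longrightarrow> 2 / real (m j) \<le> K"
    and dens: "\<And>j. j < J \<Longrightarrow> c1 \<le> config_avg fA fB (full_box (n j)) (full_box (n j)) (full_box (n j))
      (full_box (n j)) (full_box (n j)) (full_box (n j))"
  shows "\<exists>j<J. 0 < config_avg fA fB (arc \<phi> (\<alpha> 0) (\<beta> 0) (n j) (m j)) (arc \<phi> (\<alpha> 1) (\<beta> 1) (n j) (m j))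
     (arc \<phi> (\<alpha> 2) (\<beta> 2) (n j) (m j)) (arc \<phi> (\<alpha> 3) (\<beta> 3) (n j) (m j))
     (arc \<phi> (\<alpha> 4) (\<beta> 4) (n j) (m j)) (arc \<phi> (\<alpha> 5) (\<beta> 5) (n j) (m j))"
proof -
  define \<eta> where "\<eta> = c1 / 200"
  have \<eta>: "\<eta> > 0" using c1 by (simp add: \<eta>_def)
  define Q where "Q = 16 * \<kappa>'\<^sup>2 / (w * \<epsilon>)"
  show ?thesis
  proof (rule structured_scale[where fA = fA and fB = fB and l = l and \<eta> = \<eta> and \<theta> = \<eta> and J = J and \<delta> = \<delta>,
        OF fA fB l(1) l(2) less_imp_le[OF \<eta>] \<eta> J])
    fix j assume j: "j < J" and st: "\<And>D Q S1 S2 S3 U1 U2 U3 S1' S2' S3' U1' U2' U3'.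
      (\<And>S. S \<in> {S1, S2, S3, U1, U2, U3, S1', S2', S3', U1', U2', U3'} \<Longrightarrow> well_spread (l j) (l (Suc j)) D \<eta> Q S) \<Longrightarrow>
      \<bar>config_avg fA fB S1 S2 S3 U1 U2 U3 - config_avg fA fB S1' S2' S3' U1' U2' U3'\<bar>
        \<le> 12 * (\<eta> + \<eta> + 8 * D / l (Suc j)) + 6 * (\<delta> / \<eta>) + 6 * (16 * Q\<^sup>2 * \<delta> / \<eta>)"
    let ?M = "nat \<lfloor>\<epsilon> * n j\<rfloor>" and ?D = "(P + 7) * n j"
    let ?A = "\<lambda>i. arc \<phi> (\<alpha> i) (\<beta> i) (n j) ?M" and ?a = "\<lambda>i. arc \<phi> (\<alpha> i) (\<beta> i) (n j) (m j)"
    have n0: "n j > 0" using n(1)[OF j] by simp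
    have n8: "n j \<ge> 8 / (\<epsilon> * \<eta>)" using n(2)[OF j] by (simp add: \<eta>_def)
    have k2: "4 * \<kappa> / w + 4 * (P + 1) * \<kappa> / \<epsilon> \<le> \<eta> / 2" using \<kappa> by (simp add: \<eta>_def)
    have nA: "well_spread (l j) (l (Suc j)) ?D \<eta> Q (?A i)" if "i < 6" for i
      unfolding Q_def using well_spread_arc[OF cg[OF that] P b[OF that] w(1) w(3)[OF that] \<epsilon> \<eta> n(1)[OF j] n8 n(3)[OF j] n(4)[OF j]
        l(3)[OF j] k2 l(4)[OF j] l(5)[OF j] \<kappa>'(1)] by blast
    have nB: "well_spread (l j) (l (Suc j)) ?D \<eta> Q (full_box (n j))"
      unfolding Q_def by (rule well_spread_full_box[OF P w(1,2) \<epsilon> \<eta> n(1)[OF j] n8 l(3)[OF j] k2 l(4)[OF j] l(5)[OF j] \<kappa>'(1)])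
    let ?thick = "config_avg fA fB (?A 0) (?A 1) (?A 2) (?A 3) (?A 4) (?A 5)"
    let ?thin = "config_avg fA fB (?a 0) (?a 1) (?a 2) (?a 3) (?a 4) (?a 5)"
    let ?box = "config_avg fA fB (full_box (n j)) (full_box (n j)) (full_box (n j)) (full_box (n j)) (full_box (n j)) (full_box (n j))"
    have "\<bar>?thick - ?box\<bar> \<le> 12 * (\<eta> + \<eta> + 8 * ?D / l (Suc j)) + 6 * (\<delta> / \<eta>) + 6 * (16 * Q\<^sup>2 * \<delta> / \<eta>)"
      by (rule st) (use nA nB in auto)
    also have "\<dots> \<le> 12 * (3 * \<eta>) + c1 / 20"
    proof -
      have "2 * (P + 7) > 0" using P by simp
      then have k'0: "\<kappa>' > 0" using \<kappa>'(1) by (rule less_le_trans)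
      then have "8 * ?D / l (Suc j) \<le> 8 * ?D / (\<kappa>' * n j)"
        using l(4)[OF j] n0 P by (intro frac_le) auto
      also have "\<dots> = 8 * (P + 7) / \<kappa>'" using n0 by simp
      also have "\<dots> \<le> \<eta>" using \<kappa>'(2) by (simp add: \<eta>_def)
      finally have 1: "8 * ?D / l (Suc j) \<le> \<eta>" .
      have "6 * (\<delta> / \<eta>) + 6 * (16 * Q\<^sup>2 * \<delta> / \<eta>) = (6 + 96 * Q\<^sup>2) * \<delta> / \<eta>"
        by (simp add: add_divide_distrib distrib_right)
      also have "\<dots> \<le> c1 / 20" using \<delta> by (simp only: Q_def \<eta>_def)
      finally have 2: "6 * (\<delta> / \<eta>) + 6 * (16 * Q\<^sup>2 * \<delta> / \<eta>) \<le> c1 / 20" .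
      have "12 * (\<eta> + \<eta> + x) + y + z \<le> 12 * (3 * \<eta>) + c1 / 20" if "x \<le> \<eta>" "y + z \<le> c1 / 20" for x y z
        using that by argo
      from this[OF 1 2] show ?thesis .
    qed
    finally have 1: "\<bar>?thick - ?box\<bar> \<le> 12 * (3 * \<eta>) + c1 / 20" .
    have 2: "\<bar>?thin - ?thick\<bar> \<le> 6 * (c1 / 24)"
    proof (rule config_avg_change[OF fA fB])
      fix G :: "'x \<Rightarrow> real" and S S' assume G: "\<And>x. \<bar>G x\<bar> \<le> 1"
        and S: "(S, S') \<in> {(?a 0, ?A 0), (?a 1, ?A 1), (?a 2, ?A 2), (?a 3, ?A 3), (?a 4, ?A 4), (?a 5, ?A 5)}"
      have "\<exists>i<6. S = ?a i \<and> S' = ?A i"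
        using S by (elim insertE emptyE) (auto intro: exI[of _ "0::nat"] exI[of _ "1::nat"] exI[of _ "2::nat"] exI[of _ "3::nat"] exI[of _ "4::nat"] exI[of _ "5::nat"])
      then obtain i where i: "i < 6" "S = ?a i" "S' = ?A i" by blast
      show "E (\<lambda>x. \<bar>avg S (\<lambda>v. G (T v x)) - avg S' (\<lambda>v. G (T v x))\<bar>) \<le> c1 / 24"
        unfolding i arc_def
      proof (rule strip_L1_bound[OF finite_graph_points m(1)[OF j] m(2)[OF j] G])
        show "c1 / 24 > 0" using c1 by simp
        fix \<sigma> :: "int \<Rightarrow> int \<Rightarrow> real" and y
        assume s: "\<And>d z. \<bar>\<sigma> d z\<bar> \<le> 1" "\<And>d z w. \<bar>\<sigma> d z - \<sigma> d w\<bar> \<le> 2 / real (m j) * \<bar>real_of_int z - real_of_int w\<bar>"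
          and y: "0 \<le> y" "y < int ?M"
        have lip: "\<bar>\<sigma> d z - \<sigma> d w\<bar> \<le> K * \<bar>real_of_int z - real_of_int w\<bar>" for d z w
          using s(2)[of d z w] mult_right_mono[OF m(3)[OF j], of "\<bar>real_of_int z - real_of_int w\<bar>"] by linarith
        have y': "real_of_int y \<le> \<epsilon> * n j" using y by linarith
        show "\<bar>avg (graph_points (\<alpha> i) (\<beta> i) (n j)) (\<lambda>p. avg (graph_points (\<alpha> i) (\<beta> i) (n j)) (\<lambda>q. \<sigma> (p - q) (graph_floor \<phi> (n j) p - graph_floor \<phi> (n j) q + y)))
        - avg (graph_points (\<alpha> i) (\<beta> i) (n j)) (\<lambda>p. avg (graph_points (\<alpha> i) (\<beta> i) (n j)) (\<lambda>q. \<sigma> (p - q) (graph_floor \<phi> (n j) p - graph_floor \<phi> (n j) q)))\<bar> \<le> (c1 / 24)\<^sup>2 / 4"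
          by (rule pair[OF i(1) n(5)[OF j] s(1) lip y(1) y'])
      qed
    qed (use c1 in simp)
    have "0 < t" if "\<bar>u - v\<bar> \<le> 12 * (3 * \<eta>) + c1 / 20" "\<bar>t - u\<bar> \<le> 6 * (c1 / 24)" "c1 \<le> v" for t u v
      using that c1 unfolding \<eta>_def abs_le_iff by argo
    from this[OF 1 2 dens[OF j]] have "0 < ?thin" .
    then show ?thesis using j by blast
  qed
qed

end

text \<open>Scales are taken to be powers of two, of which the smaller always divides the larger;
  the price is the factor 2 in the upper bounds for the large scale.\<close>

lemma power_two_between:
  fixes x :: real assumes "x \<ge> 1" shows "\<exists>k. x \<le> 2 ^ k \<and> (2::real) ^ k \<le> 2 * x"
proof -
  define k where "k = (LEAST k. x \<le> 2 ^ k)"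
  have ex: "\<exists>k. x \<le> 2 ^ k" using real_arch_pow[of 2 x] by (auto intro: less_imp_le)
  have k: "x \<le> 2 ^ k" unfolding k_def by (rule LeastI_ex[OF ex])
  have "2 ^ k \<le> 2 * x"
  proof (cases k)
    case (Suc i)
    then have "\<not> x \<le> 2 ^ i" unfolding k_def by (intro not_less_Least) simp
    then show ?thesis using Suc by simp
  qed (use assms in simp)
  then show ?thesis using k by blast
qed

text \<open>The first coordinates agree exactly, \<open>h * i = t * u\<close>; the heights are off
  by the rounding and the width \<open>m\<close>.\<close>

lemma arc_near_curve:
  assumes h: "h > 0" and t: "t > 0" and v: "v \<in> arc \<phi> \<alpha> \<beta> (t / h) m"
  shows "\<exists>u\<in>{\<alpha>..\<beta>}. norm (h *\<^sub>R lat v - t *\<^sub>R vector [u, \<phi> u]) \<le> h * (real m + 1)"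
proof -
  obtain i y where v': "v = (i, y)" by (cases v)
  have i: "\<alpha> * (t / h) \<le> i" "i \<le> \<beta> * (t / h)"
    and y: "\<lfloor>t / h * \<phi> (i / (t / h))\<rfloor> \<le> y" "y < \<lfloor>t / h * \<phi> (i / (t / h))\<rfloor> + int m"
    using v by (auto simp: v' arc_def strip_def graph_points_def graph_floor_def)
  define u where "u = i / (t / h)"
  have u: "u \<in> {\<alpha>..\<beta>}" using i h t by (simp add: u_def field_simps)
  have 1: "h * i = t * u" using h t by (simp add: u_def)
  have "\<bar>y - t / h * \<phi> u\<bar> \<le> real m + 1" using y unfolding u_def[symmetric] by linarith
  then have "h * \<bar>y - t / h * \<phi> u\<bar> \<le> h * (real m + 1)" using h by (intro mult_left_mono) auto
  moreover have "h * \<bar>y - t / h * \<phi> u\<bar> = \<bar>h * y - t * \<phi> u\<bar>"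
  proof -
    have "h * y - t * \<phi> u = h * (y - t / h * \<phi> u)" using h by (simp add: field_simps)
    then show ?thesis using h by (simp add: abs_mult)
  qed
  ultimately have 2: "\<bar>h * y - t * \<phi> u\<bar> \<le> h * (real m + 1)" by simp
  have "norm (h *\<^sub>R lat v - t *\<^sub>R vector [u, \<phi> u]) \<le> h * (real m + 1)"
    using norm_vec2_le[of "h *\<^sub>R lat v - t *\<^sub>R vector [u, \<phi> u]"] 1 2 by (simp add: v')
  then show ?thesis using u by blast
qed

lemma config_near_imp_infdist:
  assumes cf: "config (near KA a h) (near KB a h) (+) x v1 v2 v3 s1 s2 s3"
    and e: "norm (h *\<^sub>R lat v1 - w1) \<le> e" "norm (h *\<^sub>R lat v2 - w2) \<le> e" "norm (h *\<^sub>R lat v3 - w3) \<le> e"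
      "norm (h *\<^sub>R lat s1 - y1) \<le> e" "norm (h *\<^sub>R lat s2 - y2) \<le> e" "norm (h *\<^sub>R lat s3 - y3) \<le> e"
    and d: "10 * h + 2 * e \<le> d"
  shows "config (\<lambda>p. infdist p KA \<le> d) (\<lambda>p. infdist p KB \<le> d) (+) (a + h *\<^sub>R lat x) w1 w2 w3 y1 y2 y3"
proof -
  have e0: "e \<ge> 0" using e(1) norm_ge_zero order_trans by blast
  have inf: "infdist q K \<le> d" if "near K a h n" "dist q (a + h *\<^sub>R lat n) \<le> 2 * e" for K q n
  proof -
    obtain p where p: "p \<in> K" "dist (a + h *\<^sub>R lat n) p \<le> 10 * h" using \<open>near K a h n\<close> by (auto simp: near_def)
    have "dist q p \<le> dist q (a + h *\<^sub>R lat n) + dist (a + h *\<^sub>R lat n) p" by (rule dist_triangle)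
    also have "\<dots> \<le> d" using p that d by linarith
    finally show ?thesis using p by (meson infdist_le2)
  qed
  have 0: "dist (a + h *\<^sub>R lat x) (a + h *\<^sub>R lat x) \<le> 2 * e" using e0 by simp
  have 1: "dist (w + (a + h *\<^sub>R lat x)) (a + h *\<^sub>R lat (v + x)) \<le> 2 * e" if "norm (h *\<^sub>R lat v - w) \<le> e" for v w
  proof -
    have "w + (a + h *\<^sub>R lat x) - (a + h *\<^sub>R lat (v + x)) = w - h *\<^sub>R lat v" by (simp add: lat_add algebra_simps)
    then show ?thesis using that e0 by (simp add: dist_norm norm_minus_commute)
  qed
  have 2: "dist (w + w' + (a + h *\<^sub>R lat x)) (a + h *\<^sub>R lat (v + v' + x)) \<le> 2 * e"
    if "norm (h *\<^sub>R lat v - w) \<le> e" "norm (h *\<^sub>R lat v' - w') \<le> e" for v w v' w'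
  proof -
    have "w + w' + (a + h *\<^sub>R lat x) - (a + h *\<^sub>R lat (v + v' + x)) = (w - h *\<^sub>R lat v) + (w' - h *\<^sub>R lat v')"
      by (simp add: lat_add algebra_simps)
    also have "norm \<dots> \<le> e + e" using that by (intro norm_triangle_mono) (simp_all add: norm_minus_commute)
    finally show ?thesis by (simp add: dist_norm)
  qed
  show ?thesis using cf e unfolding config_def
    by (intro conjI) (erule inf[OF _ 0] inf[OF _ 1] inf[OF _ 2] conjE | assumption | blast intro: inf 0 1 2)+
qed

section \<open>Transfer of the density to the torus\<close>

lemma cell_in_full_box:
  assumes h: "h > 0" and v: "v \<in> square t" shows "cell h v \<in> full_box (t / h)"
proof -
  have b: "- t \<le> v $ i" "v $ i \<le> t" for i using v by (auto simp: square_def mem_box_cart)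
  have *: "- \<lceil>t / h\<rceil> \<le> \<lfloor>v $ i / h\<rfloor> \<and> \<lfloor>v $ i / h\<rfloor> \<le> \<lceil>t / h\<rceil>" for i
  proof -
    have "- (t / h) \<le> v $ i / h" "v $ i / h \<le> t / h" using b[of i] h by (simp_all add: field_simps)
    then show ?thesis by linarith
  qed
  show ?thesis using *[of 1] *[of 2] by (auto simp: full_box_def strip_def cell_def)
qed

lemma finite_full_box: "finite (full_box n)" by (simp add: full_box_def finite_strip)

lemma card_full_box: "n \<ge> 0 \<Longrightarrow> real (card (full_box n)) = (2 * real_of_int \<lceil>n\<rceil> + 1)\<^sup>2"
proof -
  assume "n \<ge> 0"
  then have "\<lceil>n\<rceil> \<ge> 0" by simp
  then show ?thesis by (simp add: full_box_def card_strip power2_eq_square)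
qed

text \<open>Measured from the origin \<open>z - vec (2 * R)\<close>, the window occupies the
  coordinates from \<open>R\<close> to \<open>4 * R\<close>. A torus of side at least
  \<open>6 * R\<close> leaves a margin of about \<open>R\<close> below it and \<open>2 * R\<close>
  above it.\<close>

lemma near_window:
  assumes n: "near K (z - vec (2 * R)) h y" and K: "K \<subseteq> cbox (z - vec R) (z + vec (2 * R))"
  shows "R - 10 * h \<le> h * real_of_int (fst y)" "h * real_of_int (fst y) \<le> 4 * R + 10 * h" "R - 10 * h \<le> h * real_of_int (snd y)" "h * real_of_int (snd y) \<le> 4 * R + 10 * h"
proof -
  obtain p where p: "p \<in> K" "dist (z - vec (2 * R) + h *\<^sub>R lat y) p \<le> 10 * h" using n by (auto simp: near_def)
  have c: "z $ i - R \<le> p $ i \<and> p $ i \<le> z $ i + 2 * R" for i using p(1) K by (auto simp: mem_box_cart)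
  have d: "\<bar>z $ i - 2 * R + h * lat y $ i - p $ i\<bar> \<le> 10 * h" for i
    using component_le_norm_cart[of "z - vec (2 * R) + h *\<^sub>R lat y - p" i] p(2) by (simp add: dist_norm)
  show "R - 10 * h \<le> h * real_of_int (fst y)" "h * real_of_int (fst y) \<le> 4 * R + 10 * h" "R - 10 * h \<le> h * real_of_int (snd y)" "h * real_of_int (snd y) \<le> 4 * R + 10 * h"
    using c[of 1] d[of 1] c[of 2] d[of 2] by (simp_all add: abs_le_iff)
qed

lemma in_torusI:
  fixes h R :: real
  assumes h: "h > 0" and N: "6 * R \<le> h * of_int N"
    and y: "0 \<le> h * real_of_int (fst y)" "h * real_of_int (fst y) < 6 * R" "0 \<le> h * real_of_int (snd y)" "h * real_of_int (snd y) < 6 * R"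
  shows "y \<in> torus N"
proof -
  have "0 \<le> real_of_int (fst y)" "0 \<le> real_of_int (snd y)" using y h by (simp_all add: zero_le_mult_iff)
  moreover have "h * real_of_int (fst y) < h * of_int N" "h * real_of_int (snd y) < h * of_int N" using y N by linarith+
  then have "real_of_int (fst y) < of_int N" "real_of_int (snd y) < of_int N" using h by simp_all
  ultimately show ?thesis by (cases y) (simp add: torus_def)
qed

text \<open>Half of the density goes to the exceptional open set, as
  \<open>10 * (c / 20) = c / 2\<close>. Normalization loses at most \<open>7\<^sup>2\<close> from
  the side of the torus and \<open>2 ^ 12\<close> from boxes of side up to \<open>4 * t\<close>
  instead of \<open>2 * t\<close>. The product is 200704, and 819200 exceeds twice this
  number.\<close>

lemma torus_density:
  assumes h: "0 < h" "20 * h \<le> R" "2 * h \<le> 1" and t: "t \<ge> 1" "4 * t \<le> R" and c: "c > 0"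
    and A: "A \<inter> W \<subseteq> KA \<union> O'" and B: "B \<inter> W \<subseteq> KB \<union> O'" and W: "W = cbox (z - vec R) (z + vec (2 * R))"
    and K: "KA \<subseteq> W" "KB \<subseteq> W" and O': "open O'" "emeasure lborel O' \<le> ennreal (c / 20)"
    and N: "6 * R \<le> h * of_int N" "h * of_int N \<le> 7 * R" and avg: "c \<le> vc_average A B R z t"
  shows "c / 819200 \<le> shift_system.config_avg (torus N) (torus_shift N)
     (\<lambda>x. of_bool (near KA (z - vec (2 * R)) h x)) (\<lambda>x. of_bool (near KB (z - vec (2 * R)) h x))
     (full_box (t / h)) (full_box (t / h)) (full_box (t / h)) (full_box (t / h)) (full_box (t / h)) (full_box (t / h))"
proof -
  let ?a = "z - vec (2 * R)" and ?F = "full_box (t / h)"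
  have R0: "R \<ge> 1" "R > 0" using t by auto
  have "0 < h * of_int N" using N(1) R0 by linarith
  then have N0: "N > 0" using h by (simp add: zero_less_mult_iff)
  interpret shift_system "torus N" "torus_shift N" by (rule torus_shift_system[OF N0])
  define G where "G = config_avg (\<lambda>x. of_bool (near KA ?a h x)) (\<lambda>x. of_bool (near KB ?a h x)) ?F ?F ?F ?F ?F ?F"
  have inW: "y \<in> torus N" if "near KA ?a h y \<or> near KB ?a h y" for y
  proof -
    from that obtain K' where "near K' ?a h y" "K' \<subseteq> cbox (z - vec R) (z + vec (2 * R))" using K W by blast
    note nw = near_window[OF this]
    show ?thesis by (rule in_torusI[OF h(1) N(1)]) (use nw h R0 in linarith)+
  qed
  have fN: "finite (torus N)" by (rule finite_X)
  have le: "vc_average A B R z t * ((2 * t) ^ 12 * R\<^sup>2) \<le>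
    h ^ 14 * (\<Sum>(n, m1, m2, m3, k1, k2, k3)\<in>torus N \<times> ?F \<times> ?F \<times> ?F \<times> ?F \<times> ?F \<times> ?F.
       of_bool (config (near KA ?a h) (near KB ?a h) (+) n m1 m2 m3 k1 k2 k3))
    + 10 * (c / 20) * ((2 * t) ^ 12 * R\<^sup>2)"
  proof (rule discrete_lower_bound[OF h(1) A B O' _ R0(1) t(1) _ fN _ finite_full_box])
    show "0 \<le> c / 20" using c by simp
    fix v assume "v \<in> square t" then show "cell h v \<in> ?F" by (rule cell_in_full_box[OF h(1)])
  next
    fix x u w assume x: "x \<in> cbox z (z + vec R)" and u: "u \<in> square t" and w: "w \<in> square t"
    have "z $ i \<le> x $ i \<and> x $ i \<le> z $ i + R \<and> - t \<le> u $ i \<and> u $ i \<le> t \<and> - t \<le> w $ i \<and> w $ i \<le> t" for i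
      using x u w by (auto simp: square_def mem_box_cart)
    then have b: "z $ i \<le> x $ i" "x $ i \<le> z $ i + R" "- t \<le> u $ i" "u $ i \<le> t" "- t \<le> w $ i" "w $ i \<le> t" for i by auto
    have "z $ i - R \<le> x $ i \<and> x $ i \<le> z $ i + 2 * R \<and> z $ i - R \<le> x $ i + u $ i \<and> x $ i + u $ i \<le> z $ i + 2 * R
      \<and> z $ i - R \<le> x $ i + u $ i + w $ i \<and> x $ i + u $ i + w $ i \<le> z $ i + 2 * R" for i
      using b[of i] t by linarith
    then show "x \<in> W \<and> x + u \<in> W \<and> x + u + w \<in> W" unfolding W by (auto simp: mem_box_cart)
  next
    fix x assume x: "x \<in> cbox z (z + vec R)"
    have b: "z $ i \<le> x $ i" "x $ i \<le> z $ i + R" for i using x by (auto simp: mem_box_cart)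
    show "cell h (x - ?a) \<in> torus N"
    proof (rule in_torusI[OF h(1) N(1)])
      have lo: "R \<le> h * lat (cell h (x - ?a)) $ 1" "R \<le> h * lat (cell h (x - ?a)) $ 2"
        using cell_bounds[OF h(1), of "x - ?a"] b[of 1] b[of 2] h R0 by simp_all
      then show "0 \<le> h * real_of_int (fst (cell h (x - ?a)))" "0 \<le> h * real_of_int (snd (cell h (x - ?a)))" using R0 by simp_all
      show "h * real_of_int (fst (cell h (x - ?a))) < 6 * R" "h * real_of_int (snd (cell h (x - ?a))) < 6 * R"
        using cell_bounds[OF h(1), of "x - ?a"] b[of 1] b[of 2] h R0 by simp_all
    qed
  qed
  have "c * ((2 * t) ^ 12 * R\<^sup>2) \<le> vc_average A B R z t * ((2 * t) ^ 12 * R\<^sup>2)"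
    using avg by (intro mult_right_mono) auto
  also note le
  also have "(\<Sum>(n, m1, m2, m3, k1, k2, k3)\<in>torus N \<times> ?F \<times> ?F \<times> ?F \<times> ?F \<times> ?F \<times> ?F.
       of_bool (config (near KA ?a h) (near KB ?a h) (+) n m1 m2 m3 k1 k2 k3))
    \<le> (\<Sum>(n, m1, m2, m3, k1, k2, k3)\<in>torus N \<times> ?F \<times> ?F \<times> ?F \<times> ?F \<times> ?F \<times> ?F.
       of_bool (config (near KA ?a h) (near KB ?a h) (torus_shift N) n m1 m2 m3 k1 k2 k3) :: real)"
    by (intro sum_mono) (auto simp: config_torus inW)
  also have "\<dots> = G * (real (card (torus N)) * real (card ?F) ^ 6)"
    unfolding G_def by (rule config_avg_sum[symmetric])
  finally have 1: "c / 2 * ((2 * t) ^ 12 * R\<^sup>2) \<le> h ^ 14 * (G * (real (card (torus N)) * real (card ?F) ^ 6))"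
    using h by (simp add: algebra_simps)
  let ?k = "2 * real_of_int \<lceil>t / h\<rceil> + 1"
  have G0: "0 \<le> G" unfolding G_def config_avg_of_bool by (intro avg_nonneg) simp
  have cT: "real (card (torus N)) = (of_int N)\<^sup>2" using N0 by (simp add: torus_def card_cartesian_product power2_eq_square)
  have cF: "real (card ?F) = ?k\<^sup>2" using h t by (intro card_full_box) simp
  have hk: "0 \<le> h * ?k" "h * ?k \<le> 2 * (2 * t)"
  proof -
    have th: "0 \<le> t / h" using h t by simp
    have "?k \<ge> 0" using th by linarith
    then show "0 \<le> h * ?k" using h by simp
    have "?k \<le> 2 * (t / h) + 3" by linarith
    then have "h * ?k \<le> h * (2 * (t / h) + 3)" using h by (intro mult_left_mono) auto
    also have "\<dots> = 2 * t + 3 * h" using h by (simp add: algebra_simps)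
    also have "\<dots> \<le> 2 * (2 * t)" using h t R0 by linarith
    finally show "h * ?k \<le> 2 * (2 * t)" .
  qed
  have "h ^ 14 * (G * (real (card (torus N)) * real (card ?F) ^ 6)) = G * ((h * of_int N)\<^sup>2 * (h * ?k) ^ 12)"
    unfolding cT cF by (simp add: power_mult_distrib power_mult[symmetric])
  also have "\<dots> \<le> G * ((7 * R)\<^sup>2 * (2 * (2 * t)) ^ 12)"
  proof (rule mult_left_mono[OF mult_mono G0])
    show "(h * of_int N)\<^sup>2 \<le> (7 * R)\<^sup>2" using h N0 by (intro power_mono[OF N(2)]) simp
    show "(h * ?k) ^ 12 \<le> (2 * (2 * t)) ^ 12" by (rule power_mono[OF hk(2,1)])
  qed (use hk in auto)
  also have "\<dots> = G * (200704 * ((2 * t) ^ 12 * R\<^sup>2))" by (simp add: power_mult_distrib)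
  finally have "c / 2 * ((2 * t) ^ 12 * R\<^sup>2) \<le> G * (200704 * ((2 * t) ^ 12 * R\<^sup>2))"
    by (rule order_trans[OF 1])
  then have "c / 2 * ((2 * t) ^ 12 * R\<^sup>2) \<le> (G * 200704) * ((2 * t) ^ 12 * R\<^sup>2)" by (simp only: mult.assoc)
  moreover have "(2 * t) ^ 12 * R\<^sup>2 > 0" using t R0 by simp
  ultimately have "c / 2 \<le> G * 200704" by (rule mult_right_le_imp_le)
  then show ?thesis unfolding G_def[symmetric] using c by simp
qed

text \<open>The spacing is chosen here, depending on \<open>e\<close>, with the number of dilations,
  the dilations themselves and the window already given. The index \<open>j\<close> may still vary
  with \<open>e\<close>.\<close>

lemma approx_at_scale:
  fixes t :: "nat \<Rightarrow> real" and \<alpha> \<beta> :: "nat \<Rightarrow> real" and c1 :: real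
  assumes cg: "\<And>i. i < 6 \<Longrightarrow> curved_graph \<phi> \<phi>1 \<phi>2 (\<alpha> i) (\<beta> i) c' C \<Lambda>" and P: "P \<ge> 1"
    and b: "\<And>i u. i < 6 \<Longrightarrow> u \<in> {\<alpha> i..\<beta> i} \<Longrightarrow> \<bar>u\<bar> \<le> P \<and> \<bar>\<phi> u\<bar> \<le> P \<and> \<bar>\<phi>1 u\<bar> \<le> P"
    and w: "0 < w" "w \<le> 1" "\<And>i. i < 6 \<Longrightarrow> w \<le> \<beta> i - \<alpha> i" and \<epsilon>: "0 < \<epsilon>" "\<epsilon> \<le> 1"
    and c: "c > 0" "c1 = c / 819200"
    and pair: "\<And>i n (\<sigma> :: int \<Rightarrow> int \<Rightarrow> real) (y :: int). i < 6 \<Longrightarrow> n \<ge> n0 \<Longrightarrow> (\<And>d z. \<bar>\<sigma> d z\<bar> \<le> 1) \<Longrightarrow>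
      (\<And>d z w. \<bar>\<sigma> d z - \<sigma> d w\<bar> \<le> K * \<bar>real_of_int z - real_of_int w\<bar>) \<Longrightarrow>
      0 \<le> y \<Longrightarrow> of_int y \<le> \<epsilon> * n \<Longrightarrow>
      \<bar>avg (graph_points (\<alpha> i) (\<beta> i) n) (\<lambda>p. avg (graph_points (\<alpha> i) (\<beta> i) n) (\<lambda>q. \<sigma> (p - q) (graph_floor \<phi> n p - graph_floor \<phi> n q + y)))
        - avg (graph_points (\<alpha> i) (\<beta> i) n) (\<lambda>p. avg (graph_points (\<alpha> i) (\<beta> i) n) (\<lambda>q. \<sigma> (p - q) (graph_floor \<phi> n p - graph_floor \<phi> n q)))\<bar> \<le> (c1 / 24)\<^sup>2 / 4"
    and K: "K > 0" and n0: "n0 > 0"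
    and \<kappa>: "\<kappa> > 0" "4 * \<kappa> / w + 4 * (P + 1) * \<kappa> / \<epsilon> \<le> c1 / 400" "\<kappa> \<le> \<kappa>'"
    and \<kappa>': "2 * (P + 7) \<le> \<kappa>'" "8 * (P + 7) / \<kappa>' \<le> c1 / 200"
    and J: "J > 0" "6 / real J \<le> \<delta>" and \<delta>: "(6 + 96 * (16 * \<kappa>'\<^sup>2 / (w * \<epsilon>))\<^sup>2) * \<delta> / (c1 / 200) \<le> c1 / 20"
    and t: "\<And>j. 1 \<le> t j" "\<And>j. 2 * \<kappa>' * t j \<le> \<kappa> * t (Suc j)"
    and R: "\<And>j. j < J \<Longrightarrow> 4 * (P + 7) * t j \<le> R"
    and A: "A \<inter> W \<subseteq> KA \<union> O'" and B: "B \<inter> W \<subseteq> KB \<union> O'" and W: "W = cbox (z - vec R) (z + vec (2 * R))"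
    and KW: "KA \<subseteq> W" "KB \<subseteq> W" and O': "open O'" "emeasure lborel O' \<le> ennreal (c / 20)"
    and avg: "\<And>j. j < J \<Longrightarrow> c \<le> vc_average A B R z (t j)" and e: "e > 0"
  defines "V \<equiv> \<lambda>j i. (\<lambda>u. t j *\<^sub>R (vector [u, \<phi> u] :: real^2)) ` {\<alpha> i..\<beta> i}"
  shows "\<exists>j<J. KA \<noteq> {} \<and> KB \<noteq> {} \<and> (\<exists>x. \<exists>v1\<in>V j 0. \<exists>v2\<in>V j 1. \<exists>v3\<in>V j 2. \<exists>s1\<in>V j 3. \<exists>s2\<in>V j 4. \<exists>s3\<in>V j 5.
    config (\<lambda>p. infdist p KA \<le> e) (\<lambda>p. infdist p KB \<le> e) (+) x v1 v2 v3 s1 s2 s3)"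
proof -
  have c1: "c1 > 0" using c by simp
  have t0: "t j > 0" for j using t(1)[of j] by linarith
  have "2 * (P + 7) > 0" using P by simp
  then have k'0: "\<kappa>' > 0" using \<kappa>'(1) by (rule less_le_trans)
  have k'1: "\<kappa>' \<ge> 1" using \<kappa>'(1) P by argo
  have tR: "32 * t j \<le> R" if "j < J" for j
  proof -
    have "32 * t j \<le> 4 * (P + 7) * t j" using P t0[of j] by (intro mult_right_mono) auto
    then show ?thesis using R[OF that] by linarith
  qed
  have R1: "R \<ge> 32" using tR[OF J(1)] t(1)[of 0] by linarith
  \<comment> \<open>In the plane, the thin strips have width about \<open>\<epsilon>' * t j\<close>,
    which is at most \<open>e / 8\<close> because \<open>t j \<le> R\<close>. The condition
    \<open>2 / real (m j) \<le> K\<close> is met afterwards by a small spacing.\<close>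
  define \<epsilon>' where "\<epsilon>' = min (\<epsilon> / 2) (e / (8 * R))"
  have \<epsilon>': "\<epsilon>' > 0" "\<epsilon>' \<le> \<epsilon> / 2" "\<epsilon>' * (8 * R) \<le> e"
  proof -
    show "\<epsilon>' > 0" "\<epsilon>' \<le> \<epsilon> / 2" using \<epsilon> e R1 by (auto simp: \<epsilon>'_def)
    have "\<epsilon>' \<le> e / (8 * R)" by (simp add: \<epsilon>'_def)
    then show "\<epsilon>' * (8 * R) \<le> e" using R1 by (simp add: pos_le_divide_eq)
  qed
  \<comment> \<open>A common lower bound for all \<open>n j = t j / h\<close>; each summand meets
    one of the conditions on \<open>n j\<close> or on \<open>h\<close>.\<close>
  define X where "X = 100 + 1600 / (\<epsilon> * c1) + 4 / \<epsilon> + 2 / w + n0 + 1 / \<kappa> + 2 / (\<epsilon>' * K) + 56 / e"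
  have X: "100 \<le> X" "1600 / (\<epsilon> * c1) \<le> X" "4 / \<epsilon> \<le> X" "2 / w \<le> X" "n0 \<le> X" "1 / \<kappa> \<le> X" "2 / (\<epsilon>' * K) \<le> X" "56 / e \<le> X"
  proof -
    have "0 < 1600 / (\<epsilon> * c1)" "0 < 4 / \<epsilon>" "0 < 2 / w" "0 < 1 / \<kappa>" "0 < 2 / (\<epsilon>' * K)" "0 < 56 / e"
      using \<epsilon> c1 w \<kappa> \<epsilon>' K e by simp_all
    then show "100 \<le> X" "1600 / (\<epsilon> * c1) \<le> X" "4 / \<epsilon> \<le> X" "2 / w \<le> X" "n0 \<le> X" "1 / \<kappa> \<le> X" "2 / (\<epsilon>' * K) \<le> X" "56 / e \<le> X"
      using n0 unfolding X_def by linarith+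
  qed
  define h where "h = 1 / X"
  have h: "h > 0" "h \<le> 1 / 100" "h \<le> e / 56"
  proof -
    show "h > 0" "h \<le> 1 / 100" using X(1) by (simp_all add: h_def field_simps)
    show "h \<le> e / 56" using X(1,8) e by (simp add: h_def field_simps)
  qed
  define n where "n j = t j / h" for j
  have nX: "n j \<ge> X" for j
  proof -
    have "1 * X \<le> t j * X" using t(1)[of j] X(1) by (intro mult_right_mono) auto
    then show ?thesis by (simp add: n_def h_def)
  qed
  have npos: "n j > 0" for j using nX[of j] X(1) by linarith
  have hn: "h * n j = t j" for j using h by (simp add: n_def)
  have "\<exists>k. \<kappa>' * n j \<le> 2 ^ k \<and> (2::real) ^ k \<le> 2 * (\<kappa>' * n j)" for j
  proof (rule power_two_between)
    have "1 * 1 \<le> \<kappa>' * n j" using k'1 nX[of j] X(1) by (intro mult_mono) auto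
    then show "1 \<le> \<kappa>' * n j" by simp
  qed
  then obtain ex where ex: "\<And>j. \<kappa>' * n j \<le> 2 ^ ex j" "\<And>j. (2::real) ^ ex j \<le> 2 * (\<kappa>' * n j)" by metis
  \<comment> \<open>\<open>l (Suc j)\<close> is a power of two between
    \<open>\<kappa>' * n j\<close> and twice that. Sparsity of the dilations puts it below
    \<open>\<kappa> * n (Suc j)\<close>, so it is the large scale for \<open>j\<close> and also the
    small one for \<open>Suc j\<close>. The first small scale is 1.\<close>
  define E where "E j = (case j of 0 \<Rightarrow> 0 | Suc i \<Rightarrow> ex i)" for j
  define l :: "nat \<Rightarrow> nat" where "l j = 2 ^ E j" for j
  have ES: "E (Suc j) = ex j" for j by (simp add: E_def)
  have lk: "real (l j) \<le> \<kappa> * n j" for j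
  proof (cases j)
    case 0
    have "1 / \<kappa> \<le> n j" using nX[of j] X(6) by linarith
    then show ?thesis using 0 \<kappa> by (simp add: l_def E_def field_simps)
  next
    case (Suc i)
    have "real (l j) \<le> 2 * (\<kappa>' * n i)" using ex(2)[of i] by (simp add: l_def Suc ES)
    also have "\<dots> = (2 * \<kappa>' * t i) / h" by (simp add: n_def)
    also have "\<dots> \<le> (\<kappa> * t j) / h" unfolding Suc by (rule divide_right_mono[OF t(2)]) (use h in simp)
    finally show ?thesis by (simp add: n_def)
  qed
  have ldvd: "l j dvd l (Suc j)" for j
  proof -
    have "real (l j) \<le> \<kappa> * n j" by (rule lk)
    also have "\<dots> \<le> \<kappa>' * n j" using \<kappa>(3) npos[of j] by (intro mult_right_mono) auto
    also have "\<dots> \<le> real (l (Suc j))" using ex(1)[of j] by (simp add: l_def ES)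
    finally have "(2::real) ^ E j \<le> 2 ^ E (Suc j)" by (simp add: l_def)
    then have "E j \<le> E (Suc j)" by simp
    then show ?thesis unfolding l_def by (rule le_imp_power_dvd)
  qed
  define N where "N = \<lceil>6 * R / h\<rceil>"
  have N: "6 * R \<le> h * of_int N" "h * of_int N \<le> 7 * R"
  proof -
    have le: "6 * R / h \<le> of_int N" "of_int N \<le> 6 * R / h + 1" unfolding N_def by linarith+
    have "h * (6 * R / h) \<le> h * of_int N" by (rule mult_left_mono[OF le(1)]) (use h in simp)
    then show "6 * R \<le> h * of_int N" using h by simp
    have "h * of_int N \<le> h * (6 * R / h + 1)" by (rule mult_left_mono[OF le(2)]) (use h in simp)
    also have "\<dots> = 6 * R + h" using h by (simp add: distrib_left)
    finally show "h * of_int N \<le> 7 * R" using h R1 by linarith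
  qed
  have "0 < h * of_int N" using N(1) R1 by linarith
  then have N0: "N > 0" using h by (simp add: zero_less_mult_iff)
  interpret shift_system "torus N" "torus_shift N" by (rule torus_shift_system[OF N0])
  let ?a = "z - vec (2 * R)"
  let ?fA = "\<lambda>x. of_bool (near KA ?a h x) :: real" and ?fB = "\<lambda>x. of_bool (near KB ?a h x) :: real"
  define m where "m j = nat \<lceil>\<epsilon>' * n j\<rceil>" for j
  have m1: "\<epsilon>' * n j \<le> real (m j)" "real (m j) \<le> \<epsilon>' * n j + 1" for j
  proof -
    have "0 \<le> \<epsilon>' * n j" using \<epsilon>'(1) npos[of j] by simp
    then show "\<epsilon>' * n j \<le> real (m j)" "real (m j) \<le> \<epsilon>' * n j + 1" unfolding m_def by linarith+
  qed
  have lpos: "0 < l j" for j by (simp add: l_def)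
  have "\<exists>j<J. 0 < config_avg ?fA ?fB (arc \<phi> (\<alpha> 0) (\<beta> 0) (n j) (m j)) (arc \<phi> (\<alpha> 1) (\<beta> 1) (n j) (m j))
     (arc \<phi> (\<alpha> 2) (\<beta> 2) (n j) (m j)) (arc \<phi> (\<alpha> 3) (\<beta> 3) (n j) (m j))
     (arc \<phi> (\<alpha> 4) (\<beta> 4) (n j) (m j)) (arc \<phi> (\<alpha> 5) (\<beta> 5) (n j) (m j))"
  proof (rule thin_config[where l = l, OF _ _ cg P b w \<epsilon> c1 pair \<kappa>(2) \<kappa>' lpos ldvd lk _ _ _ _ _ _ _ J \<delta>])
    fix j assume j: "j < J"
    show "\<kappa>' * n j \<le> real (l (Suc j))" "real (l (Suc j)) \<le> 2 * \<kappa>' * n j" using ex[of j] by (simp_all add: l_def ES)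
    show "1 \<le> n j" "1600 / (\<epsilon> * c1) \<le> n j" "2 / w \<le> n j" "n0 \<le> n j" using nX[of j] X by linarith+
    have e4: "4 / \<epsilon> \<le> n j" using nX[of j] X by linarith
    then have e4': "4 \<le> \<epsilon> * n j" using \<epsilon> by (simp add: field_simps)
    show "2 / \<epsilon> \<le> n j"
    proof -
      have "2 / \<epsilon> \<le> 4 / \<epsilon>" using \<epsilon> by (intro divide_right_mono) auto
      then show ?thesis using e4 by linarith
    qed
    have em: "\<epsilon>' * n j > 0" using \<epsilon>'(1) npos[of j] by simp
    show "0 < m j" using m1(1)[of j] em by (cases "m j") auto
    show "m j \<le> nat \<lfloor>\<epsilon> * n j\<rfloor>"
    proof -
      have "\<epsilon>' * n j \<le> \<epsilon> / 2 * n j" using \<epsilon>'(2) npos[of j] by (intro mult_right_mono) auto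
      then have "real (m j) \<le> \<epsilon> * n j - 1" using m1(2)[of j] e4' by simp
      then have "int (m j) \<le> \<lfloor>\<epsilon> * n j\<rfloor>" by linarith
      then show ?thesis by linarith
    qed
    show "2 / real (m j) \<le> K"
    proof -
      have "2 / (\<epsilon>' * K) \<le> n j" using nX[of j] X by linarith
      then have "2 / (\<epsilon>' * n j) \<le> K" using \<epsilon>'(1) K npos[of j] by (simp add: field_simps)
      moreover have "2 / real (m j) \<le> 2 / (\<epsilon>' * n j)" using m1(1)[of j] em by (intro divide_left_mono) auto
      ultimately show ?thesis by linarith
    qed
    show "c1 \<le> config_avg ?fA ?fB (full_box (n j)) (full_box (n j)) (full_box (n j)) (full_box (n j)) (full_box (n j)) (full_box (n j))"
      unfolding c(2) n_def
      by (rule torus_density[OF h(1) _ _ t(1) _ c(1) A B W KW O' N avg[OF j]]) (use h R1 tR[OF j] t0[of j] in auto)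
  qed auto
  then obtain j where j: "j < J" "0 < config_avg ?fA ?fB (arc \<phi> (\<alpha> 0) (\<beta> 0) (n j) (m j)) (arc \<phi> (\<alpha> 1) (\<beta> 1) (n j) (m j))
     (arc \<phi> (\<alpha> 2) (\<beta> 2) (n j) (m j)) (arc \<phi> (\<alpha> 3) (\<beta> 3) (n j) (m j))
     (arc \<phi> (\<alpha> 4) (\<beta> 4) (n j) (m j)) (arc \<phi> (\<alpha> 5) (\<beta> 5) (n j) (m j))" by blast
  from config_exists[OF j(2)] obtain x v1 v2 v3 s1 s2 s3 where
    v: "v1 \<in> arc \<phi> (\<alpha> 0) (\<beta> 0) (n j) (m j)" "v2 \<in> arc \<phi> (\<alpha> 1) (\<beta> 1) (n j) (m j)"
     "v3 \<in> arc \<phi> (\<alpha> 2) (\<beta> 2) (n j) (m j)" "s1 \<in> arc \<phi> (\<alpha> 3) (\<beta> 3) (n j) (m j)"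
     "s2 \<in> arc \<phi> (\<alpha> 4) (\<beta> 4) (n j) (m j)" "s3 \<in> arc \<phi> (\<alpha> 5) (\<beta> 5) (n j) (m j)"
    and cf: "config (near KA ?a h) (near KB ?a h) (torus_shift N) x v1 v2 v3 s1 s2 s3" by blast
  let ?d = "h * (real (m j) + 1)"
  have dle: "?d \<le> \<epsilon>' * t j + 2 * h"
  proof -
    have "?d \<le> h * (\<epsilon>' * n j + 2)" using m1(2)[of j] h by (intro mult_left_mono) auto
    also have "\<dots> = \<epsilon>' * (h * n j) + 2 * h" by (simp add: algebra_simps)
    finally show ?thesis by (simp add: hn)
  qed
  have close: "\<exists>u\<in>{\<alpha> i..\<beta> i}. norm (h *\<^sub>R lat v - t j *\<^sub>R vector [u, \<phi> u]) \<le> ?d"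
    if "v \<in> arc \<phi> (\<alpha> i) (\<beta> i) (n j) (m j)" for i v
    using arc_near_curve[OF h(1) t0[of j]] that unfolding n_def by blast
  have size: "\<bar>h * real_of_int (fst v)\<bar> \<le> (P + 2) * t j \<and> \<bar>h * real_of_int (snd v)\<bar> \<le> (P + 2) * t j"
    if i: "i < 6" "v \<in> arc \<phi> (\<alpha> i) (\<beta> i) (n j) (m j)" for i v
  proof -
    obtain u where u: "u \<in> {\<alpha> i..\<beta> i}" "norm (h *\<^sub>R lat v - t j *\<^sub>R vector [u, \<phi> u]) \<le> ?d" using close[OF i(2)] by blast
    have "\<epsilon>' * t j \<le> 1 * t j" using \<epsilon>' \<epsilon> t0[of j] by (intro mult_right_mono) auto
    then have d2: "?d \<le> 2 * t j" using dle h t(1)[of j] by linarith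
    have "\<bar>h * real_of_int (fst v) - t j * u\<bar> \<le> ?d" "\<bar>h * real_of_int (snd v) - t j * \<phi> u\<bar> \<le> ?d"
      using component_le_norm_cart[of "h *\<^sub>R lat v - t j *\<^sub>R vector [u, \<phi> u]" 1]
        component_le_norm_cart[of "h *\<^sub>R lat v - t j *\<^sub>R vector [u, \<phi> u]" 2] u(2) by simp_all
    moreover have "\<bar>t j * u\<bar> \<le> t j * P" "\<bar>t j * \<phi> u\<bar> \<le> t j * P"
      using b[OF i(1) u(1)] t0[of j] by (auto simp: abs_mult intro: mult_left_mono)
    ultimately have "\<bar>h * real_of_int (fst v)\<bar> \<le> t j * P + 2 * t j" "\<bar>h * real_of_int (snd v)\<bar> \<le> t j * P + 2 * t j"
      using d2 by linarith+
    then show ?thesis by (simp add: algebra_simps)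
  qed
  have "near KB ?a h x" using cf by (simp add: config_def)
  note xw = near_window[OF this KW(2)[unfolded W]]
  have PR: "2 * ((P + 2) * t j) \<le> R / 2"
  proof -
    have "4 * ((P + 2) * t j) \<le> 4 * (P + 7) * t j" using t0[of j] by (simp add: algebra_simps)
    also have "\<dots> \<le> R" by (rule R[OF j(1)])
    finally show ?thesis by simp
  qed
  have P0: "0 \<le> (P + 2) * t j" using P t0[of j] by simp
  define small where "small v \<longleftrightarrow> \<bar>h * real_of_int (fst v)\<bar> \<le> (P + 2) * t j \<and> \<bar>h * real_of_int (snd v)\<bar> \<le> (P + 2) * t j" for v :: "int \<times> int"
  have inT2: "v + v' + x \<in> torus N" if "small v" "small v'" for v v'
  proof (rule in_torusI[OF h(1) N(1)])
    have s: "\<bar>h * real_of_int (fst v) + h * real_of_int (fst v')\<bar> \<le> R / 2" "\<bar>h * real_of_int (snd v) + h * real_of_int (snd v')\<bar> \<le> R / 2"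
      using that PR unfolding small_def by linarith+
    have eq: "h * real_of_int (fst (v + v' + x)) = (h * real_of_int (fst v) + h * real_of_int (fst v')) + h * real_of_int (fst x)"
      "h * real_of_int (snd (v + v' + x)) = (h * real_of_int (snd v) + h * real_of_int (snd v')) + h * real_of_int (snd x)"
      by (simp_all add: algebra_simps)
    show "0 \<le> h * real_of_int (fst (v + v' + x))" "h * real_of_int (fst (v + v' + x)) < 6 * R"
      "0 \<le> h * real_of_int (snd (v + v' + x))" "h * real_of_int (snd (v + v' + x)) < 6 * R"
      unfolding eq using s xw h R1 by linarith+
  qed
  have z0: "small 0" using P0 by (simp add: small_def)
  have inT1: "v + x \<in> torus N" if "small v" for v using inT2[OF that z0] by simp
  have sm: "small v1" "small v2" "small v3" "small s1" "small s2" "small s3"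
    unfolding small_def using size[OF _ v(1)] size[OF _ v(2)] size[OF _ v(3)] size[OF _ v(4)] size[OF _ v(5)] size[OF _ v(6)] by simp_all
  have cf': "config (near KA ?a h) (near KB ?a h) (+) x v1 v2 v3 s1 s2 s3"
    by (rule config_no_wrap[OF cf]) (elim insertE emptyE; simp only: inT1 inT2 sm)
  have dd: "10 * h + 2 * ?d \<le> e"
  proof -
    have "\<epsilon>' * (8 * t j) \<le> \<epsilon>' * (8 * R)" using tR[OF j(1)] t0[of j] \<epsilon>' by (intro mult_left_mono) auto
    then have "\<epsilon>' * (8 * t j) \<le> e" using \<epsilon>'(3) by linarith
    then have "\<epsilon>' * t j \<le> e / 8" by simp
    then show ?thesis using dle h(3) e by linarith
  qed
  obtain u1 u2 u3 u4 u5 u6 where u: "u1 \<in> {\<alpha> 0..\<beta> 0}" "u2 \<in> {\<alpha> 1..\<beta> 1}" "u3 \<in> {\<alpha> 2..\<beta> 2}"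
      "u4 \<in> {\<alpha> 3..\<beta> 3}" "u5 \<in> {\<alpha> 4..\<beta> 4}" "u6 \<in> {\<alpha> 5..\<beta> 5}"
    and d: "norm (h *\<^sub>R lat v1 - t j *\<^sub>R vector [u1, \<phi> u1]) \<le> ?d" "norm (h *\<^sub>R lat v2 - t j *\<^sub>R vector [u2, \<phi> u2]) \<le> ?d"
      "norm (h *\<^sub>R lat v3 - t j *\<^sub>R vector [u3, \<phi> u3]) \<le> ?d" "norm (h *\<^sub>R lat s1 - t j *\<^sub>R vector [u4, \<phi> u4]) \<le> ?d"
      "norm (h *\<^sub>R lat s2 - t j *\<^sub>R vector [u5, \<phi> u5]) \<le> ?d" "norm (h *\<^sub>R lat s3 - t j *\<^sub>R vector [u6, \<phi> u6]) \<le> ?d"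
    using close[OF v(1)] close[OF v(2)] close[OF v(3)] close[OF v(4)] close[OF v(5)] close[OF v(6)] by blast
  note fin = config_near_imp_infdist[OF cf' d dd]
  have "KA \<noteq> {}" "KB \<noteq> {}" using cf' by (auto simp: config_def near_def)
  then show ?thesis using j(1) fin u unfolding V_def by blast
qed

section \<open>The exact configuration\<close>

text \<open>The supremum over \<open>z\<close> stands outside the infimum over \<open>r\<close>, so
  one window of side \<open>R\<close> has a large average at all radii from \<open>M\<close> to
  \<open>R / 64\<close> at once, and many dilations can be treated in it. A positive upper limit
  provides such windows for arbitrarily large \<open>R\<close>.\<close>

lemma density_scales:
  assumes "vc_density A B > 0"
  obtains M c where "M \<ge> 1" "c > 0"
    "\<And>R0. \<exists>R\<ge>R0. \<exists>z. \<forall>r. M \<le> r \<and> r \<le> R / 64 \<longrightarrow> c \<le> vc_average A B R z r"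
proof -
  let ?g = "\<lambda>M R. SUP z. INF r\<in>{M..R / 2 ^ 6}. ereal (vc_average A B R z r)"
  obtain M where M: "M \<ge> 1" "0 < Limsup at_top (?g M)"
    using assms unfolding vc_density_def less_SUP_iff by auto
  obtain c where c: "0 < ereal c" "ereal c < Limsup at_top (?g M)" using ereal_dense2[OF M(2)] by auto
  show ?thesis
  proof (rule that[OF M(1)])
    show "c > 0" using c(1) by simp
    fix R0
    have "\<exists>R\<ge>R0. ereal c < ?g M R"
    proof (rule ccontr)
      assume "\<not> ?thesis"
      then have "\<forall>\<^sub>F R in at_top. ?g M R \<le> ereal c" unfolding eventually_at_top_linorder by (auto simp: not_less)
      then have "Limsup at_top (?g M) \<le> ereal c" by (rule Limsup_bounded)
      then show False using c(2) by simp
    qed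
    then obtain R z where R: "R \<ge> R0" "ereal c < (INF r\<in>{M..R / 2 ^ 6}. ereal (vc_average A B R z r))"
      unfolding less_SUP_iff by auto
    have "c \<le> vc_average A B R z r" if "M \<le> r" "r \<le> R / 64" for r
      using less_INF_D[OF R(2), of r] that by simp
    then show "\<exists>R\<ge>R0. \<exists>z. \<forall>r. M \<le> r \<and> r \<le> R / 64 \<longrightarrow> c \<le> vc_average A B R z r" using R(1) by blast
  qed
qed

text \<open>The first coordinates of the six vectors are taken near \<open>u + 2\<^sup>i e\<close> with \<open>e\<close> small
  compared with \<open>u\<close>, so that no two of the ten points can coincide.\<close>

lemma distinct_reals:
  fixes u e z1 z2 z3 y1 y2 y3 :: real
  assumes "e > 0" "1000 * e \<le> u" "u + e \<le> z1" "z1 \<le> u + e + e / 10" "u + 2 * e \<le> z2" "z2 \<le> u + 2 * e + e / 10"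
    "u + 4 * e \<le> z3" "z3 \<le> u + 4 * e + e / 10" "u + 8 * e \<le> y1" "y1 \<le> u + 8 * e + e / 10"
    "u + 16 * e \<le> y2" "y2 \<le> u + 16 * e + e / 10" "u + 32 * e \<le> y3" "y3 \<le> u + 32 * e + e / 10"
  shows "distinct [0, z1 + z2, z1 + z3, z2 + z3, z1 + y1, z2 + y2, z3 + y3, z1, z2, z3]"
  \<comment> \<open>In multiples of \<open>e\<close>, the single numbers exceed \<open>u\<close> by
    about 1, 2, 4, and the sums exceed \<open>2 * u\<close> by about 3, 5, 6, 9, 18, 36; the errors
    are at most \<open>e / 5\<close>.\<close>
  unfolding distinct.simps list.set insert_iff empty_iff de_Morgan_disj
  by (intro conjI; (use assms in \<open>linarith | simp\<close>))

lemma distinct_config_points: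
  fixes x v1 v2 v3 s1 s2 s3 :: "real^2"
  assumes t: "t > 0" and \<sigma>: "\<sigma> = 1 \<or> \<sigma> = -1" and e: "e > 0" "1000 * e \<le> u"
    and v: "v1 $ 1 = t * (\<sigma> * z1)" "v2 $ 1 = t * (\<sigma> * z2)" "v3 $ 1 = t * (\<sigma> * z3)"
      "s1 $ 1 = t * (\<sigma> * y1)" "s2 $ 1 = t * (\<sigma> * y2)" "s3 $ 1 = t * (\<sigma> * y3)"
    and z: "u + e \<le> z1" "z1 \<le> u + e + e / 10" "u + 2 * e \<le> z2" "z2 \<le> u + 2 * e + e / 10"
    "u + 4 * e \<le> z3" "z3 \<le> u + 4 * e + e / 10" "u + 8 * e \<le> y1" "y1 \<le> u + 8 * e + e / 10"
    "u + 16 * e \<le> y2" "y2 \<le> u + 16 * e + e / 10" "u + 32 * e \<le> y3" "y3 \<le> u + 32 * e + e / 10"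
  shows "distinct [x, x + v1 + v2, x + v1 + v3, x + v2 + v3, x + v1 + s1, x + v2 + s2, x + v3 + s3,
    x + v1, x + v2, x + v3]"
proof -
  let ?f = "\<lambda>p::real^2. (p $ 1 - x $ 1) / (t * \<sigma>)"
  have s: "t * \<sigma> \<noteq> 0" using t \<sigma> by auto
  let ?L = "[x, x + v1 + v2, x + v1 + v3, x + v2 + v3, x + v1 + s1, x + v2 + s2, x + v3 + s3, x + v1, x + v2, x + v3]"
  have eq: "map ?f ?L = [0, z1 + z2, z1 + z3, z2 + z3, z1 + y1, z2 + y2, z3 + y3, z1, z2, z3]"
    using s by (simp add: v field_simps)
  have "distinct (map ?f ?L)" unfolding eq by (rule distinct_reals[OF e z])
  then show ?thesis unfolding distinct_map by (rule conjunct1)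
qed

lemma curved_graph_subinterval:
  assumes "curved_graph \<phi> \<phi>1 \<phi>2 a b c C \<Lambda>" "a \<le> a'" "a' < b'" "b' \<le> b"
  shows "curved_graph \<phi> \<phi>1 \<phi>2 a' b' c C \<Lambda>"
proof -
  interpret curved_graph \<phi> \<phi>1 \<phi>2 a b c C \<Lambda> by fact
  show ?thesis by standard (use assms(2-) c \<phi>1 \<phi>2 c_le C \<Lambda> in auto)
qed

text \<open>The sign \<open>\<sigma>\<close> treats an interval of negative numbers like one of
  positive numbers. The offsets \<open>2 ^ i * e\<close> reach up to \<open>32 * e\<close>, so a
  hundredth of the length of the interval is a safe choice of \<open>e\<close>.\<close>

lemma six_arcs:
  fixes a b :: real
  assumes ab: "a < b" and ne: "0 < a \<or> b < 0"
  shows "\<exists>(\<alpha> :: nat \<Rightarrow> real) \<beta> u e \<sigma>. e > 0 \<and> 1000 * e \<le> u \<and> (\<sigma> = 1 \<or> \<sigma> = (-1 :: real)) \<and>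
    (\<forall>i<6. a \<le> \<alpha> i \<and> \<alpha> i + e / 10 = \<beta> i \<and> \<beta> i \<le> b) \<and>
    (\<forall>i<6. \<forall>s\<in>{\<alpha> i..\<beta> i}. u + 2 ^ i * e \<le> \<sigma> * s \<and> \<sigma> * s \<le> u + 2 ^ i * e + e / 10)"
proof -
  have p: "(2::real) ^ i \<le> 32" if "i < 6" for i :: nat
    using power_increasing[of i 5 "2::real"] that by auto
  show ?thesis
  proof (cases "0 < a")
    case True
    define e where "e = min ((b - a) / 100) (a / 1000)"
    have e: "e > 0" "100 * e \<le> b - a" "1000 * e \<le> a" using ab True by (auto simp: e_def min_def)
    have pe: "2 ^ i * e \<le> 32 * e \<and> 0 \<le> 2 ^ i * e" if "i < 6" for i :: nat
      using p[OF that] e by (auto intro: mult_right_mono)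
    have "a \<le> a + 2 ^ i * e \<and> a + 2 ^ i * e + e / 10 \<le> b" if "i < 6" for i :: nat
      using pe[OF that] e by linarith
    then show ?thesis using e
      by (intro exI[of _ "\<lambda>i. a + 2 ^ i * e"] exI[of _ "\<lambda>i. a + 2 ^ i * e + e / 10"] exI[of _ a] exI[of _ e] exI[of _ 1]) auto
  next
    case False
    then have b: "b < 0" using ne by auto
    define e where "e = min ((b - a) / 100) (- b / 1000)"
    have e: "e > 0" "100 * e \<le> b - a" "1000 * e \<le> - b" using ab b by (auto simp: e_def min_def)
    have pe: "2 ^ i * e \<le> 32 * e \<and> 0 \<le> 2 ^ i * e" if "i < 6" for i :: nat
      using p[OF that] e by (auto intro: mult_right_mono)
    have "a \<le> b - 2 ^ i * e - e / 10 \<and> b - 2 ^ i * e \<le> b" if "i < 6" for i :: nat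
      using pe[OF that] e by linarith
    then show ?thesis using e
      by (intro exI[of _ "\<lambda>i. b - 2 ^ i * e - e / 10"] exI[of _ "\<lambda>i. b - 2 ^ i * e"] exI[of _ "- b"] exI[of _ e] exI[of _ "-1"]) auto
  qed
qed

lemma exists_sparse_sequence:
  fixes \<rho> :: real
  assumes bad: "\<And>T. \<exists>t\<ge>T. Q t"
  obtains t :: "nat \<Rightarrow> real" where "\<And>j. Q (t j)" "t 0 \<ge> T0" "\<And>j. \<rho> * t j \<le> t (Suc j)"
proof -
  define s where "s T = (SOME t. t \<ge> T \<and> Q t)" for T
  have s: "s T \<ge> T" "Q (s T)" for T
    using someI_ex[OF bad[of T, unfolded Bex_def]] bad[of T] someI_ex[of "\<lambda>t. t \<ge> T \<and> Q t"] unfolding s_def by blast+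
  define t where "t = rec_nat (s T0) (\<lambda>_ x. s (\<rho> * x))"
  have "t 0 = s T0" "t (Suc j) = s (\<rho> * t j)" for j by (simp_all add: t_def)
  then show ?thesis using that[of t] s by (metis not0_implies_Suc)
qed

lemma compact_scaled_graph:
  assumes "\<And>u. u \<in> {\<alpha>..\<beta>} \<Longrightarrow> isCont \<phi> u"
  shows "compact ((\<lambda>u. t *\<^sub>R (vector [u, \<phi> u] :: real^2)) ` {\<alpha>..\<beta>})"
proof (rule compact_continuous_image)
  have c: "continuous_on {\<alpha>..\<beta>} \<phi>" using assms by (simp add: continuous_at_imp_continuous_on)
  have eq: "(vector [u, \<phi> u] :: real^2) = (\<chi> i. if i = 1 then u else \<phi> u)" for u
    by (simp add: vec_eq_iff forall_2)
  have "continuous_on {\<alpha>..\<beta>} (\<lambda>u. (\<chi> i. if i = 1 then u else \<phi> u) :: real^2)"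
  proof (rule continuous_on_vec_lambda)
    fix i :: 2
    show "continuous_on {\<alpha>..\<beta>} (\<lambda>u. if i = 1 then u else \<phi> u)" using c by (cases "i = 1") auto
  qed
  then show "continuous_on {\<alpha>..\<beta>} (\<lambda>u. t *\<^sub>R (vector [u, \<phi> u] :: real^2))"
    unfolding eq by (intro continuous_on_scaleR continuous_on_const)
qed simp

lemma config_mono:
  assumes "config a b T x v1 v2 v3 s1 s2 s3" "\<And>p. a p \<Longrightarrow> a' p" "\<And>p. b p \<Longrightarrow> b' p"
  shows "config a' b' T x v1 v2 v3 s1 s2 s3"
  using assms unfolding config_def by blast

text \<open>If each of finitely many \<open>j\<close> failed at some error, all would fail at the
  least of these errors, by monotonicity.\<close>

lemma exists_uniform_index:
  fixes S :: "real \<Rightarrow> nat \<Rightarrow> bool"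
  assumes ex: "\<And>e. e > 0 \<Longrightarrow> \<exists>j<J. S e j" and mono: "\<And>e e' j. S e j \<Longrightarrow> e \<le> e' \<Longrightarrow> S e' j"
  shows "\<exists>j<J. \<forall>e>0. S e j"
proof (rule ccontr)
  assume "\<not> ?thesis"
  then have "\<forall>j<J. \<exists>e>0. \<not> S e j" by blast
  then obtain f where f: "\<And>j. j < J \<Longrightarrow> f j > 0 \<and> \<not> S (f j) j" by metis
  define e where "e = Min (insert 1 (f ` {..<J}))"
  have "e > 0" using f by (auto simp: e_def)
  then obtain j where j: "j < J" "S e j" using ex by blast
  have "e \<le> f j" using j(1) by (auto simp: e_def intro: Min_le)
  then show False using mono[OF j(2)] f[OF j(1)] by blast
qed

theorem theorem1p7:
  fixes A B \<Gamma> :: "(real^2) set"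
  assumes "A \<in> sets lebesgue" and "B \<in> sets lebesgue"
    and "vc_density A B > 0"
    and "closed_smooth_curve_nonvanishing_curvature \<Gamma>"
    and "uminus ` \<Gamma> = \<Gamma>"
    and "\<exists>K. compact K \<and> convex K \<and> interior K \<noteq> {} \<and> \<Gamma> = frontier K"
  shows "\<exists>t0>0. \<forall>t\<ge>t0. \<exists>x\<in>B.
    \<exists>v1 \<in> (\<lambda>p. t *\<^sub>R p) ` \<Gamma>. \<exists>v2 \<in> (\<lambda>p. t *\<^sub>R p) ` \<Gamma>. \<exists>v3 \<in> (\<lambda>p. t *\<^sub>R p) ` \<Gamma>.
    \<exists>s1 \<in> (\<lambda>p. t *\<^sub>R p) ` \<Gamma>. \<exists>s2 \<in> (\<lambda>p. t *\<^sub>R p) ` \<Gamma>. \<exists>s3 \<in> (\<lambda>p. t *\<^sub>R p) ` \<Gamma>.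
      {x, x + v1 + v2, x + v1 + v3, x + v2 + v3,
       x + v1 + s1, x + v2 + s2, x + v3 + s3} \<subseteq> B \<and>
      {x + v1, x + v2, x + v3} \<subseteq> A \<and>
      distinct [x, x + v1 + v2, x + v1 + v3, x + v2 + v3,
                x + v1 + s1, x + v2 + s2, x + v3 + s3,
                x + v1, x + v2, x + v3]"
proof -
  define Q where "Q t \<longleftrightarrow> (\<exists>x\<in>B.
    \<exists>v1 \<in> (\<lambda>p. t *\<^sub>R p) ` \<Gamma>. \<exists>v2 \<in> (\<lambda>p. t *\<^sub>R p) ` \<Gamma>. \<exists>v3 \<in> (\<lambda>p. t *\<^sub>R p) ` \<Gamma>.
    \<exists>s1 \<in> (\<lambda>p. t *\<^sub>R p) ` \<Gamma>. \<exists>s2 \<in> (\<lambda>p. t *\<^sub>R p) ` \<Gamma>. \<exists>s3 \<in> (\<lambda>p. t *\<^sub>R p) ` \<Gamma>.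
      {x, x + v1 + v2, x + v1 + v3, x + v2 + v3,
       x + v1 + s1, x + v2 + s2, x + v3 + s3} \<subseteq> B \<and>
      {x + v1, x + v2, x + v3} \<subseteq> A \<and>
      distinct [x, x + v1 + v2, x + v1 + v3, x + v2 + v3,
                x + v1 + s1, x + v2 + s2, x + v3 + s3,
                x + v1, x + v2, x + v3])" for t :: real
  have "\<exists>t0>0. \<forall>t\<ge>t0. Q t"
  proof (rule ccontr)
    assume neg: "\<not> (\<exists>t0>0. \<forall>t\<ge>t0. Q t)"
    have bad: "\<exists>t\<ge>T. \<not> Q t" for T
    proof -
      have "max T 1 > 0" by simp
      then obtain t where "t \<ge> max T 1" "\<not> Q t" using neg by blast
      then show ?thesis by (intro exI[of _ t]) simp
    qed
    obtain \<phi> \<phi>1 \<phi>2 a b cc C \<Lambda> where cg: "curved_graph \<phi> \<phi>1 \<phi>2 a b cc C \<Lambda>"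
      and \<Gamma>: "\<And>u. u \<in> {a..b} \<Longrightarrow> vector [u, \<phi> u] \<in> \<Gamma>" and ab0: "0 < a \<or> b < 0"
      using curve_contains_curved_graph[OF assms(4)] by metis
    interpret curved_graph \<phi> \<phi>1 \<phi>2 a b cc C \<Lambda> by (rule cg)
    obtain \<alpha> \<beta> :: "nat \<Rightarrow> real" and u0 e0 \<sigma> where e0: "e0 > 0" "1000 * e0 \<le> u0" and \<sigma>: "\<sigma> = 1 \<or> \<sigma> = (-1 :: real)"
      and arcs: "\<And>i. i < 6 \<Longrightarrow> a \<le> \<alpha> i \<and> \<alpha> i + e0 / 10 = \<beta> i \<and> \<beta> i \<le> b"
      and pos: "\<And>i s. i < 6 \<Longrightarrow> s \<in> {\<alpha> i..\<beta> i} \<Longrightarrow> u0 + 2 ^ i * e0 \<le> \<sigma> * s \<and> \<sigma> * s \<le> u0 + 2 ^ i * e0 + e0 / 10"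
      using six_arcs[OF \<alpha>\<beta> ab0] by blast
    have sub: "u \<in> {a..b}" if "i < 6" "u \<in> {\<alpha> i..\<beta> i}" for i u using arcs[OF that(1)] that(2) by auto
    have cgi: "curved_graph \<phi> \<phi>1 \<phi>2 (\<alpha> i) (\<beta> i) cc C \<Lambda>" if "i < 6" for i
      by (rule curved_graph_subinterval[OF cg]) (use arcs[OF that] e0 in auto)
    have cont: "isCont \<phi> u" "isCont \<phi>1 u" if "u \<in> {a..b}" for u
      by (rule DERIV_isCont[OF \<phi>1[OF that]], rule DERIV_isCont[OF \<phi>2[OF that]])
    have "bounded (\<phi> ` {a..b})" "bounded (\<phi>1 ` {a..b})"
      using cont by (auto intro!: compact_imp_bounded compact_continuous_image continuous_at_imp_continuous_on)
    then obtain P1 P2 where P12: "\<And>u. u \<in> {a..b} \<Longrightarrow> \<bar>\<phi> u\<bar> \<le> P1" "\<And>u. u \<in> {a..b} \<Longrightarrow> \<bar>\<phi>1 u\<bar> \<le> P2"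
      unfolding bounded_iff real_norm_def by blast
    define P where "P = 1 + \<bar>P1\<bar> + \<bar>P2\<bar> + \<bar>a\<bar> + \<bar>b\<bar>"
    have P: "P \<ge> 1" by (simp add: P_def)
    have Pb: "\<bar>u\<bar> \<le> P \<and> \<bar>\<phi> u\<bar> \<le> P \<and> \<bar>\<phi>1 u\<bar> \<le> P" if "i < 6" "u \<in> {\<alpha> i..\<beta> i}" for i u
    proof -
      have u: "u \<in> {a..b}" by (rule sub[OF that])
      have "P1 \<le> P" "P2 \<le> P" "\<bar>a\<bar> \<le> P" "\<bar>b\<bar> \<le> P" unfolding P_def by linarith+
      then show ?thesis using P12[OF u] u by auto
    qed
    define w where "w = min 1 (e0 / 10)"
    have w: "0 < w" "w \<le> 1" using e0 by (auto simp: w_def)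
    have wi: "w \<le> \<beta> i - \<alpha> i" if "i < 6" for i using arcs[OF that] by (auto simp: w_def)
    obtain M c where M: "M \<ge> 1" and c: "c > 0"
      and dens: "\<And>R0. \<exists>R\<ge>R0. \<exists>z. \<forall>r. M \<le> r \<and> r \<le> R / 64 \<longrightarrow> c \<le> vc_average A B R z r"
      using density_scales[OF assms(3)] by metis
    define c1 where "c1 = c / 819200"
    have c1: "c1 > 0" using c by (simp add: c1_def)
    show False
    proof (rule uniform_params[where k = 6 and \<alpha> = \<alpha> and \<beta> = \<beta> and e = "(c1 / 24)\<^sup>2 / 4"])
    show "curved_graph \<phi> \<phi>1 \<phi>2 (\<alpha> i) (\<beta> i) cc C \<Lambda>" if "i < 6" for i by (rule cgi[OF that])
    show "(c1 / 24)\<^sup>2 / 4 > 0" "0 < (6 :: nat)" using c1 by simp_all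
    fix \<epsilon>0 K n0 assume \<epsilon>0: "\<epsilon>0 > 0" and K: "K > 0" and n0: "n0 > 0" and pair0:
      "\<And>i n (\<sigma> :: int \<Rightarrow> int \<Rightarrow> real) (y :: int). i < 6 \<Longrightarrow> n \<ge> n0 \<Longrightarrow> (\<And>d z. \<bar>\<sigma> d z\<bar> \<le> 1) \<Longrightarrow>
      (\<And>d z w. \<bar>\<sigma> d z - \<sigma> d w\<bar> \<le> K * \<bar>real_of_int z - real_of_int w\<bar>) \<Longrightarrow>
      0 \<le> y \<Longrightarrow> of_int y \<le> \<epsilon>0 * n \<Longrightarrow>
      \<bar>avg (graph_points (\<alpha> i) (\<beta> i) n) (\<lambda>p. avg (graph_points (\<alpha> i) (\<beta> i) n) (\<lambda>q. \<sigma> (p - q) (graph_floor \<phi> n p - graph_floor \<phi> n q + y)))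
        - avg (graph_points (\<alpha> i) (\<beta> i) n) (\<lambda>p. avg (graph_points (\<alpha> i) (\<beta> i) n) (\<lambda>q. \<sigma> (p - q) (graph_floor \<phi> n p - graph_floor \<phi> n q)))\<bar> \<le> (c1 / 24)\<^sup>2 / 4"
    define \<epsilon> where "\<epsilon> = min 1 \<epsilon>0"
    have \<epsilon>: "0 < \<epsilon>" "\<epsilon> \<le> 1" "\<epsilon> \<le> \<epsilon>0" using \<epsilon>0 by (auto simp: \<epsilon>_def)
    have pair: "\<bar>avg (graph_points (\<alpha> i) (\<beta> i) n) (\<lambda>p. avg (graph_points (\<alpha> i) (\<beta> i) n) (\<lambda>q. \<sigma> (p - q) (graph_floor \<phi> n p - graph_floor \<phi> n q + y)))
        - avg (graph_points (\<alpha> i) (\<beta> i) n) (\<lambda>p. avg (graph_points (\<alpha> i) (\<beta> i) n) (\<lambda>q. \<sigma> (p - q) (graph_floor \<phi> n p - graph_floor \<phi> n q)))\<bar> \<le> (c1 / 24)\<^sup>2 / 4"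
      if "i < 6" "n \<ge> n0" "\<And>d z. \<bar>\<sigma> d z\<bar> \<le> 1" "\<And>d z w. \<bar>\<sigma> d z - \<sigma> d w\<bar> \<le> K * \<bar>real_of_int z - real_of_int w\<bar>"
       "0 \<le> y" "of_int y \<le> \<epsilon> * n" for i n and \<sigma> :: "int \<Rightarrow> int \<Rightarrow> real" and y :: int
    proof (rule pair0[OF that(1-5)])
      have "\<epsilon> * n \<le> \<epsilon>0 * n" using \<epsilon>(3) that(2) n0 by (intro mult_right_mono) auto
      then show "real_of_int y \<le> \<epsilon>0 * n" using that(6) by linarith
    qed
    \<comment> \<open>\<open>\<kappa>'\<close> makes the large scale so long that averages over it
      hardly change along the vectors; \<open>\<kappa>\<close> makes the small scale short compared
      with the length and thickness of the arcs.\<close>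
    define \<kappa>' where "\<kappa>' = max (2 * (P + 7)) (1600 * (P + 7) / c1)"
    have \<kappa>'1: "2 * (P + 7) \<le> \<kappa>'" by (simp add: \<kappa>'_def)
    have "2 * (P + 7) > 0" using P by simp
    then have k'0: "\<kappa>' > 0" using \<kappa>'1 by (rule less_le_trans)
    have \<kappa>'2: "8 * (P + 7) / \<kappa>' \<le> c1 / 200"
    proof -
      have "1600 * (P + 7) / c1 \<le> \<kappa>'" by (simp add: \<kappa>'_def)
      then show ?thesis using c1 k'0 by (simp add: field_simps)
    qed
    define s where "s = 4 / w + 4 * (P + 1) / \<epsilon>"
    have s: "s > 0" unfolding s_def using w P \<epsilon> by (intro add_pos_nonneg) auto
    define \<kappa> where "\<kappa> = min \<kappa>' (c1 / (400 * s))"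
    have \<kappa>0: "\<kappa> > 0" "\<kappa> \<le> \<kappa>'" using k'0 c1 s by (auto simp: \<kappa>_def)
    have \<kappa>1: "4 * \<kappa> / w + 4 * (P + 1) * \<kappa> / \<epsilon> \<le> c1 / 400"
    proof -
      have "4 * \<kappa> / w + 4 * (P + 1) * \<kappa> / \<epsilon> = s * \<kappa>" by (simp add: s_def distrib_right)
      also have "\<dots> \<le> s * (c1 / (400 * s))" using s by (intro mult_left_mono) (auto simp: \<kappa>_def)
      also have "\<dots> = c1 / 400" using s by simp
      finally show ?thesis .
    qed
    \<comment> \<open>\<open>F\<close> is the coefficient of \<open>\<delta> / \<eta>\<close> in the
      structured error. It determines \<open>\<delta>\<close>, and \<open>\<delta>\<close>
      determines the number \<open>J\<close> of dilations.\<close>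
    define F where "F = 6 + 96 * (16 * \<kappa>'\<^sup>2 / (w * \<epsilon>))\<^sup>2"
    have F: "F > 0" unfolding F_def by (intro add_pos_nonneg) auto
    define \<delta> where "\<delta> = (c1 / 20) * (c1 / 200) / F"
    have \<delta>0: "\<delta> > 0" using c1 F by (simp add: \<delta>_def)
    have \<delta>: "(6 + 96 * (16 * \<kappa>'\<^sup>2 / (w * \<epsilon>))\<^sup>2) * \<delta> / (c1 / 200) \<le> c1 / 20"
    proof -
      have "F * \<delta> / (c1 / 200) = c1 / 20" using F c1 by (simp add: \<delta>_def)
      then show ?thesis by (simp only: F_def)
    qed
    define J where "J = Suc (nat \<lceil>6 / \<delta>\<rceil>)"
    have J: "J > 0" "6 / real J \<le> \<delta>"
    proof -
      show "J > 0" by (simp add: J_def)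
      have "6 / \<delta> \<le> real J" unfolding J_def by linarith
      then show "6 / real J \<le> \<delta>" using \<delta>0 \<open>J > 0\<close> by (simp add: field_simps)
    qed
    \<comment> \<open>Dilations without a configuration, starting at \<open>M\<close>, where the
      density bound begins. The ratio leaves room for the large scale of one dilation to be the
      small scale of the next.\<close>
    obtain t where tQ: "\<And>j. \<not> Q (t j)" and t0: "t 0 \<ge> M" and tS: "\<And>j. (2 * \<kappa>' / \<kappa>) * t j \<le> t (Suc j)"
      using exists_sparse_sequence[of "\<lambda>t. \<not> Q t" M "2 * \<kappa>' / \<kappa>", OF bad] by blast
    have r1: "1 \<le> 2 * \<kappa>' / \<kappa>" using \<kappa>0 by (simp add: field_simps)
    have tM: "M \<le> t j \<and> t j \<le> t (Suc j)" for j
    proof (induction j)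
      case 0
      have "1 * t 0 \<le> (2 * \<kappa>' / \<kappa>) * t 0" using r1 t0 M by (intro mult_right_mono) auto
      then show ?case using t0 tS[of 0] by linarith
    next
      case (Suc j)
      then have m: "M \<le> t (Suc j)" by linarith
      have "1 * t (Suc j) \<le> (2 * \<kappa>' / \<kappa>) * t (Suc j)" using r1 m M by (intro mult_right_mono) auto
      then show ?case using m tS[of "Suc j"] by linarith
    qed
    have t1: "1 \<le> t j" for j using tM[of j] M by linarith
    have tk: "2 * \<kappa>' * t j \<le> \<kappa> * t (Suc j)" for j using tS[of j] \<kappa>0 by (simp add: field_simps)
    have tmono: "t j \<le> t J" if "j < J" for j
      by (rule lift_Suc_mono_le[of t]) (use tM that in auto)
    \<comment> \<open>The factor 64 brings all dilations into the range
      \<open>r \<le> R / 64\<close> of the density bound, and \<open>P + 7\<close> makes the vectors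
      short compared with the window.\<close>
    obtain R z where R: "R \<ge> 64 * (P + 7) * t J" and avg: "\<And>r. M \<le> r \<Longrightarrow> r \<le> R / 64 \<Longrightarrow> c \<le> vc_average A B R z r"
      using dens[of "64 * (P + 7) * t J"] by blast
    have RJ: "64 * (P + 7) * t j \<le> R" if "j < J" for j
    proof -
      have "64 * (P + 7) * t j \<le> 64 * (P + 7) * t J" using tmono[OF that] P by (intro mult_left_mono) auto
      then show ?thesis using R by linarith
    qed
    have R4: "4 * (P + 7) * t j \<le> R" if "j < J" for j
    proof -
      have "4 * (P + 7) * t j \<le> 64 * (P + 7) * t j" using P t1[of j] by (intro mult_right_mono) auto
      then show ?thesis using RJ[OF that] by linarith
    qed
    have avgj: "c \<le> vc_average A B R z (t j)" if "j < J" for j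
    proof (rule avg)
      show "M \<le> t j" using tM by blast
      have "64 * t j \<le> 64 * (P + 7) * t j" using P t1[of j] by (intro mult_right_mono) auto
      then show "t j \<le> R / 64" using RJ[OF that] by simp
    qed
    define W where "W = cbox (z - vec R) (z + vec (2 * R))"
    have Wb: "bounded W" "W \<in> sets lebesgue" by (auto simp: W_def)
    have "c / 40 > 0" using c by simp
    obtain KA OA where KA: "compact KA" "KA \<subseteq> A \<inter> W" "A \<inter> W \<subseteq> KA \<union> OA" "open OA" "emeasure lborel OA \<le> ennreal (c / 40)"
      by (rule compact_plus_small_open[OF assms(1) Wb \<open>c / 40 > 0\<close>])
    obtain KB OB where KB: "compact KB" "KB \<subseteq> B \<inter> W" "B \<inter> W \<subseteq> KB \<union> OB" "open OB" "emeasure lborel OB \<le> ennreal (c / 40)"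
      by (rule compact_plus_small_open[OF assms(2) Wb \<open>c / 40 > 0\<close>])
    have O': "open (OA \<union> OB)" "emeasure lborel (OA \<union> OB) \<le> ennreal (c / 20)"
    proof -
      show "open (OA \<union> OB)" using KA KB by auto
      have "emeasure lborel (OA \<union> OB) \<le> emeasure lborel OA + emeasure lborel OB"
        using KA KB by (intro emeasure_subadditive) auto
      also have "\<dots> \<le> ennreal (c / 40) + ennreal (c / 40)" using KA KB by (intro add_mono)
      also have "\<dots> = ennreal (c / 20)" using c by (subst ennreal_plus[symmetric]) auto
      finally show "emeasure lborel (OA \<union> OB) \<le> ennreal (c / 20)" .
    qed
    have cov: "A \<inter> W \<subseteq> KA \<union> (OA \<union> OB)" "B \<inter> W \<subseteq> KB \<union> (OA \<union> OB)" using KA(3) KB(3) by auto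
    have KW: "KA \<subseteq> W" "KB \<subseteq> W" using KA(2) KB(2) by auto
    define V where "V j i = (\<lambda>u. t j *\<^sub>R (vector [u, \<phi> u] :: real^2)) ` {\<alpha> i..\<beta> i}" for j i
    define S where "S e j \<longleftrightarrow> KA \<noteq> {} \<and> KB \<noteq> {} \<and> (\<exists>x. \<exists>v1\<in>V j 0. \<exists>v2\<in>V j 1. \<exists>v3\<in>V j 2. \<exists>s1\<in>V j 3. \<exists>s2\<in>V j 4. \<exists>s3\<in>V j 5.
      config (\<lambda>p. infdist p KA \<le> e) (\<lambda>p. infdist p KB \<le> e) (+) x v1 v2 v3 s1 s2 s3)" for e j
    \<comment> \<open>Fixing one dilation for all errors makes the arcs \<open>V j i\<close> fixed
      compact sets, as the passage to the limit demands.\<close>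
    have "\<exists>j<J. \<forall>e>0. S e j"
    proof (rule exists_uniform_index)
      fix e :: real assume e: "e > 0"
      show "\<exists>j<J. S e j" unfolding S_def V_def
        by (rule approx_at_scale[where \<alpha> = \<alpha> and \<beta> = \<beta> and \<phi> = \<phi> and t = t and A = A and B = B and W = W and P = P and w = w
            and \<epsilon> = \<epsilon> and c = c and K = K and \<kappa> = \<kappa> and \<kappa>' = \<kappa>' and \<delta> = \<delta> and R = R and z = z])
          (fact cgi P Pb w wi \<epsilon> c c1_def pair K n0 \<kappa>0 \<kappa>1 \<kappa>'1 \<kappa>'2 J \<delta> t1 tk R4 cov W_def KW O' avgj e)+
    next
      fix e e' j assume S: "S e j" and e: "e \<le> e'"
      have "config (\<lambda>p. infdist p KA \<le> e') (\<lambda>p. infdist p KB \<le> e') (+) x v1 v2 v3 s1 s2 s3"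
        if "config (\<lambda>p. infdist p KA \<le> e) (\<lambda>p. infdist p KB \<le> e) (+) x v1 v2 v3 s1 s2 s3" for x v1 v2 v3 s1 s2 s3
        by (rule config_mono[OF that]) (use e in linarith)+
      then show "S e' j" using S unfolding S_def by blast
    qed
    then obtain j where Sj: "\<And>e. e > 0 \<Longrightarrow> S e j" by blast
    have ne: "KA \<noteq> {}" "KB \<noteq> {}" using Sj[of 1] by (auto simp: S_def)
    have cV: "compact (V j i)" if "i < 6" for i
      unfolding V_def by (rule compact_scaled_graph[OF cont(1)[OF sub[OF that]]])
    have "\<exists>x. \<exists>v1\<in>V j 0. \<exists>v2\<in>V j 1. \<exists>v3\<in>V j 2. \<exists>s1\<in>V j 3. \<exists>s2\<in>V j 4. \<exists>s3\<in>V j 5.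
      config (\<lambda>p. p \<in> KA) (\<lambda>p. p \<in> KB) (+) x v1 v2 v3 s1 s2 s3"
    proof (rule compact_config[OF KA(1) ne(1) KB(1) ne(2)])
      fix e :: real assume "e > 0"
      from Sj[OF this] show "\<exists>x. \<exists>v1\<in>V j 0. \<exists>v2\<in>V j 1. \<exists>v3\<in>V j 2. \<exists>s1\<in>V j 3. \<exists>s2\<in>V j 4. \<exists>s3\<in>V j 5.
        config (\<lambda>p. infdist p KA \<le> e) (\<lambda>p. infdist p KB \<le> e) (+) x v1 v2 v3 s1 s2 s3"
        unfolding S_def by (elim conjE)
    qed (rule cV, simp)+
    then obtain x v1 v2 v3 s1 s2 s3 where v: "v1 \<in> V j 0" "v2 \<in> V j 1" "v3 \<in> V j 2" "s1 \<in> V j 3" "s2 \<in> V j 4" "s3 \<in> V j 5"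
      and cf: "config (\<lambda>p. p \<in> KA) (\<lambda>p. p \<in> KB) (+) x v1 v2 v3 s1 s2 s3" by blast
    have on\<Gamma>: "v \<in> (\<lambda>p. t j *\<^sub>R p) ` \<Gamma>" if "i < 6" "v \<in> V j i" for i v
      using that \<Gamma> sub[OF that(1)] by (auto simp: V_def)
    have coord: "\<exists>y. v $ 1 = t j * (\<sigma> * y) \<and> u0 + 2 ^ i * e0 \<le> y \<and> y \<le> u0 + 2 ^ i * e0 + e0 / 10" if i: "i < 6" and vi: "v \<in> V j i" for i v
    proof -
      obtain u where u: "u \<in> {\<alpha> i..\<beta> i}" "v = t j *\<^sub>R vector [u, \<phi> u]" using vi by (auto simp: V_def)
      have "\<sigma> * (\<sigma> * u) = u" using \<sigma> by auto
      then have "v $ 1 = t j * (\<sigma> * (\<sigma> * u))" using u(2) by simp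
      then show ?thesis using pos[OF i u(1)] by blast
    qed
    have "\<exists>y. v1 $ 1 = t j * (\<sigma> * y) \<and> u0 + e0 \<le> y \<and> y \<le> u0 + e0 + e0 / 10"
      using coord[OF _ v(1)] by simp
    then obtain z1 where z1: "v1 $ 1 = t j * (\<sigma> * z1)" "u0 + e0 \<le> z1" "z1 \<le> u0 + e0 + e0 / 10" by blast
    have "\<exists>y. v2 $ 1 = t j * (\<sigma> * y) \<and> u0 + 2 * e0 \<le> y \<and> y \<le> u0 + 2 * e0 + e0 / 10"
      using coord[OF _ v(2)] by simp
    then obtain z2 where z2: "v2 $ 1 = t j * (\<sigma> * z2)" "u0 + 2 * e0 \<le> z2" "z2 \<le> u0 + 2 * e0 + e0 / 10" by blast
    have "\<exists>y. v3 $ 1 = t j * (\<sigma> * y) \<and> u0 + 4 * e0 \<le> y \<and> y \<le> u0 + 4 * e0 + e0 / 10"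
      using coord[OF _ v(3)] by simp
    then obtain z3 where z3: "v3 $ 1 = t j * (\<sigma> * z3)" "u0 + 4 * e0 \<le> z3" "z3 \<le> u0 + 4 * e0 + e0 / 10" by blast
    have "\<exists>y. s1 $ 1 = t j * (\<sigma> * y) \<and> u0 + 8 * e0 \<le> y \<and> y \<le> u0 + 8 * e0 + e0 / 10"
      using coord[OF _ v(4)] by simp
    then obtain y1 where y1: "s1 $ 1 = t j * (\<sigma> * y1)" "u0 + 8 * e0 \<le> y1" "y1 \<le> u0 + 8 * e0 + e0 / 10" by blast
    have "\<exists>y. s2 $ 1 = t j * (\<sigma> * y) \<and> u0 + 16 * e0 \<le> y \<and> y \<le> u0 + 16 * e0 + e0 / 10"
      using coord[OF _ v(5)] by simp
    then obtain y2 where y2: "s2 $ 1 = t j * (\<sigma> * y2)" "u0 + 16 * e0 \<le> y2" "y2 \<le> u0 + 16 * e0 + e0 / 10" by blast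
    have "\<exists>y. s3 $ 1 = t j * (\<sigma> * y) \<and> u0 + 32 * e0 \<le> y \<and> y \<le> u0 + 32 * e0 + e0 / 10"
      using coord[OF _ v(6)] by simp
    then obtain y3 where y3: "s3 $ 1 = t j * (\<sigma> * y3)" "u0 + 32 * e0 \<le> y3" "y3 \<le> u0 + 32 * e0 + e0 / 10" by blast
    note coords = z1(1) z2(1) z3(1) y1(1) y2(1) y3(1)
    note zb = z1(2,3) z2(2,3) z3(2,3) y1(2,3) y2(2,3) y3(2,3)
    have tp: "t j > 0" using t1[of j] by linarith
    have dist: "distinct [x, x + v1 + v2, x + v1 + v3, x + v2 + v3, x + v1 + s1, x + v2 + s2, x + v3 + s3,
        x + v1, x + v2, x + v3]"
      by (rule distinct_config_points[OF tp \<sigma> e0 coords zb])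
    have xB: "x \<in> B"
      and pts: "{x, x + v1 + v2, x + v1 + v3, x + v2 + v3, x + v1 + s1, x + v2 + s2, x + v3 + s3} \<subseteq> B"
      "{x + v1, x + v2, x + v3} \<subseteq> A"
      using cf KA(2) KB(2) by (auto simp: config_def add.commute add.left_commute)
    have tv: "v1 \<in> (\<lambda>p. t j *\<^sub>R p) ` \<Gamma>" "v2 \<in> (\<lambda>p. t j *\<^sub>R p) ` \<Gamma>" "v3 \<in> (\<lambda>p. t j *\<^sub>R p) ` \<Gamma>" "s1 \<in> (\<lambda>p. t j *\<^sub>R p) ` \<Gamma>" "s2 \<in> (\<lambda>p. t j *\<^sub>R p) ` \<Gamma>" "s3 \<in> (\<lambda>p. t j *\<^sub>R p) ` \<Gamma>"
      by (rule on\<Gamma>[OF _ v(1)] on\<Gamma>[OF _ v(2)] on\<Gamma>[OF _ v(3)] on\<Gamma>[OF _ v(4)] on\<Gamma>[OF _ v(5)] on\<Gamma>[OF _ v(6)], simp)+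
    have "Q (t j)" unfolding Q_def
      by (rule bexI[of _ x], rule bexI[of _ v1], rule bexI[of _ v2], rule bexI[of _ v3], rule bexI[of _ s1],
          rule bexI[of _ s2], rule bexI[of _ s3], intro conjI)
        (fact pts dist xB tv)+
    then show False using tQ by blast
    qed
  qed
  then show ?thesis unfolding Q_def .
qed

end
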